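(* Let $\mathcal M$ be a sufficiently saturated o-minimal expansion of an ordered group and let $\mathcal U$ be a connected abelian $\bigvee$-definable group which is definably generated. Assume that $X\subseteq\mathcal U$ is a definable set and $\Lambda\leqslant\mathcal U$ is a finitely generated subgroup such that $X+\Lambda=\mathcal U$. Then there is a subgroup $\Lambda'\subseteq\Lambda$ such that $\mathcal U/\Lambda'$ is a definable group. If $\mathcal U$ is generated by a definably compact set, then $\mathcal U/\Lambda'$ is moreover definably compact.
   Context: A $\bigvee$-definable group is a group whose universe is a directed union of a small family of definable subsets of $M^n$ (fixed $n$), with the group operation restricted to each pair of these sets definable; a map is $\bigvee$-definable if its restriction to every definable subset is definable; definably generated means generated by a definable subset. Connectedness and definable compactness refer to the canonical group topology of $\mathcal U$ (covered by a small family of definable sets each definably homeomorphic to an open subset of $M^{\dim\mathcal U}$, continuous transitions and group operations); connected means no compatible $\bigvee$-definable $\emptyset\subsetneq\mathcal V\subsetneq\mathcal U$ is both open and closed (compatible: $\mathcal V\cap Y$ definable for all definable $Y\subseteq\mathcal U$). "$\mathcal U/\Lambda'$ is a definable group" means there exist a definable group $\overline K$ and a surjective $\bigvee$-definable homomorphism $\mu:\mathcal U\to\overline K$ with kernel $\Lambda'$; "definably compact" then refers to $\overline K$. *)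

theory Defs
  imports
    "HOL-Algebra.Generated_Groups"
    "HOL-Algebra.Coset"
    "HOL-Analysis.Function_Topology"
    "HOL-Analysis.Product_Topology"
    "HOL-Analysis.Abstract_Limits"
begin

text \<open>The universe of the structure is a type carrying an ordered group. Commutativity is not
  required, and \<open>open\<close> is the order topology by the axioms of \<^class>\<open>linorder_topology\<close>.\<close>

class linordered_group_add = group_add + linorder_topology +
  assumes add_left_mono_group: "x \<le> y \<Longrightarrow> z + x \<le> z + y"
    and add_right_mono_group: "x \<le> y \<Longrightarrow> x + z \<le> y + z"

subsection \<open>First-order structures expanding an ordered group\<close>

text \<open>The symbols for addition and order are built into the syntax; \<open>'f\<close> and \<open>'r\<close> are the types of
  the additional function and relation symbols. Arities are not declared: a symbol applied to
  argument lists of different lengths plays the role of different symbols.\<close>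

datatype 'f trm = Var nat | Add "'f trm" "'f trm" | Fn 'f "'f trm list"

datatype ('f, 'r) fm =
    Eq "'f trm" "'f trm"
  | Less "'f trm" "'f trm"
  | Rel 'r "'f trm list"
  | Neg "('f, 'r) fm"
  | Conj "('f, 'r) fm" "('f, 'r) fm"
  | Ex nat "('f, 'r) fm"

record ('a, 'f, 'r) interp =
  fun_interp :: "'f \<Rightarrow> 'a list \<Rightarrow> 'a"
  rel_interp :: "'r \<Rightarrow> 'a list \<Rightarrow> bool"

primrec trm_val :: "('a::plus, 'f, 'r) interp \<Rightarrow> (nat \<Rightarrow> 'a) \<Rightarrow> 'f trm \<Rightarrow> 'a" where
  "trm_val M e (Var i) = e i"
| "trm_val M e (Add s t) = trm_val M e s + trm_val M e t"
| "trm_val M e (Fn f ts) = fun_interp M f (map (trm_val M e) ts)"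

primrec sat :: "('a::{plus,ord}, 'f, 'r) interp \<Rightarrow> (nat \<Rightarrow> 'a) \<Rightarrow> ('f, 'r) fm \<Rightarrow> bool" where
  "sat M e (Eq s t) \<longleftrightarrow> trm_val M e s = trm_val M e t"
| "sat M e (Less s t) \<longleftrightarrow> trm_val M e s < trm_val M e t"
| "sat M e (Rel r ts) \<longleftrightarrow> rel_interp M r (map (trm_val M e) ts)"
| "sat M e (Neg \<phi>) \<longleftrightarrow> \<not> sat M e \<phi>"
| "sat M e (Conj \<phi> \<psi>) \<longleftrightarrow> sat M e \<phi> \<and> sat M e \<psi>"
| "sat M e (Ex i \<phi>) \<longleftrightarrow> (\<exists>x. sat M (e(i := x)) \<phi>)"

text \<open>Elements of $M^n$ are lists of length \<open>n\<close>. Definability is with parameters: the variables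
  below \<open>n\<close> hold the tuple, and \<open>e\<close> assigns parameters to the others.\<close>

definition definable ::
    "('a::{plus,ord}, 'f, 'r) interp \<Rightarrow> nat \<Rightarrow> 'a list set \<Rightarrow> bool" where
  "definable M n D \<longleftrightarrow>
     (\<exists>\<phi> e. D = {xs. length xs = n \<and> sat M (\<lambda>i. if i < n then xs ! i else e i) \<phi>})"

definition definable_fun ::
    "('a::{plus,ord}, 'f, 'r) interp \<Rightarrow> nat \<Rightarrow> nat \<Rightarrow> 'a list set \<Rightarrow> ('a list \<Rightarrow> 'a list) \<Rightarrow> bool" where
  "definable_fun M n m D f \<longleftrightarrow>
     (\<forall>x\<in>D. length (f x) = m) \<and> definable M (n + m) {x @ f x |x. x \<in> D}"

definition open_intervals :: "'a::linorder set set" where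
  "open_intervals =
     {{a<..<b} |a b. True} \<union> {{a<..} |a. True} \<union> {{..<b} |b. True} \<union> {UNIV}"

text \<open>Density of the order is not listed: it is automatic for nontrivial ordered groups.\<close>

definition o_minimal :: "('a::linordered_group_add, 'f, 'r) interp \<Rightarrow> bool" where
  "o_minimal M \<longleftrightarrow>
     (\<forall>D. definable M 1 D \<longrightarrow>
        (\<exists>\<F>. finite \<F> \<and> \<F> \<subseteq> {{a} |a. True} \<union> open_intervals \<and> {x. [x] \<in> D} = \<Union>\<F>))"

definition small :: "'k rel \<Rightarrow> 'b set \<Rightarrow> bool" where
  "small \<kappa> A \<longleftrightarrow> (card_of A, \<kappa>) \<in> ordLess"

text \<open>Every finitely satisfiable set of formulas in the variable 0 with parameters from a small
  set is realised.\<close>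

definition saturated :: "'k rel \<Rightarrow> ('a::{plus,ord}, 'f, 'r) interp \<Rightarrow> bool" where
  "saturated \<kappa> M \<longleftrightarrow>
     (\<forall>A P. small \<kappa> A \<longrightarrow> (\<forall>(\<phi>, e)\<in>P. range e \<subseteq> A) \<longrightarrow>
        (\<forall>F\<subseteq>P. finite F \<longrightarrow> (\<exists>x. \<forall>(\<phi>, e)\<in>F. sat M (e(0 := x)) \<phi>)) \<longrightarrow>
        (\<exists>x. \<forall>(\<phi>, e)\<in>P. sat M (e(0 := x)) \<phi>))"

text \<open>\<open>\<kappa>\<close> is an uncountable cardinal exceeding the size of the language.\<close>

definition sufficiently_saturated ::
    "'k rel \<Rightarrow> ('a::{plus,ord}, 'f, 'r) interp \<Rightarrow> bool" where
  "sufficiently_saturated \<kappa> M \<longleftrightarrow>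
     Card_order \<kappa> \<and> (natLeq, \<kappa>) \<in> ordLess \<and>
     small \<kappa> (UNIV :: 'f set) \<and> small \<kappa> (UNIV :: 'r set) \<and> saturated \<kappa> M"

subsection \<open>Topology and dimension\<close>

definition tuple_topology :: "nat \<Rightarrow> 'a::topological_space list topology" where
  "tuple_topology n =
     pullback_topology {xs. length xs = n} (\<lambda>xs. \<lambda>i\<in>{..<n}. xs ! i)
       (product_topology (\<lambda>_. euclidean) {..<n})"

text \<open>The dimension of a nonempty definable set is the largest \<open>k\<close> such that some projection to
  \<open>k\<close> coordinates has nonempty interior.\<close>

definition def_dim :: "nat \<Rightarrow> 'a::topological_space list set \<Rightarrow> nat" where
  "def_dim n X =
     Max {k. \<exists>js. length js = k \<and> sorted_wrt (<) js \<and> set js \<subseteq> {..<n} \<and>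
               tuple_topology k interior_of ((\<lambda>x. map ((!) x) js) ` X) \<noteq> {}}"

definition vdim ::
    "('a::{plus,linorder_topology}, 'f, 'r) interp \<Rightarrow> nat \<Rightarrow> 'a list set \<Rightarrow> nat" where
  "vdim M n U = Max {def_dim n X |X. definable M n X \<and> X \<subseteq> U \<and> X \<noteq> {}}"

subsection \<open>Definable and \<open>\<Or>\<close>-definable groups\<close>

definition directed_vunion ::
    "'k rel \<Rightarrow> ('a::{plus,ord}, 'f, 'r) interp \<Rightarrow> nat \<Rightarrow> 'a list set set \<Rightarrow> 'a list set \<Rightarrow> bool" where
  "directed_vunion \<kappa> M n \<X> U \<longleftrightarrow>
     small \<kappa> \<X> \<and> (\<forall>X\<in>\<X>. definable M n X) \<and>
     (\<forall>X\<in>\<X>. \<forall>Y\<in>\<X>. \<exists>Z\<in>\<X>. X \<union> Y \<subseteq> Z) \<and> U = \<Union>\<X>"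

definition vdef_set ::
    "'k rel \<Rightarrow> ('a::{plus,ord}, 'f, 'r) interp \<Rightarrow> nat \<Rightarrow> 'a list set \<Rightarrow> bool" where
  "vdef_set \<kappa> M n V \<longleftrightarrow> (\<exists>\<X>. directed_vunion \<kappa> M n \<X> V)"

definition definable_mult ::
    "('a::{plus,ord}, 'f, 'r) interp \<Rightarrow> nat \<Rightarrow> 'a list monoid \<Rightarrow> 'a list set \<Rightarrow> 'a list set \<Rightarrow> bool" where
  "definable_mult M n G X Y \<longleftrightarrow>
     definable M (n + n + n) {x @ y @ (x \<otimes>\<^bsub>G\<^esub> y) |x y. x \<in> X \<and> y \<in> Y}"

definition vdef_group ::
    "'k rel \<Rightarrow> ('a::{plus,ord}, 'f, 'r) interp \<Rightarrow> nat \<Rightarrow> 'a list monoid \<Rightarrow> bool" where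
  "vdef_group \<kappa> M n G \<longleftrightarrow>
     group G \<and>
     (\<exists>\<X>. directed_vunion \<kappa> M n \<X> (carrier G) \<and> (\<forall>X\<in>\<X>. \<forall>Y\<in>\<X>. definable_mult M n G X Y))"

definition definable_group ::
    "('a::{plus,ord}, 'f, 'r) interp \<Rightarrow> nat \<Rightarrow> 'a list monoid \<Rightarrow> bool" where
  "definable_group M n G \<longleftrightarrow>
     group G \<and> definable M n (carrier G) \<and> definable_mult M n G (carrier G) (carrier G)"

definition vdef_map ::
    "('a::{plus,ord}, 'f, 'r) interp \<Rightarrow> nat \<Rightarrow> nat \<Rightarrow> 'a list set \<Rightarrow> ('a list \<Rightarrow> 'a list) \<Rightarrow> bool" where
  "vdef_map M n m U f \<longleftrightarrow> (\<forall>Y. definable M n Y \<and> Y \<subseteq> U \<longrightarrow> definable_fun M n m Y f)"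

definition definably_generated ::
    "('a::{plus,ord}, 'f, 'r) interp \<Rightarrow> nat \<Rightarrow> 'a list monoid \<Rightarrow> bool" where
  "definably_generated M n G \<longleftrightarrow>
     (\<exists>Z. definable M n Z \<and> Z \<subseteq> carrier G \<and> generate G Z = carrier G)"

definition finitely_generated_subgroup :: "('b, 'c) monoid_scheme \<Rightarrow> 'b set \<Rightarrow> bool" where
  "finitely_generated_subgroup G H \<longleftrightarrow>
     (\<exists>S. finite S \<and> S \<subseteq> carrier G \<and> H = generate G S)"

text \<open>The canonical group topology, which is unique. Since the chart domains are open in \<open>T\<close> and
  the charts are homeomorphisms, the transition maps are continuous maps between open sets.
  Definable groups are covered as the special case of a single definable set.\<close>

definition canonical_group_topology ::
    "'k rel \<Rightarrow> ('a::{plus,linorder_topology}, 'f, 'r) interp \<Rightarrow> nat \<Rightarrow> 'a list monoid \<Rightarrow>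
     'a list topology \<Rightarrow> bool" where
  "canonical_group_topology \<kappa> M n G T \<longleftrightarrow>
     topspace T = carrier G \<and>
     (\<exists>\<V>. small \<kappa> \<V> \<and> \<Union>\<V> = carrier G \<and>
        (\<forall>V\<in>\<V>. definable M n V \<and> openin T V \<and>
           (\<exists>f W. let d = vdim M n (carrier G) in
              definable_fun M n d V f \<and> openin (tuple_topology d) W \<and>
              homeomorphic_map (subtopology T V) (subtopology (tuple_topology d) W) f))) \<and>
     continuous_map (prod_topology T T) T (\<lambda>(x, y). x \<otimes>\<^bsub>G\<^esub> y) \<and>
     continuous_map T T (\<lambda>x. inv\<^bsub>G\<^esub> x)"

definition compatible ::
    "('a::{plus,ord}, 'f, 'r) interp \<Rightarrow> nat \<Rightarrow> 'a list set \<Rightarrow> 'a list set \<Rightarrow> bool" where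
  "compatible M n U V \<longleftrightarrow> (\<forall>Y. definable M n Y \<and> Y \<subseteq> U \<longrightarrow> definable M n (V \<inter> Y))"

definition vconnected ::
    "'k rel \<Rightarrow> ('a::{plus,ord}, 'f, 'r) interp \<Rightarrow> nat \<Rightarrow> 'a list set \<Rightarrow> 'a list topology \<Rightarrow> bool" where
  "vconnected \<kappa> M n U T \<longleftrightarrow>
     \<not> (\<exists>V. {} \<subset> V \<and> V \<subset> U \<and> vdef_set \<kappa> M n V \<and> compatible M n U V \<and>
            openin T V \<and> closedin T V)"

text \<open>\<open>interval_end I F\<close>: \<open>I\<close> is an open interval with endpoints in $M \cup \{\pm\infty\}$ and \<open>F\<close> is
  the filter of approach, inside \<open>I\<close>, to one of its endpoints.\<close>

inductive interval_end :: "'a::linorder_topology set \<Rightarrow> 'a filter \<Rightarrow> bool" where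
  "a < b \<Longrightarrow> interval_end {a<..<b} (at_right a)"
| "a < b \<Longrightarrow> interval_end {a<..<b} (at_left b)"
| "interval_end {a<..} (at_right a)"
| "interval_end {a<..} at_top"
| "interval_end {..<b} at_bot"
| "interval_end {..<b} (at_left b)"
| "interval_end UNIV at_bot"
| "interval_end UNIV at_top"

text \<open>Definable compactness in the sense of Peterzil and Steinhorn: every definable continuous curve
  on an open interval, with values in \<open>X\<close>, has limits in \<open>X\<close> at both endpoints.\<close>

definition definably_compact ::
    "('a::{plus,linorder_topology}, 'f, 'r) interp \<Rightarrow> nat \<Rightarrow> 'a list topology \<Rightarrow>
     'a list set \<Rightarrow> bool" where
  "definably_compact M n T X \<longleftrightarrow>
     definable M n X \<and> X \<subseteq> topspace T \<and>
     (\<forall>I F \<gamma>. interval_end I F \<and> \<gamma> ` I \<subseteq> X \<and>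
        definable M (1 + n) {t # \<gamma> t |t. t \<in> I} \<and> continuous_map (top_of_set I) T \<gamma> \<longrightarrow>
        (\<exists>l\<in>X. limitin T \<gamma> l F))"

definition definably_compact_group ::
    "'k rel \<Rightarrow> ('a::{plus,linorder_topology}, 'f, 'r) interp \<Rightarrow> nat \<Rightarrow> 'a list monoid \<Rightarrow> bool" where
  "definably_compact_group \<kappa> M n G \<longleftrightarrow>
     (\<exists>T. canonical_group_topology \<kappa> M n G T \<and> definably_compact M n T (carrier G))"

text \<open>\<open>K\<close>, living on a subset of $M^m$, is a realisation of \<open>U/N\<close> as a definable group.\<close>

definition definable_quotient ::
    "('a::{plus,ord}, 'f, 'r) interp \<Rightarrow> nat \<Rightarrow> 'a list monoid \<Rightarrow> 'a list set \<Rightarrow>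
     nat \<Rightarrow> 'a list monoid \<Rightarrow> bool" where
  "definable_quotient M n U N m K \<longleftrightarrow>
     definable_group M m K \<and>
     (\<exists>\<mu>. vdef_map M n m (carrier U) \<mu> \<and> \<mu> \<in> hom U K \<and> \<mu> ` carrier U = carrier K \<and>
          kernel U K \<mu> = N)"

end

theory Submission
  imports Defs "HOL-Library.Countable_Set" "HOL-Library.List_Lexorder"
begin

text \<open>By saturation \<open>X + X \<subseteq> X + F\<close> for a finite \<open>F \<subseteq> \<Lambda>\<close>, so \<open>X \<inter> \<Lambda>\<close> is an
  approximate subgroup of the finitely generated group \<open>\<Lambda>\<close>. A maximal set of
  generators whose span \<open>N\<close> meets every translate of it in a finite set then satisfies
  \<open>\<Lambda> \<subseteq> N + (X \<inter> \<Lambda>) + finite\<close>, hence \<open>N\<close> meets every definable set in a finite set and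
  \<open>Y + N\<close> is everything for some definable \<open>Y\<close>. The quotient by \<open>N\<close> is realised on the set \<open>K\<close> of
  lexicographically least representatives in \<open>Y\<close>. It carries the quotient topology; a rank count for
  the pregeometry of definable closure shows that finitely many translates of open cores of charts
  cover the group up to \<open>N\<close>, which yields charts on \<open>K\<close>. If a definably compact \<open>Z\<close> generates,
  saturation puts \<open>K\<close> into a finite sum of copies of \<open>Z \<union> -Z \<union> {0}\<close>, and definable choice along
  curves shows that such sums contain the limits of their definable curves.\<close>

section \<open>A calculus of definable predicates\<close>

text \<open>The language may be uncountable, whereas generic points are found by avoiding countable
  closures. Definability is therefore tracked with an explicit sublanguage and parameter set, and
  every argument with generic points runs in a finite sublanguage containing the symbols of the
  definable sets at hand; there the definable closure of a countable set is countable, hence by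
  saturation contains no infinite definable set. The obstacle to charts on the quotient is that a
  set of lexicographically least representatives has no reason to be open. Translating cures this,
  because a point outside the open core has rank below \<open>d\<close>. If a point escaped the
  cores for \<open>d + 1\<close> independent translates, then \<open>d * (d + 1)\<close> independent
  coordinates would have rank at most \<open>d + (d + 1) * (d - 1)\<close>, which is one too few. In
  the argument on limits, definable choice yields factor curves that need not be continuous.
  Definability alone makes them continuous near the given end, which is why the induction speaks of
  definable curves only.\<close>

primrec trm_ren :: "(nat \<Rightarrow> nat) \<Rightarrow> 'f trm \<Rightarrow> 'f trm" where
  "trm_ren r (Var i) = Var (r i)"
| "trm_ren r (Add s t) = Add (trm_ren r s) (trm_ren r t)"
| "trm_ren r (Fn f ts) = Fn f (map (trm_ren r) ts)"

primrec trm_fv :: "'f trm \<Rightarrow> nat set" where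
  "trm_fv (Var i) = {i}"
| "trm_fv (Add s t) = trm_fv s \<union> trm_fv t"
| "trm_fv (Fn f ts) = \<Union> (set (map trm_fv ts))"

text \<open>Bound variables are renamed along with the free ones, which is harmless for injective
  \<open>r\<close>. Substitutions that identify variables are left to
  \<open>dnorm_subst\<close>.\<close>

primrec fm_ren :: "(nat \<Rightarrow> nat) \<Rightarrow> ('f, 'r) fm \<Rightarrow> ('f, 'r) fm" where
  "fm_ren r (Eq s t) = Eq (trm_ren r s) (trm_ren r t)"
| "fm_ren r (Less s t) = Less (trm_ren r s) (trm_ren r t)"
| "fm_ren r (Rel p ts) = Rel p (map (trm_ren r) ts)"
| "fm_ren r (Neg \<phi>) = Neg (fm_ren r \<phi>)"
| "fm_ren r (Conj \<phi> \<psi>) = Conj (fm_ren r \<phi>) (fm_ren r \<psi>)"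
| "fm_ren r (Ex i \<phi>) = Ex (r i) (fm_ren r \<phi>)"

primrec fm_fv :: "('f, 'r) fm \<Rightarrow> nat set" where
  "fm_fv (Eq s t) = trm_fv s \<union> trm_fv t"
| "fm_fv (Less s t) = trm_fv s \<union> trm_fv t"
| "fm_fv (Rel p ts) = \<Union> (set (map trm_fv ts))"
| "fm_fv (Neg \<phi>) = fm_fv \<phi>"
| "fm_fv (Conj \<phi> \<psi>) = fm_fv \<phi> \<union> fm_fv \<psi>"
| "fm_fv (Ex i \<phi>) = fm_fv \<phi> - {i}"

lemma finite_trm_fv: "finite (trm_fv t)"
  by (induction t) auto

lemma finite_fm_fv: "finite (fm_fv \<phi>)"
  by (induction \<phi>) (auto simp: finite_trm_fv)

lemma trm_val_ren: "trm_val M e (trm_ren r t) = trm_val M (e \<circ> r) t"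
  by (induction t) (auto simp: comp_def cong: map_cong)

lemma set_trm_ren: "set_trm (trm_ren r t) = set_trm t"
  by (induction t) auto

lemma trm_val_cong: "(\<And>i. i \<in> trm_fv t \<Longrightarrow> e i = e' i) \<Longrightarrow> trm_val M e t = trm_val M e' t"
proof (induction t)
  case (Fn f ts)
  then have "map (trm_val M e) ts = map (trm_val M e') ts"
    by (intro map_cong refl) auto
  then show ?case by (simp del: map_eq_conv)
qed auto

lemma sat_cong: "(\<And>i. i \<in> fm_fv \<phi> \<Longrightarrow> e i = e' i) \<Longrightarrow> sat M e \<phi> \<longleftrightarrow> sat M e' \<phi>"
proof (induction \<phi> arbitrary: e e')
  case (Rel p ts)
  then have "map (trm_val M e) ts = map (trm_val M e') ts"
    by (intro map_cong refl trm_val_cong) auto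
  then show ?case by (simp del: map_eq_conv)
next
  case (Ex i \<phi>)
  have "sat M (e(i := x)) \<phi> \<longleftrightarrow> sat M (e'(i := x)) \<phi>" for x
    by (rule Ex.IH) (use Ex.prems in auto)
  then show ?case by simp
next
  case (Eq s t)
  have "trm_val M e s = trm_val M e' s" "trm_val M e t = trm_val M e' t"
    by (rule trm_val_cong; use Eq in auto)+
  then show ?case by simp
next
  case (Less s t)
  have "trm_val M e s = trm_val M e' s" "trm_val M e t = trm_val M e' t"
    by (rule trm_val_cong; use Less in auto)+
  then show ?case by simp
next
  case (Conj \<phi> \<psi>)
  have "sat M e \<phi> \<longleftrightarrow> sat M e' \<phi>" "sat M e \<psi> \<longleftrightarrow> sat M e' \<psi>"
    by (rule Conj.IH; use Conj.prems in auto)+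
  then show ?case by simp
next
  case (Neg \<phi>)
  have "sat M e \<phi> \<longleftrightarrow> sat M e' \<phi>" by (rule Neg.IH; use Neg.prems in auto)
  then show ?case by simp
qed

lemma sat_ren: "inj r \<Longrightarrow> sat M e (fm_ren r \<phi>) \<longleftrightarrow> sat M (e \<circ> r) \<phi>"
proof (induction \<phi> arbitrary: e)
  case (Ex i \<phi>)
  have "e(r i := x) \<circ> r = (e \<circ> r)(i := x)" for x
    using Ex.prems by (auto simp: fun_eq_iff inj_eq)
  then show ?case unfolding fm_ren.simps sat.simps Ex.IH[OF Ex.prems] by (simp only:)
next
  case (Rel p ts)
  have "map (trm_val M e) (map (trm_ren r) ts) = map (trm_val M (e \<circ> r)) ts"
    by (simp add: trm_val_ren)
  then show ?case unfolding fm_ren.simps sat.simps by (rule arg_cong)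
qed (auto simp: trm_val_ren)

text \<open>\<open>L\<close> is a pair of symbol sets, a sublanguage. It is carried along because
  the closures used later must be countable even when the whole language is not.\<close>

definition fmls :: "'f set \<times> 'r set \<Rightarrow> ('f, 'r) fm set" where
  "fmls L = {\<phi>. set1_fm \<phi> \<subseteq> fst L \<and> set2_fm \<phi> \<subseteq> snd L}"

lemma fmls_ren: "fm_ren r \<phi> \<in> fmls L \<longleftrightarrow> \<phi> \<in> fmls L"
  by (induction \<phi>) (auto simp: fmls_def set_trm_ren)

lemma fmls_simps:
  "Neg \<phi> \<in> fmls L \<longleftrightarrow> \<phi> \<in> fmls L"
  "Conj \<phi> \<psi> \<in> fmls L \<longleftrightarrow> \<phi> \<in> fmls L \<and> \<psi> \<in> fmls L"
  "Ex i \<phi> \<in> fmls L \<longleftrightarrow> \<phi> \<in> fmls L"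
  by (auto simp: fmls_def)

text \<open>Predicates are evaluated at assignments \<open>E\<close> of doubly indexed variables: \<open>E i\<close> is the
  \<open>i\<close>-th tuple variable. A slot is a variable or a constant.\<close>

type_synonym 'a slot = "(nat \<times> nat) + 'a"

fun slot_val :: "(nat \<Rightarrow> nat \<Rightarrow> 'a) \<Rightarrow> 'a slot \<Rightarrow> 'a" where
  "slot_val E (Inl p) = E (fst p) (snd p)"
| "slot_val E (Inr c) = c"

text \<open>The constant 0 is always available, so that variables without influence receive a value
  even when \<open>A\<close> is empty. In an ordered group nothing new becomes definable by this, as
  0 is the only solution of \<open>x + x = x\<close>.\<close>

definition slots :: "'a::zero set \<Rightarrow> 'a slot set" where
  "slots A = range Inl \<union> Inr ` insert 0 A"

definition dpred ::
  "('a::{plus,ord,zero}, 'f, 'r) interp \<Rightarrow> 'f set \<times> 'r set \<Rightarrow> 'a set \<Rightarrow> ((nat \<Rightarrow> nat \<Rightarrow> 'a) \<Rightarrow> bool) \<Rightarrow> bool"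
  where "dpred M L A P \<longleftrightarrow> (\<exists>\<phi> s. \<phi> \<in> fmls L \<and> range s \<subseteq> slots A \<and>
           (\<forall>E. P E \<longleftrightarrow> sat M (\<lambda>i. slot_val E (s i)) \<phi>))"

definition merge_env :: "(nat \<Rightarrow> nat \<Rightarrow> 'a) \<Rightarrow> (nat \<Rightarrow> 'a) \<Rightarrow> nat \<Rightarrow> 'a" where
  "merge_env E c i = (if even i then case prod_decode (i div 2) of (a, b) \<Rightarrow> E a b else c (i div 2))"

text \<open>A normal form in which the even variables of the formula are exactly the variables of \<open>E\<close>;
  it makes conjunction and quantification visible on the syntactic level.\<close>

definition dnorm ::
  "('a::{plus,ord,zero}, 'f, 'r) interp \<Rightarrow> 'f set \<times> 'r set \<Rightarrow> 'a set \<Rightarrow> ((nat \<Rightarrow> nat \<Rightarrow> 'a) \<Rightarrow> bool) \<Rightarrow> bool"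
  where "dnorm M L A P \<longleftrightarrow> (\<exists>\<phi> c. \<phi> \<in> fmls L \<and> range c \<subseteq> insert 0 A \<and>
           (\<forall>E. P E \<longleftrightarrow> sat M (merge_env E c) \<phi>))"

lemma dnorm_imp_dpred:
  assumes "dnorm M L A P" shows "dpred M L A P"
proof -
  obtain \<phi> c where p: "\<phi> \<in> fmls L" "range c \<subseteq> insert 0 A" "\<And>E. P E \<longleftrightarrow> sat M (merge_env E c) \<phi>"
    using assms unfolding dnorm_def by blast
  define s where "s i = (if even i then Inl (prod_decode (i div 2)) else Inr (c (i div 2)))" for i
  have "(\<lambda>i. slot_val E (s i)) = merge_env E c" for E
    by (auto simp: s_def merge_env_def fun_eq_iff split: prod.split)
  moreover have "range s \<subseteq> slots A"
    using p(2) by (fastforce simp: s_def slots_def)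
  ultimately show ?thesis unfolding dpred_def using p by metis
qed

lemma dnorm_not: "dnorm M L A P \<Longrightarrow> dnorm M L A (\<lambda>E. \<not> P E)"
  unfolding dnorm_def by (metis fmls_simps(1) sat.simps(4))

lemma dnorm_conj:
  assumes "dnorm M L A P" "dnorm M L A Q" shows "dnorm M L A (\<lambda>E. P E \<and> Q E)"
proof -
  obtain \<phi> c where p: "\<phi> \<in> fmls L" "range c \<subseteq> insert 0 A" "\<And>E. P E \<longleftrightarrow> sat M (merge_env E c) \<phi>"
    using assms(1) unfolding dnorm_def by blast
  obtain \<psi> d where q: "\<psi> \<in> fmls L" "range d \<subseteq> insert 0 A" "\<And>E. Q E \<longleftrightarrow> sat M (merge_env E d) \<psi>"
    using assms(2) unfolding dnorm_def by blast
  \<comment> \<open>The even variables, which code the entries of \<open>E\<close>, stay shared; the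
    parameter variables of the two formulas move to the residues 1 and 3 modulo 4, and
    \<open>b\<close> interleaves \<open>c\<close> and \<open>d\<close> accordingly.\<close>
  define r :: "nat \<Rightarrow> nat" where "r i = (if even i then i else 4 * (i div 2) + 1)" for i
  define r' :: "nat \<Rightarrow> nat" where "r' i = (if even i then i else 4 * (i div 2) + 3)" for i
  define b where "b i = (if even i then c (i div 2) else d (i div 2))" for i
  have inj: "inj r" "inj r'"
    unfolding r_def r'_def inj_def by (auto split: if_splits; presburger)+
  have "(4 * j + 1) div 2 = 2 * j" "(4 * j + 3) div 2 = 2 * j + 1" "odd j \<Longrightarrow> (j - Suc 0) div 2 = j div 2"
    for j :: nat by presburger+
  then have "merge_env E b \<circ> r = merge_env E c" "merge_env E b \<circ> r' = merge_env E d" for E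
    by (auto simp: r_def r'_def b_def merge_env_def fun_eq_iff)
  then have "P E \<and> Q E \<longleftrightarrow> sat M (merge_env E b) (Conj (fm_ren r \<phi>) (fm_ren r' \<psi>))" for E
    by (simp add: sat_ren inj p(3) q(3))
  moreover have "range b \<subseteq> insert 0 A" using p(2) q(2) by (auto simp: b_def)
  moreover have "Conj (fm_ren r \<phi>) (fm_ren r' \<psi>) \<in> fmls L"
    using p(1) q(1) by (simp add: fmls_simps fmls_ren)
  ultimately show ?thesis unfolding dnorm_def by blast
qed

text \<open>Each entry \<open>E i j\<close> is exactly one formula variable,
  \<open>2 * prod_encode (i, j)\<close>, so updating it is the semantics of a single
  \<open>Ex\<close>.\<close>

lemma dnorm_ex:
  assumes "dnorm M L A P" shows "dnorm M L A (\<lambda>E. \<exists>x. P (E(i := (E i)(j := x))))"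
proof -
  obtain \<phi> c where p: "\<phi> \<in> fmls L" "range c \<subseteq> insert 0 A" "\<And>E. P E \<longleftrightarrow> sat M (merge_env E c) \<phi>"
    using assms unfolding dnorm_def by blast
  have "merge_env (E(i := (E i)(j := x))) c = (merge_env E c)(2 * prod_encode (i, j) := x)" for E x
  proof
    fix k
    show "merge_env (E(i := (E i)(j := x))) c k = ((merge_env E c)(2 * prod_encode (i, j) := x)) k"
    proof (cases "even k")
      case True
      obtain a b where ab: "prod_decode (k div 2) = (a, b)" by fastforce
      then have "k = 2 * prod_encode (a, b)"
        using True by (metis dvd_mult_div_cancel prod_decode_inverse)
      then show ?thesis by (auto simp: merge_env_def prod_encode_eq)
    qed (auto simp: merge_env_def)
  qed
  then have "(\<exists>x. P (E(i := (E i)(j := x)))) \<longleftrightarrow> sat M (merge_env E c) (Ex (2 * prod_encode (i, j)) \<phi>)" for E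
    by (simp add: p(3))
  then show ?thesis unfolding dnorm_def using p by (metis fmls_simps(3))
qed

definition slot_index :: "(nat \<Rightarrow> 'a slot) \<Rightarrow> nat \<Rightarrow> nat" where
  "slot_index s i = (case s i of Inl p \<Rightarrow> 2 * prod_encode p | Inr c \<Rightarrow> 2 * i + 1)"

definition slot_const :: "(nat \<Rightarrow> 'a::zero slot) \<Rightarrow> nat \<Rightarrow> 'a" where
  "slot_const s i = (case s i of Inl p \<Rightarrow> 0 | Inr c \<Rightarrow> c)"

lemma slot_const_in: "range s \<subseteq> slots A \<Longrightarrow> range (slot_const s) \<subseteq> insert 0 A"
proof (rule image_subsetI)
  fix i assume "range s \<subseteq> slots A"
  then have "s i \<in> slots A" by auto
  then show "slot_const s i \<in> insert 0 A" by (auto simp: slot_const_def slots_def)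
qed

lemma slot_val_trm:
  "trm_val M (\<lambda>i. slot_val E (s i)) t = trm_val M (merge_env E (slot_const s)) (trm_ren (slot_index s) t)"
proof -
  have "slot_val E (s i) = merge_env E (slot_const s) (slot_index s i)" for i
    by (auto simp: merge_env_def slot_index_def slot_const_def split: sum.splits prod.splits)
  then have "(\<lambda>i. slot_val E (s i)) = merge_env E (slot_const s) \<circ> slot_index s" by auto
  then show ?thesis by (simp add: trm_val_ren)
qed

text \<open>An arbitrary slot assignment is pushed into the formula. Atoms tolerate identification
  of variables; only the quantifier has to beware of capture, and it moves to a fresh entry of
  \<open>E\<close>.\<close>

lemma dnorm_subst:
  assumes "range s \<subseteq> slots A" "\<phi> \<in> fmls L"
  shows "dnorm M L A (\<lambda>E. sat M (\<lambda>i. slot_val E (s i)) \<phi>)"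
  using assms
proof (induction \<phi> arbitrary: s)
  case (Neg \<phi>) then show ?case by (simp add: fmls_simps dnorm_not)
next
  case (Conj \<phi> \<psi>) then show ?case by (simp add: fmls_simps dnorm_conj)
next
  case (Ex i \<phi>)
  define s' where "s' k = (if k \<in> fm_fv \<phi> then s k else Inr 0)" for k
  have "finite {p. \<exists>k. s' k = Inl p}"
    by (rule finite_subset[of _ "(\<lambda>k. projl (s k)) ` fm_fv \<phi>"])
       (force simp: s'_def finite_fm_fv split: if_splits)+
  then obtain p where p: "\<And>k. s' k \<noteq> Inl p"
    using ex_new_if_finite[of "{p. \<exists>k. s' k = Inl p}"] by (auto simp: finite_prod)
  have r: "range (s'(i := Inl p)) \<subseteq> slots A"
    using Ex.prems by (auto simp: s'_def slots_def)
  have eq: "slot_val (E(fst p := (E (fst p))(snd p := x))) ((s'(i := Inl p)) k) =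
      ((\<lambda>k. slot_val E (s k))(i := x)) k" if "k \<in> fm_fv \<phi>" for E x k
  proof (cases "k = i")
    case False
    have "s' k = s k" using that by (simp add: s'_def)
    moreover obtain c where "s' k = Inr c \<or> (\<exists>q. s' k = Inl q)" using sum.exhaust by metis
    ultimately show ?thesis using False p[of k]
      by (cases "s k") (auto simp: prod_eq_iff)
  qed auto
  have "sat M (\<lambda>k. slot_val (E(fst p := (E (fst p))(snd p := x))) ((s'(i := Inl p)) k)) \<phi> \<longleftrightarrow>
      sat M ((\<lambda>k. slot_val E (s k))(i := x)) \<phi>" for E x
    by (rule sat_cong) (rule eq)
  then have "(\<lambda>E. sat M (\<lambda>k. slot_val E (s k)) (Ex i \<phi>)) = (\<lambda>E. \<exists>x.
       sat M (\<lambda>k. slot_val (E(fst p := (E (fst p))(snd p := x))) ((s'(i := Inl p)) k)) \<phi>)"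
    by (auto simp: fun_eq_iff)
  moreover have "dnorm M L A (\<lambda>E. sat M (\<lambda>k. slot_val E ((s'(i := Inl p)) k)) \<phi>)"
    using Ex r by (simp add: fmls_simps)
  ultimately show ?case using dnorm_ex[of M L A "(\<lambda>E. sat M (\<lambda>k. slot_val E ((s'(i := Inl p)) k)) \<phi>)" "fst p" "snd p"]
    by simp
next
  case (Eq t u)
  then show ?case unfolding dnorm_def
    by (intro exI[of _ "Eq (trm_ren (slot_index s) t) (trm_ren (slot_index s) u)"] exI[of _ "slot_const s"])
       (auto simp: fmls_def set_trm_ren slot_val_trm slot_const_in)
next
  case (Less t u)
  then show ?case unfolding dnorm_def
    by (intro exI[of _ "Less (trm_ren (slot_index s) t) (trm_ren (slot_index s) u)"] exI[of _ "slot_const s"])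
       (auto simp: fmls_def set_trm_ren slot_val_trm slot_const_in)
next
  case (Rel p ts)
  have "map (trm_val M (\<lambda>i. slot_val E (s i))) ts =
      map (trm_val M (merge_env E (slot_const s))) (map (trm_ren (slot_index s)) ts)" for E
    by (simp add: slot_val_trm)
  with Rel show ?case unfolding dnorm_def
    by (intro exI[of _ "Rel p (map (trm_ren (slot_index s)) ts)"] exI[of _ "slot_const s"])
       (auto simp del: map_map simp: fmls_def set_trm_ren slot_const_in)
qed


text \<open>Reindexing is immediate for \<open>dpred\<close>, the logical operations are immediate
  for \<open>dnorm\<close>; the equivalence makes both kinds of closure available.\<close>

lemma dpred_iff_dnorm: "dpred M L A P \<longleftrightarrow> dnorm M L A P"
proof
  assume "dpred M L A P"
  then obtain \<phi> s where p: "\<phi> \<in> fmls L" "range s \<subseteq> slots A" "P = (\<lambda>E. sat M (\<lambda>i. slot_val E (s i)) \<phi>)"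
    unfolding dpred_def by (auto simp: fun_eq_iff)
  show "dnorm M L A P" unfolding p(3) by (rule dnorm_subst[OF p(2,1)])
qed (rule dnorm_imp_dpred)

lemma dpred_cong: "dpred M L A P \<Longrightarrow> (\<And>E. P E = Q E) \<Longrightarrow> dpred M L A Q"
  unfolding dpred_def by simp

lemma dpred_not: "dpred M L A P \<Longrightarrow> dpred M L A (\<lambda>E. \<not> P E)"
  by (simp add: dpred_iff_dnorm dnorm_not)

lemma dpred_conj: "dpred M L A P \<Longrightarrow> dpred M L A Q \<Longrightarrow> dpred M L A (\<lambda>E. P E \<and> Q E)"
  by (simp add: dpred_iff_dnorm dnorm_conj)

lemma dpred_disj:
  assumes "dpred M L A P" "dpred M L A Q" shows "dpred M L A (\<lambda>E. P E \<or> Q E)"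
  by (rule dpred_cong[OF dpred_not[OF dpred_conj[OF dpred_not[OF assms(1)] dpred_not[OF assms(2)]]]]) auto

lemma dpred_imp:
  assumes "dpred M L A P" "dpred M L A Q" shows "dpred M L A (\<lambda>E. P E \<longrightarrow> Q E)"
  by (rule dpred_cong[OF dpred_disj[OF dpred_not[OF assms(1)] assms(2)]]) auto

lemma dpred_const: "dpred M L A (\<lambda>E. b)"
proof -
  have "dpred M L A (\<lambda>E. True)"
    unfolding dpred_def
    by (rule exI[of _ "Eq (Var 0) (Var 0)"], rule exI[of _ "\<lambda>i. Inr 0"]) (auto simp: fmls_def slots_def)
  from this dpred_not[OF this] show ?thesis by (cases b) auto
qed

lemma dpred_mono:
  assumes "dpred M L A P" "fst L \<subseteq> fst L'" "snd L \<subseteq> snd L'" "A \<subseteq> B"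
  shows "dpred M L' B P"
proof -
  have "slots A \<subseteq> slots B" "fmls L \<subseteq> fmls L'" using assms(2-4) by (auto simp: slots_def fmls_def)
  with assms(1) show ?thesis unfolding dpred_def by (meson subset_iff)
qed

lemma dpred_reindex:
  assumes "dpred M L A P" "\<And>i j. \<sigma> i j \<in> slots A"
  shows "dpred M L A (\<lambda>E. P (\<lambda>i j. slot_val E (\<sigma> i j)))"
proof -
  obtain \<phi> s where p: "\<phi> \<in> fmls L" "range s \<subseteq> slots A" "\<And>E. P E \<longleftrightarrow> sat M (\<lambda>i. slot_val E (s i)) \<phi>"
    using assms(1) unfolding dpred_def by blast
  define s' where "s' i = (case s i of Inl p \<Rightarrow> \<sigma> (fst p) (snd p) | Inr c \<Rightarrow> Inr c)" for i
  have "slot_val (\<lambda>i j. slot_val E (\<sigma> i j)) (s i) = slot_val E (s' i)" for E i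
    by (auto simp: s'_def split: sum.splits)
  moreover have "s i \<in> slots A" for i using p(2) by auto
  then have "s' i \<in> slots A" for i using assms(2)
    by (cases "s i") (auto simp: s'_def, metis)
  ultimately show ?thesis unfolding dpred_def using p by (intro exI[of _ \<phi>] exI[of _ s']) auto
qed

lemma dpred_ex_finite:
  "finite I \<Longrightarrow> (\<And>i. i \<in> I \<Longrightarrow> dpred M L A (P i)) \<Longrightarrow> dpred M L A (\<lambda>E. \<exists>i\<in>I. P i E)"
proof (induction I rule: finite_induct)
  case empty show ?case by (simp add: dpred_const)
next
  case (insert i I)
  have "dpred M L A (\<lambda>E. P i E \<or> (\<exists>i\<in>I. P i E))" using insert by (intro dpred_disj) auto
  then show ?case by (rule dpred_cong) auto
qed

lemma dpred_all_finite:
  assumes "finite I" "\<And>i. i \<in> I \<Longrightarrow> dpred M L A (P i)" shows "dpred M L A (\<lambda>E. \<forall>i\<in>I. P i E)"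
  by (rule dpred_cong[OF dpred_not[OF dpred_ex_finite[of I M L A "\<lambda>i E. \<not> P i E"]]])
     (use assms in \<open>auto intro: dpred_not\<close>)

text \<open>The second premise is freshness of the tuple variable \<open>k\<close>, stated
  semantically: apart from its argument \<open>x\<close>, \<open>Q\<close> ignores that variable.
  Quantifying over the entry \<open>(k, j)\<close> then quantifies over \<open>x\<close>.\<close>

lemma dpred_ex:
  assumes "dpred M L A (\<lambda>E. Q E (E k j))" "\<And>E f x. Q (E(k := f)) x = Q E x"
  shows "dpred M L A (\<lambda>E. \<exists>x. Q E x)"
  using dnorm_ex[of M L A "\<lambda>E. Q E (E k j)" k j] assms by (simp add: dpred_iff_dnorm)

lemma dpred_all:
  assumes "dpred M L A (\<lambda>E. Q E (E k j))" "\<And>E f x. Q (E(k := f)) x = Q E x"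
  shows "dpred M L A (\<lambda>E. \<forall>x. Q E x)"
  using dpred_not[OF dpred_ex[where Q = "\<lambda>E x. \<not> Q E x", OF dpred_not[OF assms(1)]]] assms(2) by simp

section \<open>Tuple variables, quantifiers over tuples, and terms\<close>

definition tup :: "nat \<Rightarrow> (nat \<Rightarrow> 'a) \<Rightarrow> 'a list" where
  "tup n f = map f [0..<n]"

lemma length_tup [simp]: "length (tup n f) = n"
  by (simp add: tup_def)

lemma tup_nth [simp]: "i < n \<Longrightarrow> tup n f ! i = f i"
  by (simp add: tup_def)

lemma tup_of_list [simp]: "length x = n \<Longrightarrow> tup n ((!) x) = x"
  by (simp add: list_eq_iff_nth_eq)

lemma tup_Suc_0: "tup (Suc 0) f = [f 0]"
  by (simp add: tup_def)

lemma dpred_ex_tuple: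
  assumes "dpred M L A (\<lambda>E. Q E (tup n (E k)))" "\<And>E f x. Q (E(k := f)) x = Q E x"
  shows "dpred M L A (\<lambda>E. \<exists>x. length x = n \<and> Q E x)"
proof -
  \<comment> \<open>At stage \<open>m\<close> the entries below \<open>m\<close> are quantified and
    all others still agree with \<open>E k\<close>; stage \<open>n\<close> is the claim.\<close>
  have "dpred M L A (\<lambda>E. \<exists>f. (\<forall>i\<ge>m. f i = E k i) \<and> Q E (tup n f))" for m
  proof (induction m)
    case 0
    have "(\<forall>i\<ge>0. f i = E k i) \<longleftrightarrow> f = E k" for f :: "nat \<Rightarrow> 'a" and E by (simp add: fun_eq_iff)
    then show ?case using assms(1) by simp
  next
    case (Suc m)
    let ?P = "\<lambda>E. \<exists>f. (\<forall>i\<ge>m. f i = E k i) \<and> Q E (tup n f)"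
    have "dpred M L A (\<lambda>E. \<exists>x. ?P (E(k := (E k)(m := x))))"
      using dnorm_ex[of M L A ?P k m] Suc by (simp add: dpred_iff_dnorm)
    moreover have "(\<exists>x. ?P (E(k := (E k)(m := x)))) \<longleftrightarrow> (\<exists>f. (\<forall>i\<ge>Suc m. f i = E k i) \<and> Q E (tup n f))" for E
    proof
      assume "\<exists>x. ?P (E(k := (E k)(m := x)))"
      then obtain x f where f: "\<forall>i\<ge>m. f i = ((E k)(m := x)) i" "Q E (tup n f)" by (auto simp: assms(2))
      from f(1) have "\<forall>i\<ge>Suc m. f i = E k i" by auto
      with f(2) show "\<exists>f. (\<forall>i\<ge>Suc m. f i = E k i) \<and> Q E (tup n f)" by blast
    next
      assume "\<exists>f. (\<forall>i\<ge>Suc m. f i = E k i) \<and> Q E (tup n f)"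
      then obtain f where f: "\<forall>i\<ge>Suc m. f i = E k i" "Q E (tup n f)" by blast
      have "\<forall>i\<ge>m. f i = ((E k)(m := f m)) i" using f(1) by (auto simp: Suc_le_eq)
      then have "?P (E(k := (E k)(m := f m)))" using f(2) unfolding assms(2) fun_upd_same by blast
      then show "\<exists>x. ?P (E(k := (E k)(m := x)))" by blast
    qed
    ultimately show ?case by (rule dpred_cong)
  qed
  from this[of n] show ?thesis
  proof (rule dpred_cong)
    fix E
    show "(\<exists>f. (\<forall>i\<ge>n. f i = E k i) \<and> Q E (tup n f)) \<longleftrightarrow> (\<exists>x. length x = n \<and> Q E x)"
    proof
      assume "\<exists>x. length x = n \<and> Q E x"
      then obtain x where x: "length x = n" "Q E x" by blast
      let ?f = "\<lambda>i. if i < n then x ! i else E k i"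
      have "tup n ?f = x" using x(1) by (simp add: list_eq_iff_nth_eq)
      with x(2) show "\<exists>f. (\<forall>i\<ge>n. f i = E k i) \<and> Q E (tup n f)" by (intro exI[of _ ?f]) auto
    qed (metis length_tup)
  qed
qed

text \<open>A term is a bare slot, a tuple term a list of slots. Operations enter only through their
  graphs, the sum in \<open>dpred_add\<close> and group products as definable sets of
  triples.\<close>

definition sterm :: "'a::zero set \<Rightarrow> ((nat \<Rightarrow> nat \<Rightarrow> 'a) \<Rightarrow> 'a) \<Rightarrow> bool" where
  "sterm A t \<longleftrightarrow> (\<exists>\<sigma>\<in>slots A. t = (\<lambda>E. slot_val E \<sigma>))"

definition tterm :: "'a::zero set \<Rightarrow> nat \<Rightarrow> ((nat \<Rightarrow> nat \<Rightarrow> 'a) \<Rightarrow> 'a list) \<Rightarrow> bool" where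
  "tterm A n t \<longleftrightarrow> (\<exists>ss. length ss = n \<and> set ss \<subseteq> slots A \<and> t = (\<lambda>E. map (slot_val E) ss))"

lemma sterm_var: "sterm A (\<lambda>E. E i j)"
  unfolding sterm_def by (rule bexI[of _ "Inl (i, j)"]) (auto simp: slots_def)

lemma sterm_const: "c \<in> insert 0 A \<Longrightarrow> sterm A (\<lambda>E. c)"
  unfolding sterm_def by (rule bexI[of _ "Inr c"]) (auto simp: slots_def)

lemma dpred_less:
  assumes "sterm A s" "sterm A t" shows "dpred M L A (\<lambda>E. s E < t E)"
proof -
  obtain a b where *: "a \<in> slots A" "s = (\<lambda>E. slot_val E a)" "b \<in> slots A" "t = (\<lambda>E. slot_val E b)"
    using assms unfolding sterm_def by blast
  show ?thesis unfolding dpred_def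
    by (rule exI[of _ "Less (Var 0) (Var 1)"], rule exI[of _ "\<lambda>i. if i = 0 then a else b"])
       (use * in \<open>auto simp: fmls_def\<close>)
qed

lemma dpred_eq:
  assumes "sterm A s" "sterm A t" shows "dpred M L A (\<lambda>E. s E = t E)"
proof -
  obtain a b where *: "a \<in> slots A" "s = (\<lambda>E. slot_val E a)" "b \<in> slots A" "t = (\<lambda>E. slot_val E b)"
    using assms unfolding sterm_def by blast
  show ?thesis unfolding dpred_def
    by (rule exI[of _ "Eq (Var 0) (Var 1)"], rule exI[of _ "\<lambda>i. if i = 0 then a else b"])
       (use * in \<open>auto simp: fmls_def\<close>)
qed

lemma dpred_add:
  assumes "sterm A s" "sterm A t" "sterm A u" shows "dpred M L A (\<lambda>E. s E + t E = u E)"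
proof -
  obtain a b c where *: "a \<in> slots A" "s = (\<lambda>E. slot_val E a)" "b \<in> slots A" "t = (\<lambda>E. slot_val E b)"
     "c \<in> slots A" "u = (\<lambda>E. slot_val E c)"
    using assms unfolding sterm_def by blast
  show ?thesis unfolding dpred_def
    by (rule exI[of _ "Eq (Add (Var 0) (Var 1)) (Var 2)"],
        rule exI[of _ "\<lambda>i. if i = 0 then a else if i = 1 then b else c"])
       (use * in \<open>auto simp: fmls_def\<close>)
qed

lemma tterm_tup: "tterm A n (\<lambda>E. tup n (E i))"
  unfolding tterm_def by (rule exI[of _ "map (\<lambda>j. Inl (i, j)) [0..<n]"]) (auto simp: slots_def tup_def)

lemma tterm_const: "length u = n \<Longrightarrow> set u \<subseteq> insert 0 A \<Longrightarrow> tterm A n (\<lambda>E. u)"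
  unfolding tterm_def by (rule exI[of _ "map Inr u"]) (auto simp: slots_def comp_def)

lemma tterm_append: "tterm A n s \<Longrightarrow> tterm A m t \<Longrightarrow> tterm A (n + m) (\<lambda>E. s E @ t E)"
  unfolding tterm_def by (metis (no_types, lifting) length_append map_append set_append Un_least)

lemma tterm_Cons: "sterm A s \<Longrightarrow> tterm A m t \<Longrightarrow> tterm A (Suc m) (\<lambda>E. s E # t E)"
  unfolding tterm_def sterm_def
  by (metis (no_types, lifting) insert_subset length_Cons list.simps(15) list.simps(9))

lemma tterm_Nil: "tterm A 0 (\<lambda>E. [])"
  unfolding tterm_def by auto

lemma tterm_nth: "tterm A n t \<Longrightarrow> i < n \<Longrightarrow> sterm A (\<lambda>E. t E ! i)"
  unfolding tterm_def sterm_def using nth_mem by fastforce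

lemma tterm_length: "tterm A n t \<Longrightarrow> length (t E) = n"
  unfolding tterm_def by auto

lemma dpred_eq_tuple:
  assumes "tterm A n s" "tterm A n t" shows "dpred M L A (\<lambda>E. s E = t E)"
proof -
  have "dpred M L A (\<lambda>E. \<forall>i\<in>{..<n}. s E ! i = t E ! i)"
    by (rule dpred_all_finite) (use assms in \<open>auto intro!: dpred_eq tterm_nth\<close>)
  then show ?thesis
    by (rule dpred_cong) (use assms in \<open>auto simp: list_eq_iff_nth_eq tterm_length\<close>)
qed

section \<open>Sets definable over a sublanguage and a parameter set\<close>

definition dset ::
  "('a::{plus,ord,zero}, 'f, 'r) interp \<Rightarrow> 'f set \<times> 'r set \<Rightarrow> 'a set \<Rightarrow> nat \<Rightarrow> 'a list set \<Rightarrow> bool"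
  where "dset M L A n D \<longleftrightarrow> (\<forall>x\<in>D. length x = n) \<and> dpred M L A (\<lambda>E. tup n (E 0) \<in> D)"

lemma dpred_mem:
  assumes "dset M L A n D" "tterm A n t" shows "dpred M L A (\<lambda>E. t E \<in> D)"
proof -
  obtain ss where ss: "length ss = n" "set ss \<subseteq> slots A" "t = (\<lambda>E. map (slot_val E) ss)"
    using assms(2) unfolding tterm_def by blast
  define \<sigma> where "\<sigma> (i::nat) j = (if j < n then ss ! j else Inr 0)" for i j
  have "\<sigma> i j \<in> slots A" for i j using ss(1,2) nth_mem[of j ss] unfolding \<sigma>_def by (auto simp: slots_def dest!: subsetD)
  then have "dpred M L A (\<lambda>E. tup n (\<lambda>j. slot_val E (\<sigma> 0 j)) \<in> D)"
    using assms(1) dpred_reindex[of M L A "\<lambda>E. tup n (E 0) \<in> D" \<sigma>] unfolding dset_def by blast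
  moreover have "tup n (\<lambda>j. slot_val E (\<sigma> 0 j)) = t E" for E
    using ss(1,3) by (auto simp: list_eq_iff_nth_eq \<sigma>_def)
  ultimately show ?thesis by simp
qed

lemma dset_mono:
  "dset M L A n D \<Longrightarrow> fst L \<subseteq> fst L' \<Longrightarrow> snd L \<subseteq> snd L' \<Longrightarrow> A \<subseteq> B \<Longrightarrow> dset M L' B n D"
  unfolding dset_def using dpred_mono by blast

lemma dsetI:
  assumes "dpred M L A (\<lambda>E. R (tup n (E 0)))" shows "dset M L A n {x. length x = n \<and> R x}"
  unfolding dset_def using assms by simp

lemma dsetI2:
  assumes "dpred M L A (\<lambda>E. R (tup n (E 0)) (tup m (E 1)))"
  shows "dset M L A (n + m) {x @ y |x y. length x = n \<and> length y = m \<and> R x y}"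
proof -
  define \<sigma> :: "nat \<Rightarrow> nat \<Rightarrow> 'a slot" where "\<sigma> i j = (if i = 0 then Inl (0, j) else Inl (0, n + j))" for i j
  have "\<sigma> i j \<in> slots A" for i j by (auto simp: \<sigma>_def slots_def)
  then have *: "dpred M L A (\<lambda>E. R (tup n (\<lambda>j. slot_val E (\<sigma> 0 j))) (tup m (\<lambda>j. slot_val E (\<sigma> 1 j))))"
    using dpred_reindex[OF assms, of \<sigma>] by simp
  have "tup (n + m) f = tup n f @ tup m (\<lambda>j. f (n + j))" for f :: "nat \<Rightarrow> 'a"
    by (auto simp: list_eq_iff_nth_eq nth_append)
  then have "(tup (n + m) (E 0) \<in> {x @ y |x y. length x = n \<and> length y = m \<and> R x y}) =
     R (tup n (\<lambda>j. slot_val E (\<sigma> 0 j))) (tup m (\<lambda>j. slot_val E (\<sigma> 1 j)))" for E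
    by (auto simp: \<sigma>_def, metis length_tup)
  with * show ?thesis unfolding dset_def by auto
qed

lemma dsetI3:
  assumes "dpred M L A (\<lambda>E. R (tup n (E 0)) (tup m (E 1)) (tup k (E 2)))"
  shows "dset M L A (n + m + k) {x @ y @ z |x y z. length x = n \<and> length y = m \<and> length z = k \<and> R x y z}"
proof -
  define \<sigma> :: "nat \<Rightarrow> nat \<Rightarrow> 'a slot" where
    "\<sigma> i j = (if i = 0 then Inl (0, j) else if i = 1 then Inl (0, n + j) else Inl (0, n + m + j))" for i j
  have "\<sigma> i j \<in> slots A" for i j by (auto simp: \<sigma>_def slots_def)
  then have *: "dpred M L A (\<lambda>E. R (tup n (\<lambda>j. slot_val E (\<sigma> 0 j))) (tup m (\<lambda>j. slot_val E (\<sigma> 1 j)))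
      (tup k (\<lambda>j. slot_val E (\<sigma> 2 j))))"
    using dpred_reindex[OF assms, of \<sigma>] by simp
  have "tup (n + m + k) f = tup n f @ tup m (\<lambda>j. f (n + j)) @ tup k (\<lambda>j. f (n + m + j))" for f :: "nat \<Rightarrow> 'a"
    by (auto simp: list_eq_iff_nth_eq nth_append)
  then have "(tup (n + m + k) (E 0) \<in> {x @ y @ z |x y z. length x = n \<and> length y = m \<and> length z = k \<and> R x y z}) =
     R (tup n (\<lambda>j. slot_val E (\<sigma> 0 j))) (tup m (\<lambda>j. slot_val E (\<sigma> 1 j))) (tup k (\<lambda>j. slot_val E (\<sigma> 2 j)))" for E
    by (auto simp: \<sigma>_def, metis length_tup)
  with * show ?thesis unfolding dset_def by auto
qed

lemma dset_formula:
  assumes "dset M L A n D"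
  shows "\<exists>\<phi> e. \<phi> \<in> fmls L \<and> range e \<subseteq> insert 0 A \<and>
    D = {xs. length xs = n \<and> sat M (\<lambda>i. if i < n then xs ! i else e i) \<phi>}"
proof -
  obtain \<phi> c where p: "\<phi> \<in> fmls L" "range c \<subseteq> insert 0 A" "\<And>E. tup n (E 0) \<in> D \<longleftrightarrow> sat M (merge_env E c) \<phi>"
    using assms unfolding dset_def dpred_iff_dnorm dnorm_def by blast
  \<comment> \<open>\<open>r\<close> places the entries of the tuple at the variables below
    \<open>n\<close> and shifts every other variable by \<open>n\<close>, as the given notion of
    definability demands. Entries of \<open>E\<close> outside the tuple have no influence and
    receive 0 through \<open>e\<close>.\<close>
  define r where "r i = (if even i \<and> fst (prod_decode (i div 2)) = 0 \<and> snd (prod_decode (i div 2)) < n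
     then snd (prod_decode (i div 2)) else n + i)" for i
  define e where "e k = (if even (k - n) then 0 else c ((k - n) div 2))" for k
  have "inj r"
  proof (rule injI)
    fix i j assume *: "r i = r j"
    show "i = j"
    proof (cases "r i < n")
      case True
      then have i: "even i" "fst (prod_decode (i div 2)) = 0" "snd (prod_decode (i div 2)) = r i"
        by (auto simp: r_def split: if_splits)
      from True have j: "even j" "fst (prod_decode (j div 2)) = 0" "snd (prod_decode (j div 2)) = r j"
        unfolding * by (auto simp: r_def split: if_splits)
      from i j * have "prod_decode (i div 2) = prod_decode (j div 2)" by (simp add: prod_eq_iff)
      with i j show ?thesis by (metis dvd_mult_div_cancel prod_decode_inverse)
    qed (use * in \<open>auto simp: r_def split: if_splits\<close>)
  qed
  have "xs \<in> D \<longleftrightarrow> sat M (\<lambda>i. if i < n then xs ! i else e i) (fm_ren r \<phi>)" if l: "length xs = n" for xs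
  proof -
    let ?E = "\<lambda>a b. if a = 0 \<and> b < n then xs ! b else 0"
    have "(\<lambda>i. if i < n then xs ! i else e i) \<circ> r = merge_env ?E c"
      by (auto simp: fun_eq_iff r_def e_def merge_env_def split: prod.split)
    moreover have "tup n (?E 0) = xs" using l by (simp add: list_eq_iff_nth_eq)
    ultimately show ?thesis using p(3)[of ?E] by (simp add: sat_ren[OF \<open>inj r\<close>])
  qed
  moreover have "\<forall>x\<in>D. length x = n" using assms by (simp add: dset_def)
  moreover have "range e \<subseteq> insert 0 A" using p(2) by (auto simp: e_def)
  ultimately show ?thesis using p(1) by (intro exI[of _ "fm_ren r \<phi>"] exI[of _ e]) (auto simp: fmls_ren)
qed

lemma dset_imp_definable: "dset M L A n D \<Longrightarrow> definable M n D"
  using dset_formula unfolding definable_def by blast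

text \<open>A formula mentions finitely many symbols and parameters. This is the source of the
  finite sublanguages and parameter sets used below.\<close>

lemma definable_imp_dset:
  assumes "definable M n D"
  obtains F R A where "finite F" "finite R" "finite A" "dset M (F, R) A n D"
proof -
  obtain \<phi> e where D: "D = {xs. length xs = n \<and> sat M (\<lambda>i. if i < n then xs ! i else e i) \<phi>}"
    using assms unfolding definable_def by blast
  define s :: "nat \<Rightarrow> 'a slot" where "s i = (if i \<in> fm_fv \<phi> then if i < n then Inl (0, i) else Inr (e i) else Inr 0)" for i
  have "tup n (E 0) \<in> D \<longleftrightarrow> sat M (\<lambda>i. slot_val E (s i)) \<phi>" for E
  proof -
    have "tup n (E 0) \<in> D \<longleftrightarrow> sat M (\<lambda>i. if i < n then tup n (E 0) ! i else e i) \<phi>"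
      by (simp add: D)
    also have "\<dots> \<longleftrightarrow> sat M (\<lambda>i. slot_val E (s i)) \<phi>"
      by (rule sat_cong) (auto simp: s_def)
    finally show ?thesis .
  qed
  moreover have "finite (set_trm t)" for t :: "'b trm" by (induction t) auto
  then have "finite (set1_fm \<phi>)" "finite (set2_fm \<phi>)" by (induction \<phi>) auto
  moreover have "range s \<subseteq> slots (e ` fm_fv \<phi>)" by (auto simp: s_def slots_def)
  moreover have "\<phi> \<in> fmls (set1_fm \<phi>, set2_fm \<phi>)" by (simp add: fmls_def)
  moreover have "\<forall>x\<in>D. length x = n" by (simp add: D)
  ultimately show thesis
    using that[of "set1_fm \<phi>" "set2_fm \<phi>" "e ` fm_fv \<phi>"] finite_fm_fv unfolding dset_def dpred_def by blast
qed

abbreviation "full \<equiv> (UNIV, UNIV)"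

lemma definable_iff_dset: "definable M n D \<longleftrightarrow> dset M full UNIV n D"
proof
  assume "definable M n D"
  then obtain F R A where "dset M (F, R) A n D" by (rule definable_imp_dset)
  then show "dset M full UNIV n D" by (rule dset_mono) auto
qed (rule dset_imp_definable)

instance trm :: (countable) countable by countable_datatype
instance fm :: (countable, countable) countable by countable_datatype

text \<open>Numbering the symbols in \<open>F\<close> and \<open>R\<close> maps these formulas
  injectively to formulas over the natural numbers, which form a countable datatype.\<close>

lemma countable_fmls:
  assumes "countable F" "countable R" shows "countable (fmls (F, R))"
proof -
  have "inj_on (map_fm (to_nat_on F) (to_nat_on R)) (fmls (F, R))"
  proof (rule inj_onI)
    fix \<phi> \<psi> assume *: "\<phi> \<in> fmls (F, R)" "\<psi> \<in> fmls (F, R)"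
      "map_fm (to_nat_on F) (to_nat_on R) \<phi> = map_fm (to_nat_on F) (to_nat_on R) \<psi>"
    show "\<phi> = \<psi>"
      by (rule fm.inj_map_strong[OF _ _ *(3)])
         (use * assms in \<open>auto simp: fmls_def dest!: subsetD intro: inj_onD[OF inj_on_to_nat_on]\<close>)
  qed
  then show ?thesis by (rule countable_image_inj_on[rotated]) auto
qed

text \<open>A parameter assignment is infinite data, but only its values at the variables of the
  formula matter, so a finite list from \<open>insert 0 A\<close> codes it.\<close>

lemma countable_dsets:
  assumes "countable F" "countable R" "countable A"
  shows "countable {D. dset M (F, R) A n D}"
proof -
  let ?S = "\<lambda>(\<phi>, ps). {xs. length xs = n \<and>
     sat M (\<lambda>i. if i < n then xs ! i else if i < length ps then ps ! i else 0) \<phi>}"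
  have "{D. dset M (F, R) A n D} \<subseteq> ?S ` (fmls (F, R) \<times> lists (insert 0 A))"
  proof
    fix D assume "D \<in> {D. dset M (F, R) A n D}"
    then obtain \<phi> e where p: "\<phi> \<in> fmls (F, R)" "range e \<subseteq> insert 0 A"
      "D = {xs. length xs = n \<and> sat M (\<lambda>i. if i < n then xs ! i else e i) \<phi>}"
      using dset_formula by blast
    obtain m where m: "\<forall>i\<in>fm_fv \<phi>. i < m" using finite_fm_fv finite_nat_set_iff_bounded by blast
    let ?ps = "map e [0..<m]"
    have "sat M (\<lambda>i. if i < n then xs ! i else e i) \<phi> \<longleftrightarrow>
        sat M (\<lambda>i. if i < n then xs ! i else if i < length ?ps then ?ps ! i else 0) \<phi>" for xs
      by (rule sat_cong) (use m in auto)
    then have "D = ?S (\<phi>, ?ps)" using p(3) by auto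
    moreover have "(\<phi>, ?ps) \<in> fmls (F, R) \<times> lists (insert 0 A)" using p(1,2) by (auto simp: image_subset_iff)
    ultimately show "D \<in> ?S ` (fmls (F, R) \<times> lists (insert 0 A))" by blast
  qed
  moreover have "countable (?S ` (fmls (F, R) \<times> lists (insert 0 A)))"
    using assms by (intro countable_image countable_SIGMA countable_fmls countable_lists) auto
  ultimately show ?thesis by (rule countable_subset)
qed

section \<open>Saturation for tuples\<close>

lemma small_subset: "small \<kappa> B \<Longrightarrow> A \<subseteq> B \<Longrightarrow> small \<kappa> A"
  unfolding small_def using card_of_mono1 ordLeq_ordLess_trans by blast

lemma small_countable:
  includes cardinal_syntax
  fixes A :: "'b set"
  assumes "sufficiently_saturated \<kappa> M" "countable A" shows "small \<kappa> A"
proof -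
  obtain f :: "'b \<Rightarrow> nat" where "inj_on f A" using assms(2) unfolding countable_def by blast
  then have "|A| \<le>o |UNIV :: nat set|" using card_of_ordLeq by blast
  then show ?thesis
    using assms(1) card_of_nat ordLeq_ordIso_trans ordLeq_ordLess_trans
    unfolding small_def sufficiently_saturated_def by blast
qed

lemma small_UN:
  includes cardinal_syntax
  assumes s: "sufficiently_saturated \<kappa> M" and "small \<kappa> I" "\<And>i. i \<in> I \<Longrightarrow> countable (B i)"
  shows "small \<kappa> (\<Union>i\<in>I. B i)"
proof -
  let ?J = "I <+> (UNIV :: nat set)"
  have "natLeq <o \<kappa>" and co: "Card_order \<kappa>" using s unfolding sufficiently_saturated_def by auto
  have n: "|UNIV :: nat set| <o \<kappa>"
    using \<open>natLeq <o \<kappa>\<close> card_of_nat ordIso_ordLess_trans by blast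
  then have "|UNIV :: nat set| \<le>o |Field \<kappa>|"
    using ordLeq_ordIso_trans[OF ordLess_imp_ordLeq ordIso_symmetric[OF card_of_Field_ordIso[OF co]]] by blast
  then have inf: "\<not> finite (Field \<kappa>)" using card_of_ordLeq_infinite infinite_UNIV_nat by blast
  have J: "|?J| <o \<kappa>"
    by (rule card_of_Plus_ordLess_infinite_Field[OF inf co _ n]) (use assms(2) in \<open>simp add: small_def\<close>)
  have "|\<Union>i\<in>I. B i| \<le>o |?J|"
  proof (rule card_of_UNION_ordLeq_infinite)
    show "\<forall>i\<in>I. |B i| \<le>o |?J|"
    proof
      fix i assume "i \<in> I"
      then obtain f where "inj_on f (B i)" "range f \<subseteq> (UNIV :: nat set)" using assms(3) unfolding countable_def by blast
      then have "|B i| \<le>o |UNIV :: nat set|" using card_of_ordLeq by blast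
      then show "|B i| \<le>o |?J|" using card_of_Plus2 ordLeq_transitive by blast
    qed
  qed (auto simp: card_of_Plus1)
  then show ?thesis unfolding small_def using J ordLeq_ordLess_trans by blast
qed

text \<open>Saturation is given for one variable. A first coordinate is found that extends to every
  finite subfamily at once; it joins the parameters, and the fibres over it have the finite
  intersection property in one dimension less.\<close>

lemma saturation_tuples:
  fixes M :: "('a::{plus,ord,zero}, 'f, 'r) interp"
  assumes s: "sufficiently_saturated \<kappa> M" and "small \<kappa> A" "\<And>D. D \<in> \<D> \<Longrightarrow> dset M full A n D"
    "\<And>\<F>. finite \<F> \<Longrightarrow> \<F> \<subseteq> \<D> \<Longrightarrow> \<exists>x. length x = n \<and> (\<forall>D\<in>\<F>. x \<in> D)"
  shows "\<exists>x. length x = n \<and> (\<forall>D\<in>\<D>. x \<in> D)"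
  using assms(2-)
proof (induction n arbitrary: A \<D>)
  case 0
  have "[] \<in> D" if "D \<in> \<D>" for D using "0.prems"(3)[of "{D}"] that by auto
  then show ?case by auto
next
  case (Suc n)
  \<comment> \<open>\<open>Q \<F>\<close> projects the intersection of \<open>\<F>\<close> to the
    first coordinate. Over all finite \<open>\<F>\<close> together these projections form the
    one-variable type to be realised.\<close>
  define Q where "Q \<F> = {z::'a list. length z = Suc 0 \<and> (\<exists>y. length y = n \<and> (\<forall>D\<in>\<F>. hd z # y \<in> D))}" for \<F>
  have Qd: "dset M full A (Suc 0) (Q \<F>)" if "finite \<F>" "\<F> \<subseteq> \<D>" for \<F>
    unfolding Q_def
  proof (rule dsetI, rule dpred_ex_tuple[where k = 1])
    show "dpred M full A (\<lambda>E. \<forall>D\<in>\<F>. hd (tup (Suc 0) (E 0)) # tup n (E 1) \<in> D)"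
    proof (rule dpred_all_finite[OF that(1)])
      fix D assume "D \<in> \<F>"
      then have "dset M full A (Suc n) D" using Suc.prems(2) that by blast
      then have "dpred M full A (\<lambda>E. E 0 0 # tup n (E 1) \<in> D)"
        by (rule dpred_mem) (intro tterm_Cons sterm_var tterm_tup)
      then show "dpred M full A (\<lambda>E. hd (tup (Suc 0) (E 0)) # tup n (E 1) \<in> D)"
        by (simp add: tup_Suc_0)
    qed
  qed simp
  define \<I> where "\<I> = {\<F>. finite \<F> \<and> \<F> \<subseteq> \<D>}"
  have "\<forall>\<F>\<in>\<I>. \<exists>\<phi>e. range (snd \<phi>e) \<subseteq> insert 0 A \<and>
      (\<forall>x. [x] \<in> Q \<F> \<longleftrightarrow> sat M ((snd \<phi>e)(0 := x)) (fst \<phi>e))"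
  proof
    fix \<F> assume "\<F> \<in> \<I>"
    then have "dset M full A (Suc 0) (Q \<F>)" by (intro Qd) (auto simp: \<I>_def)
    from dset_formula[OF this] obtain \<phi> e where "range e \<subseteq> insert 0 A"
      "Q \<F> = {xs. length xs = Suc 0 \<and> sat M (\<lambda>i. if i < Suc 0 then xs ! i else e i) \<phi>}"
      by blast
    moreover have "(\<lambda>i. if i < Suc 0 then [x] ! i else e i) = e(0 := x)" for x by auto
    ultimately show "\<exists>\<phi>e. range (snd \<phi>e) \<subseteq> insert 0 A \<and>
      (\<forall>x. [x] \<in> Q \<F> \<longleftrightarrow> sat M ((snd \<phi>e)(0 := x)) (fst \<phi>e))"
      by (intro exI[of _ "(\<phi>, e)"]) simp
  qed
  from bchoice[OF this] obtain g where g: "\<forall>\<F>\<in>\<I>. range (snd (g \<F>)) \<subseteq> insert 0 A"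
    "\<forall>\<F>\<in>\<I>. \<forall>x. [x] \<in> Q \<F> \<longleftrightarrow> sat M ((snd (g \<F>))(0 := x)) (fst (g \<F>))"
    by blast
  have "small \<kappa> (\<Union>a\<in>A. {0, a})"
    by (rule small_UN[OF s Suc.prems(1)]) auto
  moreover have "small \<kappa> {0::'a}" by (rule small_countable[OF s]) auto
  ultimately have sm: "small \<kappa> (insert 0 A)"
    by (cases "A = {}") (auto elim: small_subset)
  have sat: "saturated \<kappa> M" using s unfolding sufficiently_saturated_def by blast
  have H1: "\<forall>(\<phi>, e)\<in>g ` \<I>. range e \<subseteq> insert 0 A" using g(1) by (auto simp: split_beta)
  have H2: "\<exists>x. \<forall>(\<phi>, e)\<in>F. sat M (e(0 := x)) \<phi>" if F: "F \<subseteq> g ` \<I>" "finite F" for F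
  proof -
    obtain \<J> where J: "\<J> \<subseteq> \<I>" "finite \<J>" "F = g ` \<J>" using finite_subset_image[OF F(2,1)] by blast
    then have "finite (\<Union>\<J>)" "\<Union>\<J> \<subseteq> \<D>" by (auto simp: \<I>_def)
    then obtain z where z: "length z = Suc n" "\<forall>D\<in>\<Union>\<J>. z \<in> D" using Suc.prems(3) by blast
    then have "[hd z] \<in> Q \<F>" if "\<F> \<in> \<J>" for \<F>
      using that unfolding Q_def by (auto intro!: exI[of _ "tl z"] simp: length_Suc_conv)
    then have "sat M ((snd p)(0 := hd z)) (fst p)" if "p \<in> F" for p
      using that J g(2) by blast
    then show ?thesis by (intro exI[of _ "hd z"]) (simp add: split_beta)
  qed
  obtain x where "\<forall>(\<phi>, e)\<in>g ` \<I>. sat M (e(0 := x)) \<phi>"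
    using sat[unfolded saturated_def, THEN spec, THEN spec, THEN mp, THEN mp, THEN mp, OF sm H1] H2 by blast
  then have x: "[x] \<in> Q \<F>" if "\<F> \<in> \<I>" for \<F> using that g(2) by (auto simp: split_beta)
  define \<D>' where "\<D>' = (\<lambda>D. {y. length y = n \<and> x # y \<in> D}) ` \<D>"
  have "\<exists>y. length y = n \<and> (\<forall>D\<in>\<D>'. y \<in> D)"
  proof (rule Suc.IH)
    have "small \<kappa> (\<Union>a\<in>A. {x, a})"
      by (rule small_UN[OF s Suc.prems(1)]) auto
    moreover have "small \<kappa> {x}" by (rule small_countable[OF s]) auto
    ultimately show "small \<kappa> (insert x A)"
      by (cases "A = {}") (auto elim: small_subset)
    fix D assume "D \<in> \<D>'"
    then obtain D0 where D0: "D0 \<in> \<D>" "D = {y. length y = n \<and> x # y \<in> D0}" unfolding \<D>'_def by blast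
    have "dset M full (insert x A) (Suc n) D0" by (rule dset_mono[OF Suc.prems(2)[OF D0(1)]]) auto
    then have "dpred M full (insert x A) (\<lambda>E. x # tup n (E 0) \<in> D0)"
      by (rule dpred_mem) (intro tterm_Cons sterm_const tterm_tup, simp)
    then show "dset M full (insert x A) n D" unfolding D0(2) by (rule dsetI)
  next
    fix \<F> assume fin: "finite \<F>" "\<F> \<subseteq> \<D>'"
    from finite_subset_image[OF fin(1) fin(2)[unfolded \<D>'_def]] obtain \<J> where J: "\<J> \<subseteq> \<D>" "finite \<J>" "\<F> = (\<lambda>D. {y. length y = n \<and> x # y \<in> D}) ` \<J>"
      by blast
    then have "[x] \<in> Q \<J>" by (intro x) (simp add: \<I>_def)
    then show "\<exists>x. length x = n \<and> (\<forall>D\<in>\<F>. x \<in> D)" unfolding Q_def J(3) by auto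
  qed
  then obtain y where "length y = n" "\<forall>D\<in>\<D>. x # y \<in> D" unfolding \<D>'_def by auto
  then show ?case by (intro exI[of _ "x # y"]) auto
qed

text \<open>Compactness, the form in which saturation is used from here on: if no finite subfamily
  covered \<open>Y\<close>, the sets \<open>Y - D\<close> would have the finite intersection
  property, and a common point would lie in \<open>Y\<close> but in no \<open>D\<close>.\<close>

lemma definable_finite_cover:
  fixes M :: "('a::{plus,ord,zero}, 'f, 'r) interp"
  assumes s: "sufficiently_saturated \<kappa> M" and Y: "definable M n Y"
    and "small \<kappa> \<D>" "\<And>D. D \<in> \<D> \<Longrightarrow> definable M n D" "Y \<subseteq> \<Union>\<D>"
  obtains \<F> where "\<F> \<subseteq> \<D>" "finite \<F>" "Y \<subseteq> \<Union>\<F>"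
proof (rule ccontr)
  assume *: "\<not> thesis"
  note sub = that
  have "\<forall>D\<in>\<D>. \<exists>A. finite A \<and> dset M full A n D"
  proof
    fix D assume "D \<in> \<D>"
    then obtain F R A where "finite F" "finite R" "finite A" "dset M (F, R) A n D"
      by (rule definable_imp_dset[OF assms(4)])
    then show "\<exists>A. finite A \<and> dset M full A n D" using dset_mono[of M "(F, R)" A n D full A] by auto
  qed
  from bchoice[OF this] obtain a where a: "\<forall>D\<in>\<D>. finite (a D) \<and> dset M full (a D) n D" by blast
  obtain F R A0 where A0: "finite F" "finite R" "finite A0" "dset M (F, R) A0 n Y"
    by (rule definable_imp_dset[OF Y])
  \<comment> \<open>Each member of the cover needs finitely many parameters, so the union over the
    small family is small. The parameters of \<open>Y\<close> are attached to every index, which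
    takes them in because the family is nonempty.\<close>
  define A where "A = (\<Union>D\<in>\<D>. a D \<union> A0)"
  have "\<D> \<noteq> {}" using * that[of "{}"] assms(5) by auto
  have len: "\<forall>y\<in>Y. length y = n" using A0(4) by (simp add: dset_def)
  have "small \<kappa> A" unfolding A_def
    by (rule small_UN[OF s assms(3)]) (use a A0 in \<open>auto intro: countable_finite\<close>)
  moreover have Yd: "dset M full A n Y"
    by (rule dset_mono[OF A0(4)]) (use \<open>\<D> \<noteq> {}\<close> in \<open>auto simp: A_def\<close>)
  moreover have "dset M full A n {x. length x = n \<and> x \<in> Y - D}" if "D \<in> \<D>" for D
  proof -
    have "dset M full A n D" by (rule dset_mono[of M full "a D"]) (use a that in \<open>auto simp: A_def\<close>)
    with Yd show ?thesis
      by (intro dsetI) (auto intro!: dpred_conj dpred_not dpred_mem tterm_tup)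
  qed
  ultimately have "\<exists>x. length x = n \<and> (\<forall>C\<in>(\<lambda>D. {x. length x = n \<and> x \<in> Y - D}) ` \<D>. x \<in> C)"
  proof (rule_tac saturation_tuples[OF s, of A])
    fix \<F> assume fin: "finite \<F>" "\<F> \<subseteq> (\<lambda>D. {x. length x = n \<and> x \<in> Y - D}) ` \<D>"
    from finite_subset_image[OF fin] obtain \<J> where
      J: "\<J> \<subseteq> \<D>" "finite \<J>" "\<F> = (\<lambda>D. {x. length x = n \<and> x \<in> Y - D}) ` \<J>" by blast
    then obtain y where "y \<in> Y" "y \<notin> \<Union>\<J>" using * sub by blast
    then show "\<exists>x. length x = n \<and> (\<forall>D\<in>\<F>. x \<in> D)" using J(3) len by auto
  qed auto
  with \<open>\<D> \<noteq> {}\<close> assms(5) show False by auto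
qed

section \<open>Approximate subgroups of finitely generated abelian groups\<close>

text \<open>With \<open>b\<close> in \<open>S\<close> above every correction in \<open>H\<close>,
  the move from \<open>s\<close> to \<open>s + b - x\<close> goes up by at least 1 and by at most
  \<open>b + h\<close>. Repeating it brings \<open>S\<close> within \<open>b + h\<close> of every
  nonnegative integer, and symmetry covers the negative ones.\<close>

lemma int_approximate_subgroup_syndetic:
  fixes S H :: "int set"
  assumes "infinite S" "\<And>s. s \<in> S \<Longrightarrow> - s \<in> S" "finite H"
    "\<And>s t. s \<in> S \<Longrightarrow> t \<in> S \<Longrightarrow> \<exists>h\<in>H. s + t - h \<in> S"
  obtains E where "finite E" "\<And>n. \<exists>e\<in>E. n - e \<in> S"
proof -
  define h where "h = Max (insert 0 (abs ` H))"
  have h: "\<bar>x\<bar> \<le> h" if "x \<in> H" for x using assms(3) that by (auto simp: h_def)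
  have "0 \<le> h" using assms(3) by (simp add: h_def)
  obtain b where b: "b \<in> S" "b > h"
  proof -
    have "\<not> S \<subseteq> {-h..h}" using assms(1) finite_subset by blast
    then obtain c where "c \<in> S" "c < -h \<or> c > h" by (auto simp: subset_iff not_le)
    then show thesis using that[of c] that[of "-c"] assms(2) by fastforce
  qed
  have pos: "\<exists>s\<in>S. \<bar>int n - s\<bar> \<le> b + h" for n
  proof (induction n)
    case 0 show ?case using b \<open>0 \<le> h\<close> by (intro bexI[of _ b]) auto
  next
    case (Suc n)
    then obtain s where s: "s \<in> S" "\<bar>int n - s\<bar> \<le> b + h" by blast
    show ?case
    proof (cases "\<bar>int (Suc n) - s\<bar> \<le> b + h")
      case False
      \<comment> \<open>The invariant breaks only if \<open>s\<close> lies exactly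
        \<open>b + h\<close> below \<open>n\<close>. After the move the distance to
        \<open>n + 1\<close> is \<open>1 + h + x\<close>, at most \<open>1 + 2 * h\<close>, which
        \<open>b > h\<close> keeps within the bound.\<close>
      then have "s = int n - (b + h)" using s(2) by auto
      moreover obtain x where "x \<in> H" "s + b - x \<in> S" using assms(4) s(1) b(1) by blast
      ultimately show ?thesis using h[of x] b(2) by (intro bexI[of _ "s + b - x"]) auto
    qed (use s in blast)
  qed
  have "\<exists>e\<in>{-(b+h)..b+h}. n - e \<in> S" for n
  proof -
    obtain s where "s \<in> S" "\<bar>n - s\<bar> \<le> b + h"
    proof (cases "n \<ge> 0")
      case True then show thesis using pos[of "nat n"] that by auto
    next
      case False
      then obtain s where "s \<in> S" "\<bar>- n - s\<bar> \<le> b + h" using pos[of "nat (-n)"] by auto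
      then show thesis using that[of "-s"] assms(2) by auto
    qed
    then show ?thesis by (intro bexI[of _ "n - s"]) auto
  qed
  then show thesis using that[of "{-(b+h)..b+h}"] by blast
qed


lemma (in comm_group) generate_insertE:
  assumes "x \<in> generate G (insert v T)" "v \<in> carrier G" "T \<subseteq> carrier G"
  shows "\<exists>h\<in>generate G T. \<exists>k::int. x = h \<otimes> v [^] k"
  using assms(1)
proof induction
  case one
  then show ?case using generate.one[of G T] by (intro bexI[of _ \<one>] exI[of _ 0]) auto
next
  case (incl h)
  show ?case
  proof (cases "h = v")
    case True
    then show ?thesis using generate.one[of G T] assms(2) by (intro bexI[of _ \<one>] exI[of _ 1]) auto
  next
    case False
    then have "h \<in> T" using incl by auto
    then have "h \<in> generate G T" by (rule generate.incl)
    moreover have "h \<in> carrier G" using False incl assms(3) by auto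
    ultimately show ?thesis by (intro bexI[of _ h] exI[of _ 0]) auto
  qed
next
  case (inv h)
  show ?case
  proof (cases "h = v")
    case True
    have "v [^] (- 1 :: int) = inv v" using int_pow_neg[of v 1] assms(2) by (simp add: int_pow_1)
    then have "inv h = \<one> \<otimes> v [^] (- 1 :: int)" using True assms(2) by simp
    then show ?thesis by (intro bexI[OF _ generate.one] exI)
  next
    case False
    then have "h \<in> T" using inv by auto
    then have "inv h \<in> generate G T" by (rule generate.inv)
    moreover have "h \<in> carrier G" using False inv assms(3) by auto
    ultimately show ?thesis by (intro bexI[of _ "inv h"] exI[of _ 0]) auto
  qed
next
  case (eng a b)
  then obtain h h' and k k' :: int where *: "h \<in> generate G T" "h' \<in> generate G T" "a = h \<otimes> v [^] k" "b = h' \<otimes> v [^] k'"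
    by blast
  moreover have "h \<in> carrier G" "h' \<in> carrier G" using * generate_in_carrier assms(3) by auto
  ultimately show ?case using generate.eng[of h G T h'] assms(2)
    by (intro bexI[of _ "h \<otimes> h'"] exI[of _ "k + k'"]) (auto simp: int_pow_mult m_ac)
qed

text \<open>Being in \<open>B\<close> modulo \<open>N\<close> up to finitely many translates
  propagates along products, so the powers of a single generator \<open>v\<close> suffice. If
  \<open>v\<close> is outside \<open>T\<close>, maximality of \<open>T\<close> makes the exponents
  \<open>k\<close> for which \<open>v [^] k\<close> is close to \<open>B\<close> an infinite
  approximate subgroup of the integers, hence one with bounded gaps.\<close>

lemma (in comm_group) approximate_subgroup_complement:
  assumes S: "finite S" "S \<subseteq> carrier G"
    and B: "B \<subseteq> carrier G" "\<one> \<in> B" "\<And>b. b \<in> B \<Longrightarrow> inv b \<in> B"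
    and F: "finite F" "F \<subseteq> carrier G" "\<And>a b. a \<in> B \<Longrightarrow> b \<in> B \<Longrightarrow> \<exists>f\<in>F. a \<otimes> b \<otimes> inv f \<in> B"
  obtains N E where "subgroup N G" "N \<subseteq> generate G S" "\<And>g. g \<in> carrier G \<Longrightarrow> finite {x \<in> N. x \<otimes> g \<in> B}"
    "finite E" "E \<subseteq> carrier G" "\<And>x. x \<in> generate G S \<Longrightarrow> \<exists>y\<in>N. \<exists>e\<in>E. x \<otimes> y \<otimes> inv e \<in> B"
proof -
  \<comment> \<open>Maximality is taken by cardinality among the subsets of \<open>S\<close>; the
    search can start because the empty set spans only the identity.\<close>
  define ok where "ok T \<longleftrightarrow> T \<subseteq> S \<and> (\<forall>g\<in>carrier G. finite {x \<in> generate G T. x \<otimes> g \<in> B})" for T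
  have "ok {}" by (auto simp: ok_def generate_empty)
  moreover have "\<forall>T. ok T \<longrightarrow> card T < Suc (card S)"
    using S(1) card_mono less_Suc_eq_le unfolding ok_def by blast
  ultimately obtain T where T: "ok T" "\<And>T'. ok T' \<Longrightarrow> card T' \<le> card T"
    using ex_has_greatest_nat[of ok "{}" card "Suc (card S)"] by blast
  define N where "N = generate G T"
  have TS: "T \<subseteq> S" and Tc: "T \<subseteq> carrier G" and finT: "finite T" using T(1) S by (auto simp: ok_def finite_subset)
  have sN: "subgroup N G" unfolding N_def using Tc by (rule generate_is_subgroup)
  note Nc = subgroup.mem_carrier[OF sN] and N1 = subgroup.one_closed[OF sN]
    and Nm = subgroup.m_closed[OF sN] and Ni = subgroup.m_inv_closed[OF sN]
  \<comment> \<open>\<open>nr E x\<close> places \<open>x\<close> in the product of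
    \<open>B\<close>, \<open>N\<close> and \<open>E\<close>: it is in \<open>B\<close> modulo
    \<open>N\<close>, with error in \<open>E\<close>.\<close>
  define nr where "nr E x \<longleftrightarrow> (\<exists>y\<in>N. \<exists>e\<in>E. x \<otimes> y \<otimes> inv e \<in> B)" for E x
  \<comment> \<open>Equal errors cancel in a quotient, so the new error lies in the fixed set
    \<open>F\<close> and no longer depends on \<open>e\<close>.\<close>
  have nr_diff: "nr F (x \<otimes> inv x')" if "nr {e} x" "nr {e} x'" "x \<in> carrier G" "x' \<in> carrier G" "e \<in> carrier G" for e x x'
  proof -
    obtain y y' where y: "y \<in> N" "y' \<in> N" "x \<otimes> y \<otimes> inv e \<in> B" "x' \<otimes> y' \<otimes> inv e \<in> B"
      using \<open>nr {e} x\<close> \<open>nr {e} x'\<close> unfolding nr_def by blast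
    note c = Nc[OF y(1)] Nc[OF y(2)]
    from y obtain f where f: "f \<in> F" "x \<otimes> y \<otimes> inv e \<otimes> inv (x' \<otimes> y' \<otimes> inv e) \<otimes> inv f \<in> B" using B(3) F(3) by blast
    have "inv e \<otimes> (e \<otimes> z) = z" if "z \<in> carrier G" for z using that \<open>e \<in> carrier G\<close> by (simp flip: m_assoc)
    then have "x \<otimes> y \<otimes> inv e \<otimes> inv (x' \<otimes> y' \<otimes> inv e) = x \<otimes> y \<otimes> inv (x' \<otimes> y')"
      using c that(3-) by (simp add: inv_mult_group m_assoc)
    then have "x \<otimes> y \<otimes> inv e \<otimes> inv (x' \<otimes> y' \<otimes> inv e) = x \<otimes> inv x' \<otimes> (y \<otimes> inv y')"
      using c that(3-) by (simp add: inv_mult m_ac)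
    then show ?thesis using f y Nm Ni unfolding nr_def by (intro bexI[of _ "y \<otimes> inv y'"] bexI[of _ f]) auto
  qed
  have nr_mult: "nr ((\<lambda>(f, e, e'). f \<otimes> (e \<otimes> e')) ` (F \<times> E \<times> E')) (x \<otimes> x')"
    if h: "nr E x" "nr E' x'" "x \<in> carrier G" "x' \<in> carrier G" "E \<subseteq> carrier G" "E' \<subseteq> carrier G" for E E' x x'
  proof -
    obtain y y' e e' where y: "y \<in> N" "y' \<in> N" "e \<in> E" "e' \<in> E'" "x \<otimes> y \<otimes> inv e \<in> B" "x' \<otimes> y' \<otimes> inv e' \<in> B"
      using h(1,2) unfolding nr_def by blast
    note c = Nc[OF y(1)] Nc[OF y(2)]
    have ec: "e \<in> carrier G" "e' \<in> carrier G" using y that by auto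
    from y obtain f where f: "f \<in> F" "x \<otimes> y \<otimes> inv e \<otimes> (x' \<otimes> y' \<otimes> inv e') \<otimes> inv f \<in> B" using F(3) by blast
    have "f \<in> carrier G" using f F by auto
    then have "x \<otimes> y \<otimes> inv e \<otimes> (x' \<otimes> y' \<otimes> inv e') \<otimes> inv f = x \<otimes> x' \<otimes> (y \<otimes> y') \<otimes> inv (f \<otimes> (e \<otimes> e'))"
      using c ec that by (simp add: inv_mult m_ac)
    with f y show ?thesis unfolding nr_def
      by (intro bexI[of _ "y \<otimes> y'"] bexI[of _ "f \<otimes> (e \<otimes> e')"]) (auto intro!: Nm image_eqI[of _ _ "(f, e, e')"])
  qed
  have nr_inv: "nr (m_inv G ` E) (inv x)" if h: "nr E x" "x \<in> carrier G" "E \<subseteq> carrier G" for E x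
  proof -
    obtain y e where y: "y \<in> N" "e \<in> E" "x \<otimes> y \<otimes> inv e \<in> B" using h(1) unfolding nr_def by blast
    have "inv (x \<otimes> y \<otimes> inv e) = inv x \<otimes> inv y \<otimes> inv (inv e)"
      using y Nc that by (auto simp: inv_mult subset_iff)
    with y B(3) Ni show ?thesis unfolding nr_def by (metis image_eqI)
  qed
  have step: "\<exists>E. finite E \<and> E \<subseteq> carrier G \<and> (\<forall>k::int. nr E (v [^] k))" if v: "v \<in> S" for v
  proof (cases "v \<in> T")
    case True
    have "nr {\<one>} (v [^] k)" for k :: int
    proof -
      have "v \<in> N" unfolding N_def using True generate.incl by metis
      then have "inv (v [^] k) \<in> N" using subgroup_int_pow_closed[OF sN] Ni by blast
      moreover have "v [^] k \<in> carrier G" using Nc[OF \<open>v \<in> N\<close>] by simp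
      ultimately show ?thesis unfolding nr_def using B(2) by (intro bexI[of _ "inv (v [^] k)"] bexI[of _ \<one>]) auto
    qed
    then show ?thesis by (intro exI[of _ "{\<one>}"]) auto
  next
    case False
    have vc: "v \<in> carrier G" using v S by auto
    have "card (insert v T) > card T" using False finT by simp
    then have "\<not> ok (insert v T)" using T(2)[of "insert v T"] by auto
    then obtain g where g: "g \<in> carrier G" "infinite {x \<in> generate G (insert v T). x \<otimes> g \<in> B}"
      using v TS unfolding ok_def by auto
    define K where "K = {k::int. \<exists>h\<in>N. h \<otimes> v [^] k \<otimes> g \<in> B}"
    \<comment> \<open>The infinite set is sorted by the exponent of \<open>v\<close>. Each exponent
      contributes finitely many elements, because \<open>T\<close> is still \<open>ok\<close>, so
      infinitely many exponents occur.\<close>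
    have sub: "{x \<in> generate G (insert v T). x \<otimes> g \<in> B} \<subseteq>
        (\<Union>k\<in>K. (\<lambda>h. h \<otimes> v [^] k) ` {h \<in> N. h \<otimes> (v [^] k \<otimes> g) \<in> B})"
    proof
      fix x assume x: "x \<in> {x \<in> generate G (insert v T). x \<otimes> g \<in> B}"
      then obtain h and k :: int where hk: "h \<in> N" "x = h \<otimes> v [^] k"
        using generate_insertE[of x v T] vc Tc unfolding N_def by blast
      moreover have "k \<in> K" using hk x unfolding K_def by blast
      moreover have "h \<otimes> v [^] k \<otimes> g = h \<otimes> (v [^] k \<otimes> g)" using Nc[OF hk(1)] vc g by (simp add: m_assoc)
      ultimately show "x \<in> (\<Union>k\<in>K. (\<lambda>h. h \<otimes> v [^] k) ` {h \<in> N. h \<otimes> (v [^] k \<otimes> g) \<in> B})"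
        using x by (intro UN_I[of k]) auto
    qed
    have fin: "finite {h \<in> N. h \<otimes> (v [^] k \<otimes> g) \<in> B}" for k :: int
      using T(1) vc g unfolding ok_def N_def by auto
    have "infinite K"
    proof
      assume "finite K"
      then have "finite (\<Union>k\<in>K. (\<lambda>h. h \<otimes> v [^] k) ` {h \<in> N. h \<otimes> (v [^] k \<otimes> g) \<in> B})" using fin by blast
      from finite_subset[OF sub this] show False using g(2) by contradiction
    qed
    then obtain k0 where k0: "k0 \<in> K" by (metis finite.emptyI ex_in_conv)
    have nrK: "nr {inv g} (v [^] k)" if kK: "k \<in> K" for k :: int
    proof -
      obtain h where h: "h \<in> N" "h \<otimes> v [^] k \<otimes> g \<in> B" using kK K_def by blast
      have "h \<otimes> v [^] k \<otimes> g = v [^] k \<otimes> h \<otimes> inv (inv g)"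
        using Nc[OF h(1)] vc g by (simp add: m_ac)
      with h show ?thesis unfolding nr_def by auto
    qed
    \<comment> \<open>The error set is made symmetric so that \<open>S0\<close> becomes closed under
      negation.\<close>
    define F' where "F' = F \<union> m_inv G ` F"
    have F'c: "F' \<subseteq> carrier G" "finite F'" using F by (auto simp: F'_def)
    have nrF': "nr F' x" if "nr F x" for x using that unfolding nr_def F'_def by blast
    define S0 where "S0 = {k::int. nr F' (v [^] k)}"
    have pd: "v [^] (a - b) = v [^] a \<otimes> inv (v [^] b)" for a b :: int using vc by (simp add: int_pow_diff)
    have "(\<lambda>k. k - k0) ` K \<subseteq> S0"
      using nr_diff[OF nrK nrK[OF k0]] vc g by (auto simp: S0_def pd intro!: nrF')
    moreover have "infinite ((\<lambda>k. k - k0) ` K)" using \<open>infinite K\<close> by (simp add: finite_image_iff inj_on_def)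
    ultimately have "infinite S0" using finite_subset by blast
    moreover have "- k \<in> S0" if "k \<in> S0" for k
    proof -
      have "m_inv G ` F' \<subseteq> F'" using F by (auto simp: F'_def)
      moreover have "nr (m_inv G ` F') (inv (v [^] k))"
        using nr_inv[of F' "v [^] k"] that vc F'c by (simp add: S0_def)
      ultimately have "nr F' (inv (v [^] k))" unfolding nr_def by blast
      then show ?thesis using vc by (simp add: S0_def int_pow_neg)
    qed
    moreover
    define J where "J = (\<lambda>(f, e, e'). f \<otimes> (e \<otimes> e')) ` (F \<times> F' \<times> F')"
    define ke where "ke e = (SOME k::int. nr {e} (v [^] k))" for e
    have "finite (ke ` J)" using F F'c by (simp add: J_def)
    moreover have "\<exists>h\<in>ke ` J. s + t - h \<in> S0" if st: "s \<in> S0" "t \<in> S0" for s t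
    proof -
      have "nr J (v [^] (s + t))"
        using nr_mult[of F' "v [^] s" F' "v [^] t"] st vc F'c by (simp add: S0_def J_def int_pow_mult)
      then obtain e where e: "e \<in> J" "nr {e} (v [^] (s + t))" unfolding nr_def by blast
      have "e \<in> carrier G" using e(1) F(2) F'c(1) by (auto simp: J_def subset_iff)
      have "nr {e} (v [^] (ke e))" unfolding ke_def by (rule someI[of _ "s + t"]) (rule e(2))
      then have "s + t - ke e \<in> S0" using nr_diff[OF e(2)] vc \<open>e \<in> carrier G\<close> nrF' by (simp add: S0_def pd)
      with e(1) show ?thesis by blast
    qed
    ultimately obtain E0 where E0: "finite E0" "\<And>k. \<exists>e\<in>E0. k - e \<in> S0"
      using int_approximate_subgroup_syndetic by metis
    let ?E = "(\<lambda>(f, e). f \<otimes> v [^] e) ` (F' \<times> E0)"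
    have "nr ?E (v [^] k)" for k :: int
    proof -
      obtain e where e: "e \<in> E0" "k - e \<in> S0" using E0 by blast
      then obtain y f where y: "y \<in> N" "f \<in> F'" "v [^] (k - e) \<otimes> y \<otimes> inv f \<in> B" unfolding S0_def nr_def by blast
      have "v [^] (k - e) \<otimes> y \<otimes> inv f = v [^] k \<otimes> y \<otimes> inv (f \<otimes> v [^] e)"
        using vc Nc[OF y(1)] F'c y(2) by (auto simp: pd inv_mult m_ac subset_iff)
      with y e show ?thesis unfolding nr_def by force
    qed
    moreover have "finite ?E" "?E \<subseteq> carrier G" using E0 F'c vc by auto
    ultimately show ?thesis by blast
  qed
  have "\<exists>E. finite E \<and> E \<subseteq> carrier G \<and> (\<forall>x\<in>generate G T'. nr E x)" if "finite T'" "T' \<subseteq> S" for T'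
    using that
  proof (induction T' rule: finite_induct)
    case empty
    then show ?case using B(2) N1
      by (intro exI[of _ "{\<one>}"]) (auto simp: generate_empty nr_def intro!: bexI[of _ \<one>])
  next
    case (insert v T')
    then obtain E where E: "finite E" "E \<subseteq> carrier G" "\<And>x. x \<in> generate G T' \<Longrightarrow> nr E x" by auto
    obtain E' where E': "finite E'" "E' \<subseteq> carrier G" "\<And>k::int. nr E' (v [^] k)" using step[of v] insert by auto
    let ?E = "(\<lambda>(f, e, e'). f \<otimes> (e \<otimes> e')) ` (F \<times> E \<times> E')"
    have "nr ?E x" if x: "x \<in> generate G (insert v T')" for x
    proof -
      have c: "v \<in> carrier G" "T' \<subseteq> carrier G" using insert.prems S by auto
      then obtain h and k :: int where hk: "h \<in> generate G T'" "x = h \<otimes> v [^] k"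
        using generate_insertE[OF x] by blast
      moreover have "h \<in> carrier G" using hk(1) c generate_in_carrier by blast
      ultimately show ?thesis using nr_mult[OF E(3) E'(3)] E E' c by auto
    qed
    moreover have "finite ?E" "?E \<subseteq> carrier G" using E(1,2) E'(1,2) F(1,2) by (auto simp: subset_iff)
    ultimately show ?case by blast
  qed
  from this[OF S(1) subset_refl] obtain E where E: "finite E" "E \<subseteq> carrier G" "\<forall>x\<in>generate G S. nr E x"
    by blast
  show thesis
  proof (rule that[of N E])
    show "N \<subseteq> generate G S" unfolding N_def by (rule mono_generate[OF TS])
    show "finite {x \<in> N. x \<otimes> g \<in> B}" if "g \<in> carrier G" for g
      using T(1) that unfolding ok_def N_def by blast
    show "\<exists>y\<in>N. \<exists>e\<in>E. x \<otimes> y \<otimes> inv e \<in> B" if "x \<in> generate G S" for x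
      using E(3) that unfolding nr_def by blast
  qed (use sN E in auto)
qed

section \<open>Definable subsets of a \<open>\<Or>\<close>-definable group\<close>

abbreviation "DP M \<equiv> dpred M full UNIV"

lemma definableI:
  assumes "DP M (\<lambda>E. tup n (E 0) \<in> D)" "\<And>x. x \<in> D \<Longrightarrow> length x = n" shows "definable M n D"
  unfolding definable_iff_dset dset_def using assms by blast

lemma definable_length: "definable M n D \<Longrightarrow> x \<in> D \<Longrightarrow> length x = n"
  unfolding definable_def by auto

lemma DP_mem: "definable M n D \<Longrightarrow> tterm UNIV n t \<Longrightarrow> DP M (\<lambda>E. t E \<in> D)"
  unfolding definable_iff_dset by (rule dpred_mem)

lemma definable_Un:
  fixes M :: "('a::{plus,ord,zero}, 'f, 'r) interp"
  shows "definable M n C \<Longrightarrow> definable M n D \<Longrightarrow> definable M n (C \<union> D)"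
  by (rule definableI) (auto simp: definable_length intro!: dpred_disj DP_mem tterm_tup)

lemma definable_empty:
  fixes M :: "('a::{plus,ord,zero}, 'f, 'r) interp"
  shows "definable M n {}"
  by (rule definableI) (auto simp: dpred_const)

lemma definable_singleton:
  fixes M :: "('a::{plus,ord,zero}, 'f, 'r) interp"
  shows "length u = n \<Longrightarrow> definable M n {u}"
  by (rule definableI) (auto intro!: dpred_eq_tuple tterm_tup tterm_const)

lemma definable_finite:
  fixes M :: "('a::{plus,ord,zero}, 'f, 'r) interp"
  shows "finite D \<Longrightarrow> (\<And>x. x \<in> D \<Longrightarrow> length x = n) \<Longrightarrow> definable M n D"
proof (induction D rule: finite_induct)
  case (insert x D)
  then have "definable M n ({x} \<union> D)" by (intro definable_Un definable_singleton) auto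
  then show ?case by simp
qed (rule definable_empty)

lemma DP_bex:
  assumes "definable M n D" "DP M (\<lambda>E. tup n (E k) \<in> D \<longrightarrow> Q E (tup n (E k)))" "\<And>E f x. Q (E(k := f)) x = Q E x"
  shows "DP M (\<lambda>E. \<exists>x\<in>D. Q E x)"
proof -
  have "DP M (\<lambda>E. \<exists>x. length x = n \<and> (x \<in> D \<and> (x \<in> D \<longrightarrow> Q E x)))"
    by (rule dpred_ex_tuple[where k = k], rule dpred_conj)
       (auto intro!: DP_mem[OF assms(1)] tterm_tup assms(2) simp: assms(3))
  then show ?thesis by (rule dpred_cong) (use definable_length[OF assms(1)] in blast)
qed

lemma definable_append2:
  assumes "DP M (\<lambda>E. R (tup n (E 0)) (tup m (E 1)))" "\<And>x y. R x y \<Longrightarrow> length x = n \<and> length y = m"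
    "D = {x @ y |x y. R x y}"
  shows "definable M (n + m) D"
proof -
  have "D = {x @ y |x y. length x = n \<and> length y = m \<and> R x y}" using assms(2,3) by blast
  then show ?thesis using dset_imp_definable[OF dsetI2[where R = R, OF assms(1)]] by simp
qed

lemma definable_append3:
  assumes "DP M (\<lambda>E. R (tup n (E 0)) (tup m (E 1)) (tup k (E 2)))"
    "\<And>x y z. R x y z \<Longrightarrow> length x = n \<and> length y = m \<and> length z = k"
    "D = {x @ y @ z |x y z. R x y z}"
  shows "definable M (n + m + k) D"
proof -
  have "D = {x @ y @ z |x y z. length x = n \<and> length y = m \<and> length z = k \<and> R x y z}" using assms(2,3) by blast
  then show ?thesis using dset_imp_definable[OF dsetI3[where R = R, OF assms(1)]] by simp
qed

lemma dpred_mult: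
  assumes "dset M L A (n + n + n) {x @ y @ (x \<otimes>\<^bsub>G\<^esub> y) |x y. x \<in> X \<and> y \<in> Y}"
    "\<And>x. x \<in> X \<union> Y \<Longrightarrow> length x = n" "tterm A n s" "tterm A n t" "tterm A n u"
  shows "dpred M L A (\<lambda>E. s E \<in> X \<and> t E \<in> Y \<and> s E \<otimes>\<^bsub>G\<^esub> t E = u E)"
proof -
  have "dpred M L A (\<lambda>E. s E @ t E @ u E \<in> {x @ y @ (x \<otimes>\<^bsub>G\<^esub> y) |x y. x \<in> X \<and> y \<in> Y})"
    using dpred_mem[OF assms(1), of "\<lambda>E. s E @ t E @ u E"]
      tterm_append[OF assms(3) tterm_append[OF assms(4,5)]] by (simp add: add.assoc)
  then show ?thesis
  proof (rule dpred_cong)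
    fix E
    have l: "length (s E) = n" "length (t E) = n" using assms tterm_length by blast+
    show "(s E @ t E @ u E \<in> {x @ y @ (x \<otimes>\<^bsub>G\<^esub> y) |x y. x \<in> X \<and> y \<in> Y}) =
       (s E \<in> X \<and> t E \<in> Y \<and> s E \<otimes>\<^bsub>G\<^esub> t E = u E)"
    proof
      assume "s E @ t E @ u E \<in> {x @ y @ (x \<otimes>\<^bsub>G\<^esub> y) |x y. x \<in> X \<and> y \<in> Y}"
      then obtain x y where xy: "x \<in> X" "y \<in> Y" "s E @ t E @ u E = x @ y @ (x \<otimes>\<^bsub>G\<^esub> y)" by blast
      moreover have "length x = n" "length y = n" using xy assms(2) by auto
      ultimately show "s E \<in> X \<and> t E \<in> Y \<and> s E \<otimes>\<^bsub>G\<^esub> t E = u E" using l by auto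
    next
      assume "s E \<in> X \<and> t E \<in> Y \<and> s E \<otimes>\<^bsub>G\<^esub> t E = u E"
      then show "s E @ t E @ u E \<in> {x @ y @ (x \<otimes>\<^bsub>G\<^esub> y) |x y. x \<in> X \<and> y \<in> Y}"
        by (intro CollectI exI[of _ "s E"] exI[of _ "t E"]) auto
    qed
  qed
qed

lemma (in comm_group) countable_generate:
  assumes "finite S" "S \<subseteq> carrier G" shows "countable (generate G S)"
  using assms
proof (induction S rule: finite_induct)
  case (insert v T)
  have "generate G (insert v T) \<subseteq> (\<lambda>(h, k::int). h \<otimes> v [^] k) ` (generate G T \<times> UNIV)"
    using generate_insertE[of _ v T] insert.prems by force
  then show ?case using insert by (auto intro: countable_subset)
qed (simp add: generate_empty)

locale vgroup = comm_group U for U :: "'a::linordered_group_add list monoid" (structure) +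
  fixes \<kappa> :: "'k rel" and M :: "('a, 'f, 'r) interp" and n :: nat
  assumes suff_sat: "sufficiently_saturated \<kappa> M" and vdef: "vdef_group \<kappa> M n U"
begin

definition dsub :: "'a list set \<Rightarrow> bool" where
  "dsub Y \<longleftrightarrow> definable M n Y \<and> Y \<subseteq> carrier U"

definition pieces :: "'a list set set" where
  "pieces = (SOME \<X>. directed_vunion \<kappa> M n \<X> (carrier U) \<and> (\<forall>X\<in>\<X>. \<forall>Y\<in>\<X>. definable_mult M n U X Y))"

lemma pieces: "directed_vunion \<kappa> M n pieces (carrier U)" "\<forall>X\<in>pieces. \<forall>Y\<in>pieces. definable_mult M n U X Y"
  using someI_ex[of "\<lambda>\<X>. directed_vunion \<kappa> M n \<X> (carrier U) \<and> (\<forall>X\<in>\<X>. \<forall>Y\<in>\<X>. definable_mult M n U X Y)"]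
    vdef unfolding vdef_group_def pieces_def by blast+

lemma pieces_dsub: "P \<in> pieces \<Longrightarrow> dsub P"
  using pieces(1) unfolding directed_vunion_def dsub_def by blast

lemma length_carrier: "x \<in> carrier U \<Longrightarrow> length x = n"
  using pieces(1) definable_length unfolding directed_vunion_def by blast

lemma dsub_length: "dsub Y \<Longrightarrow> x \<in> Y \<Longrightarrow> length x = n"
  unfolding dsub_def using length_carrier by blast

lemma finite_pieces_bound:
  assumes "finite \<F>" "\<F> \<subseteq> pieces" obtains P where "P \<in> pieces" "\<Union>\<F> \<subseteq> P"
proof -
  have "\<exists>P\<in>pieces. \<Union>\<F> \<subseteq> P" using assms
  proof (induction \<F> rule: finite_induct)
    case empty
    have "\<one> \<in> \<Union>pieces" using pieces(1) unfolding directed_vunion_def by auto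
    then show ?case by auto
  next
    case (insert Q \<F>)
    then obtain P where "P \<in> pieces" "\<Union>\<F> \<subseteq> P" by auto
    moreover obtain R where "R \<in> pieces" "P \<union> Q \<subseteq> R"
      using pieces(1) insert.prems \<open>P \<in> pieces\<close> unfolding directed_vunion_def by (meson insert_subset)
    ultimately show ?case by auto
  qed
  then show thesis using that by blast
qed

text \<open>Compactness yields finitely many pieces covering \<open>Y\<close>, and directedness
  merges them into one.\<close>

lemma dsub_in_piece:
  assumes "dsub Y" obtains P where "P \<in> pieces" "Y \<subseteq> P"
proof -
  obtain \<F> where F: "\<F> \<subseteq> pieces" "finite \<F>" "Y \<subseteq> \<Union>\<F>"
  proof (rule definable_finite_cover[OF suff_sat, of n Y pieces])
    show "Y \<subseteq> \<Union>pieces" using assms pieces(1) unfolding dsub_def directed_vunion_def by simp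
  qed (use assms pieces(1) in \<open>auto simp: dsub_def directed_vunion_def\<close>)
  obtain P where "P \<in> pieces" "\<Union>\<F> \<subseteq> P" by (rule finite_pieces_bound[OF F(2,1)])
  then show thesis using that[of P] F(3) by blast
qed

lemma definable_mult_dsub:
  assumes "dsub X" "dsub Y" shows "definable_mult M n U X Y"
proof -
  obtain P where P: "P \<in> pieces" "X \<subseteq> P" using assms(1) by (rule dsub_in_piece)
  obtain Q where Q: "Q \<in> pieces" "Y \<subseteq> Q" using assms(2) by (rule dsub_in_piece)
  have "dset M full UNIV (n + n + n) {x @ y @ (x \<otimes> y) |x y. x \<in> P \<and> y \<in> Q}"
    using pieces(2) P Q unfolding definable_mult_def definable_iff_dset by blast
  note PQ = dpred_mult[OF this]
  show ?thesis unfolding definable_mult_def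
  proof (rule definable_append3[where R = "\<lambda>x y z. (x \<in> X \<and> y \<in> Y) \<and> (x \<in> P \<and> y \<in> Q \<and> x \<otimes> y = z)"])
    show "DP M (\<lambda>E. (tup n (E 0) \<in> X \<and> tup n (E 1) \<in> Y) \<and> tup n (E 0) \<in> P \<and> tup n (E 1) \<in> Q \<and> tup n (E 0) \<otimes> tup n (E 1) = tup n (E 2))"
      using assms dsub_length pieces_dsub P Q unfolding dsub_def
      by (intro dpred_conj[OF dpred_conj] PQ) (auto intro!: DP_mem tterm_tup)
  next
    show "length x = n \<and> length y = n \<and> length z = n" if "(x \<in> X \<and> y \<in> Y) \<and> x \<in> P \<and> y \<in> Q \<and> x \<otimes> y = z" for x y z
      using that assms length_carrier unfolding dsub_def by (auto dest!: subsetD)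
  qed (use P Q in blast)
qed

text \<open>The memberships are part of the predicate because the product is known to be definable
  only on definable subsets of the group, not on the whole carrier.\<close>

lemma DP_mult:
  assumes "dsub X" "dsub Y" "tterm UNIV n s" "tterm UNIV n t" "tterm UNIV n u"
  shows "DP M (\<lambda>E. s E \<in> X \<and> t E \<in> Y \<and> s E \<otimes> t E = u E)"
  by (rule dpred_mult)
     (use assms definable_mult_dsub dsub_length in \<open>auto simp: definable_mult_def definable_iff_dset\<close>)

lemma dsub_Un: "dsub X \<Longrightarrow> dsub Y \<Longrightarrow> dsub (X \<union> Y)"
  unfolding dsub_def using definable_Un by blast

lemma dsub_finite: "finite Y \<Longrightarrow> Y \<subseteq> carrier U \<Longrightarrow> dsub Y"
  unfolding dsub_def using definable_finite length_carrier by blast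

lemma dsub_mult:
  assumes "dsub X" "dsub Y" shows "dsub (X <#> Y)"
proof -
  have "DP M (\<lambda>E. \<exists>x\<in>X. \<exists>y\<in>Y. x \<in> X \<and> y \<in> Y \<and> x \<otimes> y = tup n (E 0))"
    using assms
    by (intro DP_bex[where k = 1] DP_bex[where k = 2] dpred_imp DP_mem DP_mult tterm_tup)
       (auto simp: dsub_def intro!: tterm_tup)
  then have "DP M (\<lambda>E. tup n (E 0) \<in> X <#> Y)"
    by (rule dpred_cong) (auto simp: set_mult_def eq_commute[of "tup _ _"])
  moreover have c: "X <#> Y \<subseteq> carrier U" using assms set_mult_closed unfolding dsub_def by blast
  ultimately show ?thesis unfolding dsub_def using length_carrier by (auto intro!: definableI)
qed

lemma mult_eq_one_iff: "x \<in> carrier U \<Longrightarrow> y \<in> carrier U \<Longrightarrow> x \<otimes> y = \<one> \<longleftrightarrow> y = inv x"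
  by (metis inv_comm inv_equality r_inv)

text \<open>Definability of inversion is not among the axioms of a \<Or>-definable group. The
  relation \<open>x \<otimes> y = \<one>\<close> defines it once \<open>y\<close> is confined to one
  piece; the sets of those \<open>x\<close> in \<open>X\<close> whose inverse lies in a given piece
  cover \<open>X\<close>, so compactness and directedness provide that piece.\<close>

lemma dsub_inv:
  assumes "dsub X" shows "dsub (m_inv U ` X)"
proof -
  have one: "tterm UNIV n (\<lambda>E. \<one>)" by (rule tterm_const) (auto simp: length_carrier)
  have sub: "X \<subseteq> carrier U" using assms by (simp add: dsub_def)
  define D where "D P = {x \<in> X. inv x \<in> P}" for P
  have D: "definable M n (D P)" if "P \<in> pieces" for P
  proof -
    have "DP M (\<lambda>E. \<exists>y\<in>P. tup n (E 0) \<in> X \<and> y \<in> P \<and> tup n (E 0) \<otimes> y = \<one>)"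
      using assms pieces_dsub[OF that]
      by (intro DP_bex[where k = 1] dpred_imp DP_mem DP_mult tterm_tup one) (auto simp: dsub_def intro!: tterm_tup)
    then have "DP M (\<lambda>E. tup n (E 0) \<in> D P)"
    proof (rule dpred_cong)
      fix E
      show "(\<exists>y\<in>P. tup n (E 0) \<in> X \<and> y \<in> P \<and> tup n (E 0) \<otimes> y = \<one>) = (tup n (E 0) \<in> D P)"
        using sub pieces_dsub[OF that] unfolding D_def dsub_def
        by (auto simp: subset_iff mult_eq_one_iff)
    qed
    then show ?thesis using assms dsub_length by (auto simp: D_def intro: definableI)
  qed
  obtain \<F> where F: "\<F> \<subseteq> D ` pieces" "finite \<F>" "X \<subseteq> \<Union>\<F>"
  proof (rule definable_finite_cover[OF suff_sat, of n X "D ` pieces"])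
    have "small \<kappa> (\<Union>P\<in>pieces. {D P})"
      by (rule small_UN[OF suff_sat]) (use pieces(1) in \<open>auto simp: directed_vunion_def\<close>)
    then show "small \<kappa> (D ` pieces)" by (simp add: UNION_singleton_eq_range)
    have "carrier U = \<Union>pieces" using pieces(1) by (simp add: directed_vunion_def)
    moreover have "inv x \<in> carrier U" if "x \<in> X" for x using sub that by auto
    ultimately have "\<exists>P\<in>pieces. inv x \<in> P" if "x \<in> X" for x using that by simp
    then show "X \<subseteq> \<Union> (D ` pieces)" unfolding D_def by blast
  qed (use assms D in \<open>auto simp: dsub_def\<close>)
  obtain \<G> where G: "\<G> \<subseteq> pieces" "finite \<G>" "\<F> = D ` \<G>" using finite_subset_image[OF F(2,1)] by blast
  obtain P where P: "P \<in> pieces" "\<Union>\<G> \<subseteq> P" by (rule finite_pieces_bound[OF G(2,1)])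
  then have XP: "inv x \<in> P" if "x \<in> X" for x using F(3) that unfolding G(3) D_def by blast
  have "DP M (\<lambda>E. \<exists>x\<in>X. x \<in> X \<and> tup n (E 0) \<in> P \<and> x \<otimes> tup n (E 0) = \<one>)"
    using assms pieces_dsub[OF P(1)]
    by (intro DP_bex[where k = 1] dpred_imp DP_mem DP_mult tterm_tup one) (auto simp: dsub_def intro!: tterm_tup)
  then have "DP M (\<lambda>E. tup n (E 0) \<in> m_inv U ` X)"
  proof (rule dpred_cong)
    fix E
    show "(\<exists>x\<in>X. x \<in> X \<and> tup n (E 0) \<in> P \<and> x \<otimes> tup n (E 0) = \<one>) = (tup n (E 0) \<in> m_inv U ` X)"
      using sub XP pieces_dsub[OF P(1)] unfolding dsub_def
      by (auto simp: subset_iff image_iff mult_eq_one_iff)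
  qed
  moreover have "m_inv U ` X \<subseteq> carrier U" using sub by auto
  ultimately show ?thesis unfolding dsub_def using length_carrier by (auto intro!: definableI)
qed

lemma dsub_finite_translates:
  assumes "dsub Y" "dsub X" "countable \<Lambda>" "\<Lambda> \<subseteq> carrier U" "Y \<subseteq> X <#> \<Lambda>"
  obtains E where "finite E" "E \<subseteq> \<Lambda>" "Y \<subseteq> X <#> E"
proof -
  obtain \<F> where F: "\<F> \<subseteq> (\<lambda>e. X <#> {e}) ` \<Lambda>" "finite \<F>" "Y \<subseteq> \<Union>\<F>"
  proof (rule definable_finite_cover[OF suff_sat, of n Y "(\<lambda>e. X <#> {e}) ` \<Lambda>"])
    show "small \<kappa> ((\<lambda>e. X <#> {e}) ` \<Lambda>)" using assms(3) by (intro small_countable[OF suff_sat]) auto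
    show "definable M n D" if "D \<in> (\<lambda>e. X <#> {e}) ` \<Lambda>" for D
      using that dsub_mult[OF assms(2)] dsub_finite assms(4) unfolding dsub_def[of "_ <#> _"] by blast
    have "X <#> \<Lambda> = \<Union> ((\<lambda>e. X <#> {e}) ` \<Lambda>)" by (auto simp: set_mult_def)
    with assms(5) show "Y \<subseteq> \<Union> ((\<lambda>e. X <#> {e}) ` \<Lambda>)" by simp
  qed (use assms in \<open>auto simp: dsub_def\<close>)
  obtain E where "E \<subseteq> \<Lambda>" "finite E" "\<F> = (\<lambda>e. X <#> {e}) ` E" using finite_subset_image[OF F(2,1)] by blast
  moreover have "X <#> E = \<Union> ((\<lambda>e. X <#> {e}) ` E)" by (auto simp: set_mult_def)
  ultimately show thesis using that[of E] F(3) by simp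
qed

text \<open>\<open>X\<close> is enlarged to a symmetric set \<open>X1\<close> containing the
  identity, whose trace \<open>B\<close> on \<open>\<Lambda>\<close> is an approximate subgroup. Any
  definable \<open>Z\<close> is covered by finitely many translates of \<open>X1\<close> by elements
  of \<open>\<Lambda>\<close>, so finiteness of the traces of \<open>N\<close> on translates of
  \<open>B\<close> gives finiteness of \<open>N \<inter> Z\<close>.\<close>

lemma exists_lattice:
  assumes X: "dsub X" and S: "finite S" "S \<subseteq> carrier U" and XL: "carrier U \<subseteq> X <#> generate U S"
  obtains N Y where "subgroup N U" "N \<subseteq> generate U S" "\<And>Z. dsub Z \<Longrightarrow> finite (N \<inter> Z)"
    "dsub Y" "carrier U \<subseteq> Y <#> N"
proof -
  define \<Lambda> where "\<Lambda> = generate U S"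
  have sL: "subgroup \<Lambda> U" unfolding \<Lambda>_def using S(2) by (rule generate_is_subgroup)
  note Lc = subgroup.mem_carrier[OF sL] and L1 = subgroup.one_closed[OF sL]
    and Lm = subgroup.m_closed[OF sL] and Li = subgroup.m_inv_closed[OF sL]
  have cL: "countable \<Lambda>" unfolding \<Lambda>_def by (rule countable_generate[OF S])
  define X1 where "X1 = X \<union> m_inv U ` X \<union> {\<one>}"
  have X1: "dsub X1" unfolding X1_def
    by (rule dsub_Un[OF dsub_Un[OF X dsub_inv[OF X]] dsub_finite]) auto
  then have X1c: "X1 \<subseteq> carrier U" by (simp add: dsub_def)
  have X1L: "carrier U \<subseteq> X1 <#> \<Lambda>" using XL unfolding X1_def \<Lambda>_def set_mult_def by blast
  have X1i: "inv x \<in> X1" if "x \<in> X1" for x using that X unfolding X1_def dsub_def by auto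
  have cov: "\<exists>E. finite E \<and> E \<subseteq> \<Lambda> \<and> Z \<subseteq> X1 <#> E" if dZ: "dsub Z" for Z
  proof -
    have sub: "Z \<subseteq> X1 <#> \<Lambda>" using dZ X1L by (auto simp: dsub_def)
    have "\<Lambda> \<subseteq> carrier U" using Lc by blast
    then obtain E where "finite E" "E \<subseteq> \<Lambda>" "Z \<subseteq> X1 <#> E"
      using sub by (rule dsub_finite_translates[OF dZ X1 cL])
    then show ?thesis by blast
  qed
  obtain F where F: "finite F" "F \<subseteq> \<Lambda>" "X1 <#> X1 \<subseteq> X1 <#> F" using cov[OF dsub_mult[OF X1 X1]] by blast
  define B where "B = X1 \<inter> \<Lambda>"
  have ex: "\<exists>f\<in>F. a \<otimes> b \<otimes> inv f \<in> B" if "a \<in> B" "b \<in> B" for a b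
  proof -
    have "a \<otimes> b \<in> X1 <#> X1" using that unfolding B_def set_mult_def by blast
    then obtain x f where xf: "x \<in> X1" "f \<in> F" "a \<otimes> b = x \<otimes> f" using F(3) unfolding set_mult_def by blast
    then have "a \<otimes> b \<otimes> inv f = x" using X1c F(2) Lc by (auto simp: m_assoc subset_iff)
    moreover have "a \<otimes> b \<otimes> inv f \<in> \<Lambda>" using that xf(2) F(2) Lm Li unfolding B_def by blast
    ultimately show ?thesis using xf by (intro bexI[of _ f]) (auto simp: B_def)
  qed
  obtain N E where N: "subgroup N U" "N \<subseteq> generate U S" "\<And>g. g \<in> carrier U \<Longrightarrow> finite {x \<in> N. x \<otimes> g \<in> B}"
    and E: "finite E" "E \<subseteq> carrier U" "\<And>x. x \<in> generate U S \<Longrightarrow> \<exists>y\<in>N. \<exists>e\<in>E. x \<otimes> y \<otimes> inv e \<in> B"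
  proof (rule approximate_subgroup_complement[OF S, of B F])
    show "B \<subseteq> carrier U" "\<one> \<in> B" using X1c L1 by (auto simp: B_def X1_def)
    show "inv b \<in> B" if "b \<in> B" for b using that X1i Li by (simp add: B_def)
    show "F \<subseteq> carrier U" using F(2) Lc by blast
  qed (use F(1) ex in auto)
  \<comment> \<open>In additive terms: for \<open>u = x + l\<close>, some element of
    \<open>N\<close> moves \<open>l\<close> into \<open>B + E\<close>. As \<open>B\<close> lies in
    \<open>X1\<close>, two copies of \<open>X1\<close> and the error set reach every coset.\<close>
  define Y where "Y = X1 <#> X1 <#> E"
  have Y: "dsub Y" unfolding Y_def 
    by (rule dsub_mult[OF dsub_mult[OF X1 X1] dsub_finite[OF E(1,2)]])
  have fin: "finite (N \<inter> Z)" if dZ: "dsub Z" for Z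
  proof -
    obtain E' where E': "finite E'" "E' \<subseteq> \<Lambda>" "Z \<subseteq> X1 <#> E'" using cov[OF dZ] by blast
    have "N \<inter> Z \<subseteq> (\<Union>e\<in>E'. {x \<in> N. x \<otimes> inv e \<in> B})"
    proof
      fix x assume x: "x \<in> N \<inter> Z"
      then obtain a e where ae: "a \<in> X1" "e \<in> E'" "x = a \<otimes> e" using E'(3) unfolding set_mult_def by blast
      then have "x \<otimes> inv e = a" using X1c E'(2) Lc by (auto simp: m_assoc subset_iff)
      moreover have "x \<otimes> inv e \<in> \<Lambda>" using x ae(2) E'(2) N(2) Lm Li unfolding \<Lambda>_def by blast
      ultimately show "x \<in> (\<Union>e\<in>E'. {x \<in> N. x \<otimes> inv e \<in> B})" using x ae by (intro UN_I[of e]) (auto simp: B_def)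
    qed
    moreover have "finite (\<Union>e\<in>E'. {x \<in> N. x \<otimes> inv e \<in> B})"
      using E'(1,2) N(3) Lc by (intro finite_UN_I) auto
    ultimately show ?thesis by (rule finite_subset)
  qed
  have "u \<in> Y <#> N" if u: "u \<in> carrier U" for u
  proof -
    obtain x l where xl: "x \<in> X1" "l \<in> \<Lambda>" "u = x \<otimes> l" using u X1L unfolding set_mult_def by blast
    then obtain y e where ye: "y \<in> N" "e \<in> E" "l \<otimes> y \<otimes> inv e \<in> B" using E(3) unfolding \<Lambda>_def by blast
    let ?b = "l \<otimes> y \<otimes> inv e"
    have c: "x \<in> carrier U" "l \<in> carrier U" "y \<in> carrier U" "e \<in> carrier U"
      using xl ye X1c Lc E(2) subgroup.mem_carrier[OF N(1)] by auto
    have "u = (x \<otimes> ?b \<otimes> e) \<otimes> inv y"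
    proof -
      have "?b \<otimes> e \<otimes> inv y = l" using c by (simp add: m_assoc)
      then show ?thesis using c xl(3) by (simp add: m_assoc)
    qed
    moreover have "x \<otimes> ?b \<otimes> e \<in> Y" unfolding Y_def set_mult_def using xl ye B_def by blast
    moreover have "inv y \<in> N" using ye(1) N(1) by (rule subgroup.m_inv_closed[rotated])
    ultimately show ?thesis unfolding set_mult_def by blast
  qed
  then have "carrier U \<subseteq> Y <#> N" by blast
  then show thesis by (intro that[of N Y]) (use N(1,2) fin Y in auto)
qed

end

section \<open>The quotient by a lattice\<close>

lemma DP_lex_less:
  fixes M :: "('a::{plus,linorder,zero}, 'f, 'r) interp"
  assumes "tterm UNIV n s" "tterm UNIV n t"
  shows "DP M (\<lambda>E. s E < t E)"
proof -
  have "DP M (\<lambda>E. \<exists>i\<in>{..<n}. (\<forall>j\<in>{..<i}. s E ! j = t E ! j) \<and> s E ! i < t E ! i)"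
    by (intro dpred_ex_finite dpred_conj dpred_all_finite)
       (use assms in \<open>auto intro!: dpred_eq dpred_less tterm_nth\<close>)
  then show ?thesis
  proof (rule dpred_cong)
    fix E
    have l: "length (s E) = n" "length (t E) = n" using assms by (auto simp: tterm_length)
    have "take i (s E) = take i (t E) \<longleftrightarrow> (\<forall>j<i. s E ! j = t E ! j)" if "i < n" for i
      using that l by (auto simp: list_eq_iff_nth_eq)
    then show "(\<exists>i\<in>{..<n}. (\<forall>j\<in>{..<i}. s E ! j = t E ! j) \<and> s E ! i < t E ! i) = (s E < t E)"
      using l by (auto simp: list_less_def lexord_take_index_conv)
  qed
qed

locale vlattice = vgroup +
  fixes N Y :: "'a list set"
  assumes sgN: "subgroup N U" and finN: "\<And>Z. dsub Z \<Longrightarrow> finite (N \<inter> Z)"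
    and dY: "dsub Y" and covY: "carrier U \<subseteq> Y <#> N"
begin

lemmas N_carrier = subgroup.mem_carrier[OF sgN] and N_one = subgroup.one_closed[OF sgN]
  and N_mult = subgroup.m_closed[OF sgN] and N_inv = subgroup.m_inv_closed[OF sgN]

text \<open>Only these elements of \<open>N\<close> can carry a point of \<open>Y\<close> to a point
  of \<open>Y\<close>. They are finitely many, so minimality within a coset is a finite conjunction
  and hence definable.\<close>

definition transl :: "'a list set" where
  "transl = N \<inter> (Y <#> m_inv U ` Y)"

text \<open>The lexicographically least elements of the finite sets \<open>Y \<inter> (x + N)\<close>.\<close>

definition K :: "'a list set" where
  "K = {x \<in> Y. \<forall>e\<in>transl. x \<otimes> e \<in> Y \<longrightarrow> x \<le> x \<otimes> e}"

definition \<mu> :: "'a list \<Rightarrow> 'a list" where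
  "\<mu> u = (THE k. k \<in> K \<and> inv k \<otimes> u \<in> N)"

definition KG :: "'a list monoid" where
  "KG = \<lparr>carrier = K, mult = \<lambda>x y. \<mu> (x \<otimes> y), one = \<mu> \<one>\<rparr>"

lemma Y_carrier: "x \<in> Y \<Longrightarrow> x \<in> carrier U"
  using dY unfolding dsub_def by blast

lemma K_carrier: "x \<in> K \<Longrightarrow> x \<in> carrier U"
  unfolding K_def using Y_carrier by blast

lemma finite_transl: "finite transl"
  unfolding transl_def by (intro finN dsub_mult dsub_inv dY)

lemma dsub_K: "dsub K"
proof -
  \<comment> \<open>The conjunct \<open>e \<in> {e}\<close> presents translation by \<open>e\<close>
    as a product on the definable sets \<open>Y\<close> and \<open>{e}\<close>, the shape covered by
    \<open>DP_mult\<close>.\<close>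
  have "DP M (\<lambda>E. tup n (E 0) \<in> Y \<and> (\<forall>e\<in>transl. \<not> (\<exists>z\<in>Y. (tup n (E 0) \<in> Y \<and> e \<in> {e} \<and> tup n (E 0) \<otimes> e = z) \<and> z < tup n (E 0))))"
  proof (intro dpred_conj dpred_all_finite[OF finite_transl] dpred_not)
    show "DP M (\<lambda>E. tup n (E 0) \<in> Y)" using dY unfolding dsub_def by (auto intro: DP_mem tterm_tup)
    fix e assume "e \<in> transl"
    then have e: "e \<in> carrier U" using N_carrier by (auto simp: transl_def)
    then have te: "tterm UNIV n (\<lambda>E. e)" by (intro tterm_const) (auto simp: length_carrier)
    show "DP M (\<lambda>E. \<exists>z\<in>Y. (tup n (E 0) \<in> Y \<and> e \<in> {e} \<and> tup n (E 0) \<otimes> e = z) \<and> z < tup n (E 0))"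
    proof (rule DP_bex[where k = 1 and n = n], goal_cases)
      case 2
      have "dsub {e}" using e by (intro dsub_finite) auto
      then show ?case using dY te
        by (intro dpred_imp dpred_conj[OF DP_mult] DP_lex_less) (auto intro!: DP_mem tterm_tup simp: dsub_def)
    qed (use dY in \<open>auto simp: dsub_def\<close>)
  qed
  then have "DP M (\<lambda>E. tup n (E 0) \<in> K)"
  proof (rule dpred_cong)
    fix E
    show "(tup n (E 0) \<in> Y \<and> (\<forall>e\<in>transl. \<not> (\<exists>z\<in>Y. (tup n (E 0) \<in> Y \<and> e \<in> {e} \<and> tup n (E 0) \<otimes> e = z) \<and> z < tup n (E 0)))) = (tup n (E 0) \<in> K)"
      unfolding K_def by (auto simp: not_less)
  qed
  then show ?thesis unfolding dsub_def using K_carrier length_carrier by (auto intro!: definableI)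
qed

text \<open>The lattice element that carries one representative to the other belongs to
  \<open>transl\<close>, so each is at most the other in the lexicographic order.\<close>

lemma K_unique:
  assumes "k \<in> K" "k' \<in> K" "inv k \<otimes> k' \<in> N" shows "k = k'"
proof -
  have *: "a \<le> b" if "a \<in> K" "b \<in> K" "inv a \<otimes> b \<in> N" for a b
  proof -
    have c: "a \<in> carrier U" "b \<in> carrier U" using that K_carrier by auto
    have y: "a \<in> Y" "b \<in> Y" using that by (auto simp: K_def)
    have "b \<otimes> inv a \<in> Y <#> m_inv U ` Y" unfolding set_mult_def using y by blast
    then have "inv a \<otimes> b \<in> transl" using that(3) c unfolding transl_def by (simp add: m_comm)
    moreover have "a \<otimes> (inv a \<otimes> b) = b" using c by (simp flip: m_assoc)
    ultimately show "a \<le> b" using that(1) y unfolding K_def by (metis (no_types, lifting) mem_Collect_eq)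
  qed
  have c: "k \<in> carrier U" "k' \<in> carrier U" using assms K_carrier by auto
  have "inv (inv k \<otimes> k') \<in> N" by (rule N_inv[OF assms(3)])
  then have "inv k' \<otimes> k \<in> N" using c by (simp add: inv_mult_group)
  then show ?thesis using *[OF assms] *[OF assms(2,1)] by auto
qed

text \<open>The points of \<open>Y\<close> congruent to \<open>u\<close> correspond to elements of
  \<open>N\<close> in the definable set \<open>u - Y\<close>. They are finitely many, so a
  lexicographic minimum exists.\<close>

lemma K_exists:
  assumes u: "u \<in> carrier U" shows "\<exists>k\<in>K. inv k \<otimes> u \<in> N"
proof -
  define C where "C = {k \<in> Y. inv k \<otimes> u \<in> N}"
  have "C \<subseteq> (\<lambda>e. u \<otimes> inv e) ` (N \<inter> (m_inv U ` Y <#> {u}))"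
  proof
    fix k assume k: "k \<in> C"
    then have kc: "k \<in> carrier U" "k \<in> Y" using Y_carrier by (auto simp: C_def)
    have "u \<otimes> inv (inv k \<otimes> u) = k" using kc u by (simp add: inv_mult m_comm[of k] flip: m_assoc)
    moreover have "inv k \<otimes> u \<in> m_inv U ` Y <#> {u}" unfolding set_mult_def using kc by blast
    ultimately show "k \<in> (\<lambda>e. u \<otimes> inv e) ` (N \<inter> (m_inv U ` Y <#> {u}))"
      using k unfolding C_def by (intro image_eqI[of _ _ "inv k \<otimes> u"]) auto
  qed
  moreover have "finite (N \<inter> (m_inv U ` Y <#> {u}))"
    using u by (intro finN dsub_mult dsub_inv[OF dY] dsub_finite) auto
  ultimately have fin: "finite C" using finite_subset by blast
  obtain y e where ye: "y \<in> Y" "e \<in> N" "u = y \<otimes> e" using u covY unfolding set_mult_def by blast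
  have "inv y \<otimes> u = e" using ye Y_carrier[OF ye(1)] N_carrier[OF ye(2)] by (simp flip: m_assoc)
  then have ne: "C \<noteq> {}" using ye by (auto simp: C_def)
  let ?k = "Min C"
  have k: "?k \<in> C" using fin ne by (rule Min_in)
  then have kc: "?k \<in> carrier U" using Y_carrier by (auto simp: C_def)
  have "?k \<le> ?k \<otimes> e" if e: "e \<in> transl" "?k \<otimes> e \<in> Y" for e
  proof -
    have eN: "e \<in> N" and ec: "e \<in> carrier U" using e(1) N_carrier by (auto simp: transl_def)
    have "inv (?k \<otimes> e) \<otimes> u = inv e \<otimes> (inv ?k \<otimes> u)" using kc ec u by (simp add: inv_mult_group m_assoc)
    also have "\<dots> \<in> N" using k N_mult[OF N_inv[OF eN]] by (auto simp: C_def)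
    finally have "?k \<otimes> e \<in> C" using e(2) by (simp add: C_def)
    then show ?thesis using fin by (rule Min_le[rotated])
  qed
  then have "?k \<in> K" using k by (auto simp: K_def C_def)
  then show ?thesis using k by (auto simp: C_def)
qed

lemma \<mu>: assumes "u \<in> carrier U" shows "\<mu> u \<in> K" "inv (\<mu> u) \<otimes> u \<in> N"
    and \<mu>_eqI: "k \<in> K \<Longrightarrow> inv k \<otimes> u \<in> N \<Longrightarrow> \<mu> u = k"
proof -
  have "\<exists>!k. k \<in> K \<and> inv k \<otimes> u \<in> N"
  proof (rule ex_ex1I)
    show "\<exists>k. k \<in> K \<and> inv k \<otimes> u \<in> N" using K_exists[OF assms] by blast
    fix k k' assume kk: "k \<in> K \<and> inv k \<otimes> u \<in> N" "k' \<in> K \<and> inv k' \<otimes> u \<in> N"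
    then have c: "k \<in> carrier U" "k' \<in> carrier U" using K_carrier by auto
    have "inv k \<otimes> u \<otimes> inv (inv k' \<otimes> u) \<in> N" using kk N_mult N_inv by blast
    moreover have "inv k \<otimes> u \<otimes> inv (inv k' \<otimes> u) = inv k \<otimes> k'"
    proof -
      have "inv k \<otimes> u \<otimes> inv (inv k' \<otimes> u) = inv k \<otimes> (u \<otimes> inv u) \<otimes> k'"
        using c assms by (simp only: inv_mult_group inv_inv m_assoc m_closed inv_closed)
      then show ?thesis using c assms by simp
    qed
    ultimately show "k = k'" using K_unique kk by simp
  qed
  then have *: "\<mu> u \<in> K \<and> inv (\<mu> u) \<otimes> u \<in> N" and **: "k \<in> K \<and> inv k \<otimes> u \<in> N \<Longrightarrow> \<mu> u = k" for k
    unfolding \<mu>_def by (rule theI', rule the1_equality)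
  from * show "\<mu> u \<in> K" "inv (\<mu> u) \<otimes> u \<in> N" by auto
  show "k \<in> K \<Longrightarrow> inv k \<otimes> u \<in> N \<Longrightarrow> \<mu> u = k" using ** by blast
qed

lemma \<mu>_carrier: "u \<in> carrier U \<Longrightarrow> \<mu> u \<in> carrier U"
  using \<mu>(1) K_carrier by blast

lemma \<mu>_K: "k \<in> K \<Longrightarrow> \<mu> k = k"
  using K_carrier N_one by (intro \<mu>_eqI) auto

lemma \<mu>_decomp: assumes "u \<in> carrier U" obtains e where "e \<in> N" "u = \<mu> u \<otimes> e"
proof (rule that)
  show "inv (\<mu> u) \<otimes> u \<in> N" by (rule \<mu>(2)[OF assms])
  show "u = \<mu> u \<otimes> (inv (\<mu> u) \<otimes> u)" using assms \<mu>_carrier[OF assms] by (simp flip: m_assoc)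
qed

lemma \<mu>_mult_N:
  assumes "u \<in> carrier U" "e \<in> N" shows "\<mu> (u \<otimes> e) = \<mu> u"
proof (rule \<mu>_eqI)
  have c: "e \<in> carrier U" "\<mu> u \<in> carrier U" using assms N_carrier \<mu>_carrier by auto
  show "u \<otimes> e \<in> carrier U" using assms c by simp
  have "inv (\<mu> u) \<otimes> (u \<otimes> e) = (inv (\<mu> u) \<otimes> u) \<otimes> e" using assms c by (simp add: m_assoc)
  also have "\<dots> \<in> N" using \<mu>(2)[OF assms(1)] assms(2) by (rule N_mult)
  finally show "inv (\<mu> u) \<otimes> (u \<otimes> e) \<in> N" .
qed (rule \<mu>(1)[OF assms(1)])

lemma \<mu>_eq_iff:
  assumes "u \<in> carrier U" "v \<in> carrier U" shows "\<mu> u = \<mu> v \<longleftrightarrow> (\<exists>e\<in>N. v = u \<otimes> e)"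
proof
  assume eq: "\<mu> u = \<mu> v"
  obtain e where e: "e \<in> N" "u = \<mu> u \<otimes> e" by (rule \<mu>_decomp[OF assms(1)])
  obtain f where f: "f \<in> N" "v = \<mu> v \<otimes> f" by (rule \<mu>_decomp[OF assms(2)])
  have c: "e \<in> carrier U" "f \<in> carrier U" "\<mu> u \<in> carrier U" using e(1) f(1) N_carrier \<mu>_carrier assms by auto
  have "e \<otimes> (inv e \<otimes> f) = f" using c by (simp flip: m_assoc)
  then have "\<mu> u \<otimes> e \<otimes> (inv e \<otimes> f) = \<mu> v \<otimes> f" using c eq by (simp add: m_assoc)
  then have "v = u \<otimes> (inv e \<otimes> f)" using e(2) f(2) by metis
  moreover have "inv e \<otimes> f \<in> N" using e f N_mult N_inv by blast
  ultimately show "\<exists>e\<in>N. v = u \<otimes> e" by blast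
next
  assume "\<exists>e\<in>N. v = u \<otimes> e"
  then show "\<mu> u = \<mu> v" using \<mu>_mult_N assms by auto
qed

lemma \<mu>_mult: assumes "u \<in> carrier U" "v \<in> carrier U" shows "\<mu> (\<mu> u \<otimes> \<mu> v) = \<mu> (u \<otimes> v)"
proof -
  obtain e where e: "e \<in> N" "u = \<mu> u \<otimes> e" by (rule \<mu>_decomp[OF assms(1)])
  obtain f where f: "f \<in> N" "v = \<mu> v \<otimes> f" by (rule \<mu>_decomp[OF assms(2)])
  have c: "e \<in> carrier U" "f \<in> carrier U" "\<mu> u \<in> carrier U" "\<mu> v \<in> carrier U"
    using e(1) f(1) N_carrier \<mu>_carrier assms by auto
  have "\<mu> u \<otimes> e \<otimes> (\<mu> v \<otimes> f) = (\<mu> u \<otimes> \<mu> v) \<otimes> (e \<otimes> f)" using c by (simp add: m_ac)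
  then have "u \<otimes> v = (\<mu> u \<otimes> \<mu> v) \<otimes> (e \<otimes> f)" using e(2) f(2) by metis
  then show ?thesis using \<mu>_mult_N[of "\<mu> u \<otimes> \<mu> v" "e \<otimes> f"] c N_mult[OF e(1) f(1)] by simp
qed

lemma KG_simps: "carrier KG = K" "x \<otimes>\<^bsub>KG\<^esub> y = \<mu> (x \<otimes> y)" "\<one>\<^bsub>KG\<^esub> = \<mu> \<one>"
  by (auto simp: KG_def)

lemma \<mu>_hom: "\<mu> \<in> hom U KG"
  by (rule homI) (auto simp: KG_simps \<mu> \<mu>_mult)

lemma \<mu>_surj: "\<mu> ` carrier U = K"
proof
  show "K \<subseteq> \<mu> ` carrier U" using \<mu>_K K_carrier by (metis image_eqI subsetI)
qed (auto simp: \<mu>)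

lemma group_KG: "comm_group KG"
proof -
  have ass: "\<mu> (\<mu> (x \<otimes> y) \<otimes> z) = \<mu> (x \<otimes> \<mu> (y \<otimes> z))" if "x \<in> K" "y \<in> K" "z \<in> K" for x y z
  proof -
    have c: "x \<in> carrier U" "y \<in> carrier U" "z \<in> carrier U" using that K_carrier by auto
    have "\<mu> (\<mu> (x \<otimes> y) \<otimes> z) = \<mu> (x \<otimes> y \<otimes> z)" using \<mu>_mult[of "x \<otimes> y" z] c \<mu>_K[OF that(3)] by simp
    also have "\<dots> = \<mu> (x \<otimes> (y \<otimes> z))" using c by (simp add: m_assoc)
    also have "\<dots> = \<mu> (x \<otimes> \<mu> (y \<otimes> z))" using \<mu>_mult[of x "y \<otimes> z"] c \<mu>_K[OF that(1)] by simp
    finally show ?thesis .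
  qed
  show ?thesis
  proof (rule comm_groupI; unfold KG_simps)
    fix x assume x: "x \<in> K"
    then have c: "x \<in> carrier U" by (rule K_carrier)
    show "\<mu> (\<mu> \<one> \<otimes> x) = x" using \<mu>_mult[of \<one> x] c \<mu>_K[OF x] by simp
    have "\<mu> (\<mu> (inv x) \<otimes> x) = \<mu> \<one>" using \<mu>_mult[of "inv x" x] c \<mu>_K[OF x] by simp
    moreover have "\<mu> (inv x) \<in> K" using c by (simp add: \<mu>)
    ultimately show "\<exists>y\<in>K. \<mu> (y \<otimes> x) = \<mu> \<one>" by blast
    fix y assume y: "y \<in> K"
    then show "\<mu> (x \<otimes> y) = \<mu> (y \<otimes> x)" "\<mu> (x \<otimes> y) \<in> K" using c K_carrier[OF y] by (auto simp: \<mu> m_comm)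
    fix z assume z: "z \<in> K"
    show "\<mu> (\<mu> (x \<otimes> y) \<otimes> z) = \<mu> (x \<otimes> \<mu> (y \<otimes> z))" by (rule ass[OF x y z])
  qed (simp add: \<mu>)
qed

lemma kernel_\<mu>: "kernel U KG \<mu> = N"
proof -
  have "\<mu> x = \<mu> \<one> \<longleftrightarrow> x \<in> N" if "x \<in> carrier U" for x
    using \<mu>_eq_iff[of \<one> x] that N_carrier by (auto simp: eq_commute)
  then show ?thesis unfolding kernel_def KG_simps using N_carrier by auto
qed

text \<open>On a definable \<open>Z\<close> the differences between \<open>x\<close> and
  \<open>\<mu> x\<close> lie in the finite set \<open>EZ\<close>, so the graph is a finite union of
  pieces of graphs of translations. The set depends on \<open>Z\<close>, which is why
  \<open>\<mu>\<close> is only \<Or>-definable.\<close>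

lemma definable_graph_\<mu>:
  assumes Z: "dsub Z" shows "definable M (n + n) {x @ \<mu> x |x. x \<in> Z}"
proof -
  define EZ where "EZ = N \<inter> (Z <#> m_inv U ` K)"
  have fin: "finite EZ" unfolding EZ_def by (intro finN dsub_mult dsub_inv Z dsub_K)
  have *: "\<mu> x = k \<longleftrightarrow> (\<exists>e\<in>EZ. k \<in> K \<and> e \<in> {e} \<and> k \<otimes> e = x)" if x: "x \<in> Z" for x k
  proof -
    have xc: "x \<in> carrier U" using x Z by (auto simp: dsub_def)
    have "\<exists>e\<in>EZ. k \<in> K \<and> e \<in> {e} \<and> k \<otimes> e = x" if k: "\<mu> x = k"
    proof -
      have kK: "k \<in> K" "k \<in> carrier U" using k \<mu>(1)[OF xc] K_carrier by auto
      obtain e where e: "e \<in> N" "x = \<mu> x \<otimes> e" by (rule \<mu>_decomp[OF xc])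
      then have "x \<otimes> inv k = e \<otimes> (k \<otimes> inv k)" using N_carrier[OF e(1)] kK(2) k by (metis inv_closed m_assoc m_comm)
      then have "e = x \<otimes> inv k" using N_carrier[OF e(1)] kK by simp
      moreover have "x \<otimes> inv k \<in> Z <#> m_inv U ` K" unfolding set_mult_def using x kK by blast
      ultimately have "e \<in> EZ" using e by (simp add: EZ_def)
      then show ?thesis using e kK k by auto
    qed
    moreover have "\<mu> x = k" if ex: "\<exists>e\<in>EZ. k \<in> K \<and> e \<in> {e} \<and> k \<otimes> e = x"
    proof -
      obtain e where "e \<in> N" "k \<in> K" "x = k \<otimes> e" using ex by (auto simp: EZ_def)
      then show "\<mu> x = k" using \<mu>_mult_N[of k e] \<mu>_K K_carrier by simp
    qed
    ultimately show ?thesis by blast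
  qed
  show ?thesis
  proof (rule definable_append2[where R = "\<lambda>x k. x \<in> Z \<and> (\<exists>e\<in>EZ. k \<in> K \<and> e \<in> {e} \<and> k \<otimes> e = x)"])
    have "DP M (\<lambda>E. \<exists>e\<in>EZ. tup n (E 1) \<in> K \<and> e \<in> {e} \<and> tup n (E 1) \<otimes> e = tup n (E 0))"
    proof (rule dpred_ex_finite[OF fin])
      fix e assume "e \<in> EZ"
      then have e: "e \<in> carrier U" using N_carrier by (auto simp: EZ_def)
      then have "tterm UNIV n (\<lambda>E. e)" "dsub {e}" by (auto intro!: tterm_const dsub_finite simp: length_carrier)
      then show "DP M (\<lambda>E. tup n (E 1) \<in> K \<and> e \<in> {e} \<and> tup n (E 1) \<otimes> e = tup n (E 0))"
        by (intro DP_mult dsub_K tterm_tup)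
    qed
    moreover have "DP M (\<lambda>E. tup n (E 0) \<in> Z)" using Z by (auto simp: dsub_def intro: DP_mem tterm_tup)
    ultimately show "DP M (\<lambda>E. tup n (E 0) \<in> Z \<and> (\<exists>e\<in>EZ. tup n (E 1) \<in> K \<and> e \<in> {e} \<and> tup n (E 1) \<otimes> e = tup n (E 0)))"
      by (intro dpred_conj)
    show "length x = n \<and> length k = n" if "x \<in> Z \<and> (\<exists>e\<in>EZ. k \<in> K \<and> e \<in> {e} \<and> k \<otimes> e = x)" for x k
    proof -
      have "x \<in> Z" "k \<in> K" using that by auto
      then show ?thesis using dsub_length[OF Z] dsub_length[OF dsub_K] by simp
    qed
    have eq: "(x \<in> Z \<and> (\<exists>e\<in>EZ. k \<in> K \<and> e \<in> {e} \<and> k \<otimes> e = x)) \<longleftrightarrow> x \<in> Z \<and> \<mu> x = k" for x k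
      using * by blast
    show "{x @ \<mu> x |x. x \<in> Z} = {x @ k |x k. x \<in> Z \<and> (\<exists>e\<in>EZ. k \<in> K \<and> e \<in> {e} \<and> k \<otimes> e = x)}"
      unfolding eq by blast
  qed
qed

lemma DP_\<mu>:
  assumes Z: "dsub Z" "tterm UNIV n s" "tterm UNIV n t"
  shows "DP M (\<lambda>E. s E \<in> Z \<and> \<mu> (s E) = t E)"
proof -
  have "DP M (\<lambda>E. s E @ t E \<in> {x @ \<mu> x |x. x \<in> Z})"
    using definable_graph_\<mu>[OF Z(1)] tterm_append[OF Z(2,3)] by (rule DP_mem)
  then show ?thesis
  proof (rule dpred_cong)
    fix E
    have l: "length (s E) = n" using Z(2) by (rule tterm_length)
    show "(s E @ t E \<in> {x @ \<mu> x |x. x \<in> Z}) = (s E \<in> Z \<and> \<mu> (s E) = t E)"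
    proof
      assume "s E @ t E \<in> {x @ \<mu> x |x. x \<in> Z}"
      then obtain x where x: "x \<in> Z" "s E @ t E = x @ \<mu> x" by blast
      moreover have "length x = n" using dsub_length[OF Z(1) x(1)] .
      ultimately show "s E \<in> Z \<and> \<mu> (s E) = t E" using l by simp
    next
      assume "s E \<in> Z \<and> \<mu> (s E) = t E"
      then show "s E @ t E \<in> {x @ \<mu> x |x. x \<in> Z}" by (intro CollectI exI[of _ "s E"]) auto
    qed
  qed
qed

lemma definable_group_KG: "definable_group M n KG"
proof -
  have "definable_mult M n KG K K"
    unfolding definable_mult_def
  proof (rule definable_append3[where R = "\<lambda>x y k. \<exists>s\<in>K <#> K. (x \<in> K \<and> y \<in> K \<and> x \<otimes> y = s) \<and> (s \<in> K <#> K \<and> \<mu> s = k)"])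
    have KK: "dsub (K <#> K)" by (intro dsub_mult dsub_K)
    show "DP M (\<lambda>E. \<exists>s\<in>K <#> K. (tup n (E 0) \<in> K \<and> tup n (E 1) \<in> K \<and> tup n (E 0) \<otimes> tup n (E 1) = s) \<and> (s \<in> K <#> K \<and> \<mu> s = tup n (E 2)))"
      using KK KK[unfolded dsub_def] by (intro DP_bex[where k = 3 and n = n] dpred_imp dpred_conj[OF DP_mult DP_\<mu>])
         (auto intro!: DP_mem tterm_tup dsub_K)
    show "length x = n \<and> length y = n \<and> length k = n"
      if "\<exists>s\<in>K <#> K. (x \<in> K \<and> y \<in> K \<and> x \<otimes> y = s) \<and> (s \<in> K <#> K \<and> \<mu> s = k)" for x y k
      using that dsub_length[OF dsub_K] \<mu>(1) K_carrier by auto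
    have "x \<otimes> y \<in> K <#> K" if "x \<in> K" "y \<in> K" for x y using that unfolding set_mult_def by blast
    then have eq: "(\<exists>s\<in>K <#> K. (x \<in> K \<and> y \<in> K \<and> x \<otimes> y = s) \<and> (s \<in> K <#> K \<and> \<mu> s = k)) \<longleftrightarrow>
        (x \<in> K \<and> y \<in> K) \<and> k = \<mu> (x \<otimes> y)" for x y k by blast
    show "{x @ y @ x \<otimes>\<^bsub>KG\<^esub> y |x y. x \<in> K \<and> y \<in> K} =
       {x @ y @ k |x y k. \<exists>s\<in>K <#> K. (x \<in> K \<and> y \<in> K \<and> x \<otimes> y = s) \<and> (s \<in> K <#> K \<and> \<mu> s = k)}"
      unfolding KG_simps eq by blast
  qed
  then show ?thesis
    using dsub_K group_KG comm_group.axioms(2) unfolding definable_group_def KG_simps dsub_def by blast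
qed

lemma definable_quotient_KG: "definable_quotient M n U N n KG"
proof -
  have "vdef_map M n n (carrier U) \<mu>"
    unfolding vdef_map_def definable_fun_def
  proof (intro allI impI conjI ballI)
    fix Z assume Z: "definable M n Z \<and> Z \<subseteq> carrier U"
    then show "definable M (n + n) {x @ \<mu> x |x. x \<in> Z}" by (intro definable_graph_\<mu>) (simp add: dsub_def)
    fix x assume "x \<in> Z"
    then show "length (\<mu> x) = n" using Z \<mu>_carrier length_carrier by auto
  qed
  then show ?thesis unfolding definable_quotient_def
    using definable_group_KG \<mu>_hom \<mu>_surj kernel_\<mu> by (auto simp: KG_simps)
qed

end

section \<open>O-minimality in one variable\<close>

lemma dpred_app1:
  assumes "dpred M L A (\<lambda>E. P (E 0 0))" "sterm A s" shows "dpred M L A (\<lambda>E. P (s E))"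
proof -
  obtain a where a: "a \<in> slots A" "s = (\<lambda>E. slot_val E a)" using assms(2) unfolding sterm_def by blast
  show ?thesis using dpred_reindex[OF assms(1), of "\<lambda>i j. a"] a by simp
qed

lemma dpred_app2:
  assumes "dpred M L A (\<lambda>E. P (E 0 0) (E 1 0))" "sterm A s" "sterm A t" shows "dpred M L A (\<lambda>E. P (s E) (t E))"
proof -
  obtain a where a: "a \<in> slots A" "s = (\<lambda>E. slot_val E a)" using assms(2) unfolding sterm_def by blast
  obtain b where b: "b \<in> slots A" "t = (\<lambda>E. slot_val E b)" using assms(3) unfolding sterm_def by blast
  show ?thesis using dpred_reindex[OF assms(1), of "\<lambda>i j. if i = 0 then a else b"] a b by simp
qed

lemma add_left_strict_mono_group:
  fixes x :: "'a::linordered_group_add" assumes "x < y" shows "z + x < z + y"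
  using add_left_mono_group[of x y z] assms by (auto simp: less_le)

lemma add_right_strict_mono_group:
  fixes x :: "'a::linordered_group_add" assumes "x < y" shows "x + z < y + z"
  using add_right_mono_group[of x y z] assms by (auto simp: less_le)

text \<open>A nonzero element makes the order unbounded on both sides, and o-minimality then makes
  it dense. The trivial structure is treated separately at the end.\<close>

locale omin =
  fixes \<kappa> :: "'k rel" and M :: "('a::linordered_group_add, 'f, 'r) interp"
  assumes suff_sat: "sufficiently_saturated \<kappa> M" and omin: "o_minimal M" and nontrivial: "\<exists>a::'a. a \<noteq> 0"
begin

abbreviation udef :: "'f set \<times> 'r set \<Rightarrow> 'a set \<Rightarrow> 'a set \<Rightarrow> bool" where
  "udef L A S \<equiv> dpred M L A (\<lambda>E. E 0 0 \<in> S)"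

lemma udef_dset: "udef L A S \<Longrightarrow> dset M L A (Suc 0) ((\<lambda>x. [x]) ` S)"
  unfolding dset_def tup_Suc_0 by (auto intro: dpred_cong)

lemma udef_mono: "udef L A S \<Longrightarrow> A \<subseteq> B \<Longrightarrow> udef L B S"
  by (rule dpred_mono) auto

lemma omin_pieces:
  assumes "udef L A S"
  obtains \<F> where "finite \<F>" "\<F> \<subseteq> {{a} |a. True} \<union> open_intervals" "S = \<Union>\<F>"
proof -
  have "definable M 1 ((\<lambda>x. [x]) ` S)" using dset_imp_definable[OF udef_dset[OF assms]] by simp
  from omin[unfolded o_minimal_def, rule_format, OF this]
  obtain \<F> where "finite \<F>" "\<F> \<subseteq> {{a} |a. True} \<union> open_intervals" "{x. [x] \<in> (\<lambda>x. [x]) ` S} = \<Union>\<F>"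
    by (elim exE conjE)
  moreover have "{x. [x] \<in> (\<lambda>x. [x]) ` S} = S" by auto
  ultimately show thesis using that by simp
qed

lemma omin_induct [consumes 1, case_names empty Un point interval]:
  assumes "udef L A S" "P {}" "\<And>S T. P S \<Longrightarrow> P T \<Longrightarrow> P (S \<union> T)" "\<And>a. P {a}" "\<And>I. I \<in> open_intervals \<Longrightarrow> P I"
  shows "P S"
proof -
  obtain \<F> where F: "finite \<F>" "\<F> \<subseteq> {{a} |a. True} \<union> open_intervals" "S = \<Union>\<F>" by (rule omin_pieces[OF assms(1)])
  from F(1,2) have "P (\<Union>\<F>)"
  proof (induction \<F> rule: finite_induct)
    case (insert I \<F>)
    then have "P I" using assms(4,5) by auto
    then show ?case using insert assms(3) by simp
  qed (use assms(2) in simp)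
  then show ?thesis using F(3) by simp
qed

lemma ex_pos: obtains c :: 'a where "c > 0"
proof -
  obtain a :: 'a where "a \<noteq> 0" using nontrivial by blast
  then have "a > 0 \<or> a < 0" by (simp add: neq_iff disj_commute)
  then have "a > 0 \<or> - a > 0" using add_left_strict_mono_group[of a 0 "- a"] by auto
  then show thesis using that by blast
qed

lemma ex_gt: "\<exists>y::'a. y > x"
proof -
  obtain c :: 'a where "c > 0" by (rule ex_pos)
  then have "x + 0 < x + c" by (rule add_left_strict_mono_group)
  then show ?thesis by auto
qed

lemma ex_lt: "\<exists>y::'a. y < x"
proof -
  obtain c :: 'a where "c > 0" by (rule ex_pos)
  then have "(x - c) + 0 < (x - c) + c" by (rule add_left_strict_mono_group)
  then show ?thesis by auto
qed

lemma ray_or_bounded: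
  assumes "udef L A S" shows "(\<exists>a. {a<..} \<subseteq> S) \<or> (\<exists>b. \<forall>x\<in>S. x \<le> b)"
  using assms
proof (induction rule: omin_induct)
  case (Un S T)
  show ?case
  proof (cases "(\<exists>a. {a<..} \<subseteq> S) \<or> (\<exists>a. {a<..} \<subseteq> T)")
    case False
    then obtain b c where "\<forall>x\<in>S. x \<le> b" "\<forall>x\<in>T. x \<le> c" using Un by blast
    then have "\<forall>x\<in>S \<union> T. x \<le> max b c" by (auto simp: le_max_iff_disj)
    then show ?thesis by blast
  qed blast
next
  case (interval I)
  then consider a b where "I = {a<..<b}" | a where "I = {a<..}" | b where "I = {..<b}" | "I = UNIV"
    unfolding open_intervals_def by auto
  then show ?case
  proof cases
    case 1 then show ?thesis by (intro disjI2 exI[of _ b]) auto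
  next
    case 3 then show ?thesis by (intro disjI2 exI[of _ b]) auto
  qed auto
qed auto

text \<open>A gap would produce a least positive element \<open>c\<close>. The doubles are unbounded
  above, so by o-minimality they contain a ray, in particular some \<open>u = s + s\<close> together
  with \<open>u + c = t + t\<close>. Then \<open>t\<close> is at least \<open>s + c\<close>, and
  \<open>t + t\<close> exceeds \<open>u + c\<close>.\<close>

lemma dense_order: assumes xy: "x < y" shows "\<exists>z::'a. x < z \<and> z < y"
proof (rule ccontr)
  assume no: "\<not> (\<exists>z. x < z \<and> z < y)"
  define c where "c = - x + y"
  have c: "c > 0" using add_left_strict_mono_group[OF xy, of "- x"] by (simp add: c_def)
  have min: "c \<le> d" if "d > 0" for d
  proof (rule ccontr)
    assume "\<not> c \<le> d"
    then have "x + d < x + c" by (intro add_left_strict_mono_group) auto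
    moreover have "x + 0 < x + d" using that by (rule add_left_strict_mono_group)
    ultimately show False using no by (auto simp: c_def add.assoc[symmetric])
  qed
  define D where "D = {z::'a. \<exists>y. y + y = z}"
  have "udef full UNIV D" unfolding D_def mem_Collect_eq
    by (rule dpred_ex[where k = 1 and j = 0], intro dpred_add sterm_var) simp
  moreover have "\<not> (\<exists>b. \<forall>x\<in>D. x \<le> b)"
  proof
    assume "\<exists>b. \<forall>x\<in>D. x \<le> b"
    then obtain b where b: "\<forall>x\<in>D. x \<le> b" by blast
    obtain z where z: "z > max b 0" using ex_gt by blast
    then have "z + 0 < z + z" by (intro add_left_strict_mono_group) auto
    moreover have "z + z \<in> D" by (auto simp: D_def)
    ultimately show False using b z by fastforce
  qed
  ultimately obtain a where a: "{a<..} \<subseteq> D" using ray_or_bounded by blast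
  obtain u where u: "u > a" using ex_gt by blast
  then obtain s where s: "s + s = u" using a by (auto simp: D_def)
  have uc: "u < u + c" using add_left_strict_mono_group[OF c, of u] by simp
  then have "u + c \<in> D" using a u by auto
  then obtain t where t: "t + t = u + c" by (auto simp: D_def)
  have "s < t"
  proof (rule ccontr)
    assume "\<not> s < t"
    then have "t \<le> s" by simp
    then have "t + t \<le> t + s" "t + s \<le> s + s" by (auto intro: add_left_mono_group add_right_mono_group)
    then show False using s t uc by auto
  qed
  then have "- s + t > 0" using add_left_strict_mono_group[of s t "- s"] by simp
  then have "c \<le> - s + t" by (rule min)
  then have st: "s + c \<le> t" using add_left_mono_group[of c "- s + t" s] by (simp add: add.assoc[symmetric])
  have "u + c = s + (s + c)" using s add.assoc[of s s c] by simp
  also have "\<dots> < s + (c + (s + c))"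
    by (rule add_left_strict_mono_group) (use add_right_strict_mono_group[OF c, of "s + c"] in simp)
  also have "\<dots> = (s + c) + (s + c)" by (simp add: add.assoc)
  also have "\<dots> \<le> t + (s + c)" using st by (rule add_right_mono_group)
  also have "\<dots> \<le> t + t" using st by (rule add_left_mono_group)
  finally show False using t by simp
qed

lemma ex_in_open_interval:
  fixes I :: "'a set"
  assumes "I \<in> open_intervals" "x \<in> I" shows "\<exists>a b. a < x \<and> x < b \<and> {a<..<b} \<subseteq> I"
proof -
  obtain p where "p < x" using ex_lt by blast
  obtain q where "x < q" using ex_gt by blast
  consider a b where "I = {a<..<b}" | a where "I = {a<..}" | b where "I = {..<b}" | "I = UNIV"
    using assms(1) unfolding open_intervals_def by auto
  then show ?thesis
  proof cases
    case (1 a b) then show ?thesis using assms(2) by (intro exI[of _ a] exI[of _ b]) auto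
  next
    case (2 a) then show ?thesis using assms(2) \<open>x < q\<close> by (intro exI[of _ a] exI[of _ q]) auto
  next
    case (3 b) then show ?thesis using assms(2) \<open>p < x\<close> by (intro exI[of _ p] exI[of _ b]) auto
  next
    case 4 then show ?thesis using \<open>p < x\<close> \<open>x < q\<close> by auto
  qed
qed

text \<open>Neighbourhoods are expressed by quantifying over endpoints of intervals, which keeps the
  notion first-order.\<close>

definition loc :: "('a \<Rightarrow> bool) \<Rightarrow> 'a \<Rightarrow> bool" where
  "loc P x \<longleftrightarrow> (\<exists>a b. a < x \<and> x < b \<and> (\<forall>y. a < y \<and> y < b \<longrightarrow> P y))"

lemma loc_mono: "loc P x \<Longrightarrow> (\<And>y. P y \<Longrightarrow> Q y) \<Longrightarrow> loc Q x"
  unfolding loc_def by blast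

lemma loc_here: "loc P x \<Longrightarrow> P x"
  unfolding loc_def by blast

lemma loc_conj: assumes "loc P x" "loc Q x" shows "loc (\<lambda>y. P y \<and> Q y) x"
proof -
  obtain a b c d where "a < x" "x < b" "\<forall>y. a < y \<and> y < b \<longrightarrow> P y" "c < x" "x < d" "\<forall>y. c < y \<and> y < d \<longrightarrow> Q y"
    using assms unfolding loc_def by blast
  then show ?thesis unfolding loc_def by (intro exI[of _ "max a c"] exI[of _ "min b d"]) auto
qed

lemma dpred_loc:
  assumes "dpred M L A (\<lambda>E. R (E 0 0) (E 1 0))"
  shows "dpred M L A (\<lambda>E. loc (R (E 0 0)) (E 1 0))"
  unfolding loc_def
  by (rule dpred_ex[where k = 2 and j = 0], rule dpred_ex[where k = 3 and j = 0],
      intro dpred_conj dpred_less sterm_var, rule dpred_all[where k = 4 and j = 0],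
      intro dpred_imp dpred_conj dpred_less sterm_var dpred_app2[OF assms]) auto

lemma dpred_loc1:
  assumes "udef L A S" shows "udef L A {x. loc (\<lambda>y. y \<in> S) x}"
proof -
  have "dpred M L A (\<lambda>E. E 1 0 \<in> S)" by (rule dpred_app1[OF assms sterm_var])
  from dpred_loc[where R = "\<lambda>x y. y \<in> S", OF this]
  have "dpred M L A (\<lambda>E. loc (\<lambda>y. y \<in> S) (E 1 0))" .
  from dpred_app2[where P = "\<lambda>x y. loc (\<lambda>y. y \<in> S) y", OF this sterm_var sterm_var]
  show ?thesis by simp
qed

lemma finite_boundary: assumes "udef L A S" shows "finite {x \<in> S. \<not> loc (\<lambda>y. y \<in> S) x}"
  using assms
proof (induction rule: omin_induct)
  case (Un S T)
  have "{x \<in> S \<union> T. \<not> loc (\<lambda>y. y \<in> S \<union> T) x} \<subseteq> {x \<in> S. \<not> loc (\<lambda>y. y \<in> S) x} \<union> {x \<in> T. \<not> loc (\<lambda>y. y \<in> T) x}"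
    using loc_mono[of "\<lambda>y. y \<in> S" _ "\<lambda>y. y \<in> S \<union> T"] loc_mono[of "\<lambda>y. y \<in> T" _ "\<lambda>y. y \<in> S \<union> T"] by blast
  then show ?case using Un finite_subset by blast
next
  case (interval I)
  have "loc (\<lambda>y. y \<in> I) x" if x: "x \<in> I" for x
  proof -
    obtain a b where "a < x" "x < b" "{a<..<b} \<subseteq> I" using ex_in_open_interval[OF interval x] by blast
    then show ?thesis unfolding loc_def by (intro exI[of _ a] exI[of _ b]) auto
  qed
  then show ?case by (metis (no_types, lifting) Collect_empty_eq finite.emptyI)
next
  case (point a)
  show ?case by (rule finite_subset[of _ "{a}"]) auto
qed auto

lemma infinite_interval: "a < (b::'a) \<Longrightarrow> infinite {a<..<b}"
proof
  assume ab: "a < b" "finite {a<..<b}"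
  obtain z where "a < z" "z < b" using dense_order[OF ab(1)] by blast
  then have ne: "{a<..<b} \<noteq> {}" by auto
  let ?m = "Min {a<..<b}"
  have "?m \<in> {a<..<b}" using ab(2) ne by (rule Min_in)
  then obtain w where "a < w" "w < ?m" using dense_order[of a ?m] by auto
  moreover have "w \<in> {a<..<b}" using calculation \<open>?m \<in> {a<..<b}\<close> by auto
  ultimately show False using Min_le[OF ab(2), of w] by auto
qed

definition is_sup :: "'a set \<Rightarrow> 'a \<Rightarrow> bool" where
  "is_sup S s \<longleftrightarrow> (\<forall>x\<in>S. x \<le> s) \<and> (\<forall>t<s. \<exists>x\<in>S. t < x)"

text \<open>Definable completeness. The order itself need not be complete, but a finite union of
  points and intervals that is bounded and nonempty has a supremum.\<close>

lemma ex_sup: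
  assumes "udef L A S" "S \<noteq> {}" "\<forall>x\<in>S. x \<le> b" shows "\<exists>s. is_sup S s"
proof -
  have "S \<noteq> {} \<Longrightarrow> \<forall>b. (\<forall>x\<in>S. x \<le> b) \<longrightarrow> (\<exists>s. is_sup S s)" using assms(1)
  proof (induction rule: omin_induct)
    case (Un S T)
    show ?case
    proof (intro allI impI)
      fix b assume b: "\<forall>x\<in>S \<union> T. x \<le> b"
      show "\<exists>s. is_sup (S \<union> T) s"
      proof (cases "S = {} \<or> T = {}")
        case False
        then obtain s t where "is_sup S s" "is_sup T t" using Un b by blast
        then have "is_sup (S \<union> T) (max s t)" unfolding is_sup_def by (auto simp: le_max_iff_disj less_max_iff_disj)
        then show ?thesis by blast
      next
        case True
        then show ?thesis
        proof
          assume "S = {}"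
          then show ?thesis using Un(2,3) b by auto
        next
          assume "T = {}"
          then show ?thesis using Un(1,3) b by auto
        qed
      qed
    qed
  next
    case (point a)
    have "is_sup {a} a" by (auto simp: is_sup_def)
    then show ?case by blast
  next
    case (interval I)
    then consider a b where "I = {a<..<b}" | a where "I = {a<..}" | b where "I = {..<b}" | "I = UNIV"
      unfolding open_intervals_def by auto
    then show ?case
    proof cases
      case (1 a b)
      then have "a < b" using interval(2) by auto
      then have "is_sup I b" unfolding is_sup_def 1 using dense_order[of "max a _" b]
        by (auto simp: max_less_iff_conj) (metis greaterThanLessThan_iff max_less_iff_conj)
      then show ?thesis by blast
    next
      case (2 a)
      have "\<not> (\<forall>x\<in>I. x \<le> b)" for b using ex_gt[of "max a b"] unfolding 2 by (auto simp: not_le)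
      then show ?thesis by blast
    next
      case (3 b)
      then have "is_sup I b" unfolding is_sup_def using dense_order by auto
      then show ?thesis by blast
    next
      case 4
      then have "\<not> (\<forall>x\<in>I. x \<le> b)" for b using ex_gt[of b] by (auto simp: not_le)
      then show ?thesis by blast
    qed
  qed auto
  then show ?thesis using assms by blast
qed

text \<open>Definable connectedness of a convex set. The points up to which everything from
  \<open>p\<close> on stays in \<open>T\<close> form a definable set; at its supremum, either local
  decision is contradictory. When \<open>y\<close> lies below \<open>x\<close> the argument runs for
  the complement.\<close>

lemma locally_decided_constant:
  assumes "udef L A S" and I: "\<And>x y z. x \<in> I \<Longrightarrow> z \<in> I \<Longrightarrow> x \<le> y \<Longrightarrow> y \<le> z \<Longrightarrow> y \<in> I"
    and dec: "\<And>x. x \<in> I \<Longrightarrow> loc (\<lambda>y. y \<in> S) x \<or> loc (\<lambda>y. y \<notin> S) x"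
    and xy: "x \<in> I" "y \<in> I" "x \<in> S"
  shows "y \<in> S"
proof -
  have main: "q \<in> T" if T: "udef L A T" "\<And>x. x \<in> I \<Longrightarrow> loc (\<lambda>y. y \<in> T) x \<or> loc (\<lambda>y. y \<notin> T) x"
    and pq: "p \<in> I" "q \<in> I" "p < q" "p \<in> T" for p q T
  proof (rule ccontr)
    assume nq: "q \<notin> T"
    let ?W = "{w. p \<le> w \<and> w \<le> q \<and> (\<forall>z. p \<le> z \<and> z \<le> w \<longrightarrow> z \<in> T)}"
    have "dpred M L (A \<union> {p, q}) (\<lambda>E. \<not> E 0 0 < p \<and> \<not> q < E 0 0 \<and> (\<forall>z. \<not> z < p \<and> \<not> E 0 0 < z \<longrightarrow> z \<in> T))"
      by (intro dpred_conj dpred_not dpred_less sterm_var sterm_const, simp, simp,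
          rule dpred_all[where k = 1 and j = 0],
          intro dpred_imp dpred_conj dpred_not dpred_less sterm_var sterm_const dpred_app1[OF udef_mono[OF T(1)]]) auto
    then have W: "udef L (A \<union> {p, q}) ?W" by (rule dpred_cong) (auto simp: not_less)
    have "p \<in> ?W" using pq by auto
    have "\<exists>s. is_sup ?W s" by (rule ex_sup[OF W, of q]) (use \<open>p \<in> ?W\<close> in auto)
    then obtain s where s: "is_sup ?W s" by blast
    have ps: "p \<le> s" "s \<le> q"
    proof -
      show "p \<le> s" using s \<open>p \<in> ?W\<close> unfolding is_sup_def by blast
      show "s \<le> q"
      proof (rule ccontr)
        assume "\<not> s \<le> q"
        then obtain x where "x \<in> ?W" "q < x" using s unfolding is_sup_def by (meson not_le)
        then show False by auto
      qed
    qed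
    have below: "z \<in> T" if z: "p \<le> z" "z < s" for z
    proof -
      have "\<exists>w\<in>?W. z < w" using s z(2) unfolding is_sup_def by blast
      then show ?thesis using z by auto
    qed
    have "s \<in> I" using I[OF pq(1,2)] ps by blast
    then consider "loc (\<lambda>y. y \<in> T) s" | "loc (\<lambda>y. y \<notin> T) s" using T(2) by blast
    then show False
    proof cases
      case 1
      then obtain a b where ab: "a < s" "s < b" "\<forall>y. a < y \<and> y < b \<longrightarrow> y \<in> T" unfolding loc_def by blast
      then have "s \<in> T" by blast
      then have "s < q" using nq ps(2) by (auto simp: less_le)
      then obtain w where w: "s < w" "w < min b q" using dense_order[of s "min b q"] ab(2) by auto
      have "w \<in> ?W"
      proof -
        have "z \<in> T" if z: "p \<le> z" "z \<le> w" for z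
        proof (cases "z < s")
          case False
          have "w < b" using w(2) by simp
          then have "a < z" "z < b" using False z ab(1) by order+
          then show ?thesis using ab(3) by blast
        qed (use z below in blast)
        then show ?thesis using w ps by auto
      qed
      then show False using s w(1) unfolding is_sup_def by fastforce
    next
      case 2
      then obtain a b where ab: "a < s" "s < b" "\<forall>y. a < y \<and> y < b \<longrightarrow> y \<notin> T" unfolding loc_def by blast
      then have "s \<noteq> p" using pq(4) by blast
      then have "p < s" using ps by auto
      then obtain z where z: "max a p < z" "z < s" using dense_order[of "max a p" s] ab(1) by auto
      then have "p \<le> z" "a < z" by auto
      moreover have "z < b" using z(2) ab(2) by order
      ultimately show False using below[of z] z(2) ab(3) by blast
    qed
  qed
  show ?thesis
  proof (rule ccontr)
    assume ny: "y \<notin> S"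
    then consider "x < y" | "y < x" using xy(3) by (metis linorder_neqE)
    then show False
    proof cases
      case 1 then show ?thesis using main[OF assms(1) dec xy(1,2)] xy(3) ny by blast
    next
      case 2
      have "udef L A (- S)" using dpred_not[OF assms(1)] by simp
      then have "x \<in> - S" using main[of "- S" y x] dec xy ny 2 by auto
      then show ?thesis using xy(3) by blast
    qed
  qed
qed

end

section \<open>The pregeometry of definable closure\<close>

lemma dpred_finite_params:
  assumes "dpred M L A P" obtains B where "finite B" "B \<subseteq> A" "dpred M L B P"
proof -
  obtain \<phi> s where p: "\<phi> \<in> fmls L" "range s \<subseteq> slots A" "\<And>E. P E \<longleftrightarrow> sat M (\<lambda>i. slot_val E (s i)) \<phi>"
    using assms unfolding dpred_def by blast
  define s' where "s' i = (if i \<in> fm_fv \<phi> then s i else Inr 0)" for i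
  define B where "B = A \<inter> (\<lambda>i. case s i of Inl q \<Rightarrow> 0 | Inr c \<Rightarrow> c) ` fm_fv \<phi>"
  have "P E \<longleftrightarrow> sat M (\<lambda>i. slot_val E (s' i)) \<phi>" for E
    unfolding p(3) by (rule sat_cong) (simp add: s'_def)
  moreover have "s' i \<in> slots B" for i
  proof (cases "i \<in> fm_fv \<phi>")
    case True
    have "s i \<in> slots A" using p(2) by blast
    show ?thesis
    proof (cases "s i")
      case (Inr c)
      then have "c \<in> (\<lambda>i. case s i of Inl q \<Rightarrow> 0 | Inr c \<Rightarrow> c) ` fm_fv \<phi>" using True by (intro image_eqI[of _ _ i]) auto
      then show ?thesis using \<open>s i \<in> slots A\<close> Inr True by (auto simp: s'_def slots_def B_def)
    qed (use True in \<open>simp add: s'_def slots_def\<close>)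
  qed (simp add: s'_def slots_def)
  ultimately have "dpred M L B P" unfolding dpred_def using p(1) by blast
  moreover have "finite B" by (simp add: B_def finite_fm_fv)
  ultimately show thesis using that[of B] by (simp add: B_def)
qed

text \<open>A parameter is turned into a variable: all tuple variables move up by one, and entry 0
  of the new tuple variable 0 takes the place of \<open>b\<close>.\<close>

lemma dpred_abstract:
  assumes "dpred M L (insert b A) P"
  obtains R where "dpred M L A R" "\<And>E f. f 0 = b \<Longrightarrow> P E \<longleftrightarrow> R (case_nat f E)"
proof -
  obtain \<phi> s where p: "\<phi> \<in> fmls L" "range s \<subseteq> slots (insert b A)" "\<And>E. P E \<longleftrightarrow> sat M (\<lambda>i. slot_val E (s i)) \<phi>"
    using assms unfolding dpred_def by blast
  define s' where "s' i = (case s i of Inl q \<Rightarrow> Inl (Suc (fst q), snd q) | Inr c \<Rightarrow> if c = b then Inl (0, 0) else Inr c)" for i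
  have "slot_val (case_nat f E) (s' i) = slot_val E (s i)" if "f 0 = b" for f E i
    using that by (auto simp: s'_def split: sum.splits)
  then have "P E \<longleftrightarrow> sat M (\<lambda>i. slot_val (case_nat f E) (s' i)) \<phi>" if "f 0 = b" for E f
    using that by (simp add: p(3))
  moreover have "s' i \<in> slots A" for i
  proof -
    have "s i \<in> slots (insert b A)" using p(2) by blast
    then show ?thesis by (auto simp: s'_def slots_def)
  qed
  then have "range s' \<subseteq> slots A" by blast
  then have "dpred M L A (\<lambda>E. sat M (\<lambda>i. slot_val E (s' i)) \<phi>)"
    unfolding dpred_def using p(1) by blast
  ultimately show thesis using that by blast
qed

definition tbox :: "'a::ord list \<Rightarrow> 'a list \<Rightarrow> 'a list set" where
  "tbox cs ds = {y. length y = length cs \<and> (\<forall>i<length cs. cs ! i < y ! i \<and> y ! i < ds ! i)}"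

text \<open>The sublanguage is countable, so a countable parameter set has countably many definable
  sets and a countable closure.\<close>

locale pregeo = omin \<kappa> M for \<kappa> :: "'k rel" and M :: "('a::linordered_group_add, 'f, 'r) interp" +
  fixes L :: "'f set \<times> 'r set"
  assumes countable_L: "countable (fst L)" "countable (snd L)"
begin

definition dcl :: "'a set \<Rightarrow> 'a set" where
  "dcl A = {a. udef L A {a}}"

lemma dcl_mono: "A \<subseteq> B \<Longrightarrow> dcl A \<subseteq> dcl B"
  unfolding dcl_def using udef_mono by blast

lemma subset_dcl: "A \<subseteq> dcl A"
  unfolding dcl_def by (auto intro!: dpred_eq sterm_var sterm_const)

text \<open>The order lets elements be peeled off one minimum at a time. This is why algebraic and
  definable closure coincide here.\<close>

lemma finite_udef_subset_dcl:
  assumes "udef L A S" "finite S" shows "S \<subseteq> dcl A"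
  using assms
proof (induction "card S" arbitrary: S)
  case (Suc k)
  then have ne: "S \<noteq> {}" by auto
  let ?m = "Min S"
  have m: "?m \<in> S" using Suc.prems(2) ne by (rule Min_in)
  have "dpred M L A (\<lambda>E. E 0 0 \<in> S \<and> (\<forall>y. y \<in> S \<longrightarrow> \<not> y < E 0 0))"
    by (intro dpred_conj Suc.prems, rule dpred_all[where k = 1 and j = 0],
        intro dpred_imp dpred_not dpred_less sterm_var dpred_app1[OF Suc.prems(1)]) simp
  then have um: "udef L A {?m}"
    by (rule dpred_cong) (use m Suc.prems(2) in \<open>auto simp: not_less intro: antisym\<close>)
  then have "udef L A (S - {?m})" using dpred_conj[OF Suc.prems(1) dpred_not[OF um]] by simp
  then have "S - {?m} \<subseteq> dcl A" using Suc.hyps Suc.prems(2) m by (intro Suc.hyps(1)) auto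
  then show ?case using um by (auto simp: dcl_def)
qed simp

text \<open>The parameter \<open>b\<close> is replaced by an existentially quantified variable
  restricted to the set \<open>{b}\<close>, which is definable over \<open>A\<close>.\<close>

lemma dpred_dcl_elim1:
  assumes "dpred M L (insert b A) P" "b \<in> dcl A" shows "dpred M L A P"
proof -
  obtain R where R: "dpred M L A R" "\<And>E f. f 0 = b \<Longrightarrow> P E \<longleftrightarrow> R (case_nat f E)"
    using assms(1) by (rule dpred_abstract) blast
  let ?Q = "\<lambda>E. E 0 0 \<in> {b} \<and> R E"
  have "dpred M L A ?Q" using assms(2) R(1) unfolding dcl_def by (intro dpred_conj) auto
  then have "dpred M L A (\<lambda>E. \<exists>x. ?Q (E(0 := (E 0)(0 := x))))"
    unfolding dpred_iff_dnorm by (rule dnorm_ex)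
  from dpred_reindex[OF this, of "\<lambda>i j. case i of 0 \<Rightarrow> Inr 0 | Suc k \<Rightarrow> Inl (k, j)"]
  have *: "dpred M L A (\<lambda>E. \<exists>x. ?Q ((\<lambda>i j. slot_val E (case i of 0 \<Rightarrow> Inr 0 | Suc k \<Rightarrow> Inl (k, j)))(0 := ((\<lambda>j. 0)(0 := x)))))"
    by (auto simp: slots_def split: nat.splits)
  have eq: "(\<lambda>i j. slot_val E (case i of 0 \<Rightarrow> Inr 0 | Suc k \<Rightarrow> Inl (k, j)))(0 := f) = case_nat f E" for E f
    by (auto simp: fun_eq_iff split: nat.splits)
  show ?thesis
  proof (rule dpred_cong[OF *])
    fix E
    show "(\<exists>x. ?Q ((\<lambda>i j. slot_val E (case i of 0 \<Rightarrow> Inr 0 | Suc k \<Rightarrow> Inl (k, j)))(0 := ((\<lambda>j. 0)(0 := x))))) = P E"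
      unfolding eq using R(2)[of "(\<lambda>j. 0)(0 := b)" E] by auto
  qed
qed

lemma dpred_dcl_elim:
  assumes "dpred M L (A \<union> B) P" "B \<subseteq> dcl A" shows "dpred M L A P"
proof -
  obtain C where C: "finite C" "C \<subseteq> A \<union> B" "dpred M L C P" using assms(1) by (rule dpred_finite_params)
  have elim: "dpred M L A P" if "finite D" "D \<subseteq> dcl A" "dpred M L (A \<union> D) P" for D
    using that
  proof (induction D rule: finite_induct)
    case (insert b D)
    have "dpred M L (insert b (A \<union> D)) P" using insert.prems(2) by simp
    moreover have "b \<in> dcl (A \<union> D)" using insert.prems(1) dcl_mono[of A "A \<union> D"] by auto
    ultimately have "dpred M L (A \<union> D) P" by (rule dpred_dcl_elim1)
    then show ?case using insert by simp
  qed simp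
  have "finite (C - A)" "C - A \<subseteq> dcl A" using C assms(2) by auto
  moreover have "dpred M L (A \<union> (C - A)) P" by (rule dpred_mono[OF C(3)]) auto
  ultimately show ?thesis by (rule elim)
qed

lemma dcl_trans: "B \<subseteq> dcl A \<Longrightarrow> dcl (A \<union> B) \<subseteq> dcl A"
  using dpred_dcl_elim unfolding dcl_def by blast

lemma dcl_subset: "B \<subseteq> dcl A \<Longrightarrow> dcl B \<subseteq> dcl A"
  using dcl_trans[of B A] dcl_mono[of B "A \<union> B"] by blast

lemma countable_dcl: assumes "countable A" shows "countable (dcl A)"
proof -
  have "(\<lambda>a. {[a]}) ` dcl A \<subseteq> {D. dset M (fst L, snd L) A (Suc 0) D}"
    using udef_dset[of L A "{_}"] unfolding dcl_def by auto
  then have "countable ((\<lambda>a. {[a]}) ` dcl A)"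
    using countable_dsets[OF countable_L assms] countable_subset by blast
  then show ?thesis by (rule countable_image_inj_on) (auto simp: inj_on_def)
qed

text \<open>Otherwise \<open>S\<close> would be covered by countably many singletons and, by
  compactness, be finite. The parameters defining \<open>S\<close> are unrelated to
  \<open>A\<close>.\<close>

lemma generic_exists:
  assumes "udef L' A' S" "infinite S" "countable A" shows "\<exists>a\<in>S. a \<notin> dcl A"
proof (rule ccontr)
  assume "\<not> ?thesis"
  then have sub: "S \<subseteq> dcl A" by blast
  obtain \<F> where F: "\<F> \<subseteq> (\<lambda>a. {[a]}) ` dcl A" "finite \<F>" "(\<lambda>x. [x]) ` S \<subseteq> \<Union>\<F>"
  proof (rule definable_finite_cover[OF suff_sat])
    show "definable M (Suc 0) ((\<lambda>x. [x]) ` S)" using dset_imp_definable[OF udef_dset[OF assms(1)]] .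
    show "small \<kappa> ((\<lambda>a. {[a]}) ` dcl A)"
      by (intro small_countable[OF suff_sat] countable_image countable_dcl assms)
    show "definable M (Suc 0) D" if "D \<in> (\<lambda>a. {[a]}) ` dcl A" for D
      using that by (auto intro: definable_singleton)
    show "(\<lambda>x. [x]) ` S \<subseteq> \<Union> ((\<lambda>a. {[a]}) ` dcl A)" using sub by auto
  qed
  have "finite (\<Union>\<F>)" using F by (auto simp: subset_iff image_iff)
  then have "finite ((\<lambda>x. [x]) ` S)" using F(3) finite_subset by blast
  then show False using assms(2) finite_imageD[of "\<lambda>x. [x]" S] by (auto simp: inj_on_def)
qed

lemma udef_interval: "udef full UNIV {a<..<b}"
  by (auto intro!: dpred_conj dpred_less sterm_var sterm_const)

lemma generic_in_interval: "a < b \<Longrightarrow> countable A \<Longrightarrow> \<exists>c. a < c \<and> c < b \<and> c \<notin> dcl A"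
  using generic_exists[OF udef_interval infinite_interval] by force

text \<open>The points of \<open>S\<close> without a neighbourhood inside \<open>S\<close> form a
  finite set definable over \<open>A\<close>, so all of them lie in \<open>dcl A\<close>.\<close>

lemma generic_loc:
  assumes "udef L A S" "a \<in> S" "a \<notin> dcl A" shows "loc (\<lambda>y. y \<in> S) a"
proof (rule ccontr)
  assume no: "\<not> ?thesis"
  let ?T = "{x \<in> S. \<not> loc (\<lambda>y. y \<in> S) x}"
  have "udef L A ?T" using dpred_conj[OF assms(1) dpred_not[OF dpred_loc1[OF assms(1)]]] by simp
  then have "?T \<subseteq> dcl A" using finite_boundary[OF assms(1)] by (rule finite_udef_subset_dcl)
  then show False using no assms by blast
qed

lemma udef_abstract:
  assumes "udef L (insert a A) S"
  obtains R where "dpred M L A (\<lambda>E. R (E 0 0) (E 1 0))" "\<And>y. R a y \<longleftrightarrow> y \<in> S"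
proof -
  obtain R where R: "dpred M L A R" "\<And>E f. f 0 = a \<Longrightarrow> E 0 0 \<in> S \<longleftrightarrow> R (case_nat f E)"
    using assms by (rule dpred_abstract) blast
  define R' where "R' x y = R (case_nat (\<lambda>_. x) (\<lambda>_ _. y))" for x y
  from dpred_reindex[OF R(1), of "\<lambda>i j. case i of 0 \<Rightarrow> Inl (0, 0) | Suc k \<Rightarrow> Inl (1, 0)"]
  have Rd: "dpred M L A (\<lambda>E. R (\<lambda>i j. slot_val E (case i of 0 \<Rightarrow> Inl (0, 0) | Suc k \<Rightarrow> Inl (1, 0))))"
    by (auto simp: slots_def split: nat.splits)
  have eq: "(\<lambda>i j. slot_val E (case i of 0 \<Rightarrow> Inl (0, 0) | Suc k \<Rightarrow> Inl (1, 0))) = case_nat (\<lambda>_. E 0 0) (\<lambda>_ _. E 1 0)" for E :: "nat \<Rightarrow> nat \<Rightarrow> 'a"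
    by (auto simp: fun_eq_iff split: nat.splits)
  have "dpred M L A (\<lambda>E. R' (E 0 0) (E 1 0))" unfolding R'_def by (rule dpred_cong[OF Rd]) (simp only: eq)
  moreover have "R' a y \<longleftrightarrow> y \<in> S" for y unfolding R'_def using R(2)[of "\<lambda>_. a" "\<lambda>_ _. y"] by simp
  ultimately show thesis by (rule that)
qed

text \<open>The function is constant on each of the finitely many intervals that make up the set of
  points where it is locally constant.\<close>

lemma finite_locally_constant_values:
  assumes G: "dpred M L A (\<lambda>E. G (E 0 0) (E 1 0))" and fn: "\<And>x y z. G x y \<Longrightarrow> G x z \<Longrightarrow> y = z"
    and pq: "p < q" "\<And>y. p < y \<Longrightarrow> y < q \<Longrightarrow> \<exists>x. loc (\<lambda>x. G x y) x"
  shows False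
proof -
  define W where "W = {x. \<exists>y. (p < y \<and> y < q) \<and> loc (\<lambda>x. G x y) x}"
  have G': "dpred M L (A \<union> {p, q}) (\<lambda>E. G (E 1 0) (E 0 0))"
    by (rule dpred_mono[OF dpred_app2[where P = G, OF G sterm_var sterm_var]]) auto
  have "dpred M L (A \<union> {p, q}) (\<lambda>E. loc (\<lambda>x. G x (E 0 0)) (E 1 0))"
    by (rule dpred_loc[where R = "\<lambda>y x. G x y", OF G'])
  note lc = dpred_app2[where P = "\<lambda>y x. loc (\<lambda>x. G x y) x", OF this sterm_var sterm_var]
  have "udef L (A \<union> {p, q}) W" unfolding W_def mem_Collect_eq
    by (rule dpred_ex[where k = 1 and j = 0], intro dpred_conj dpred_less sterm_var sterm_const lc) auto
  then obtain \<F> where F: "finite \<F>" "\<F> \<subseteq> {{a} |a. True} \<union> open_intervals" "W = \<Union>\<F>" by (rule omin_pieces)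
  define V where "V I = {y. (p < y \<and> y < q) \<and> (\<exists>x\<in>I. loc (\<lambda>x. G x y) x)}" for I
  have one: "y = y'" if I: "I \<in> \<F>" "y \<in> V I" "y' \<in> V I" for I y y'
  proof -
    obtain x where x: "x \<in> I" "loc (\<lambda>x. G x y) x" using I(2) V_def by blast
    obtain x' where x': "x' \<in> I" "loc (\<lambda>x. G x y') x'" using I(3) V_def by blast
    have "udef L (insert y A) {z. G z y}"
      using dpred_app2[where P = G, OF dpred_mono[OF G, of L "insert y A"] sterm_var sterm_const] by auto
    moreover have "v \<in> I" if "u \<in> I" "w \<in> I" "u \<le> v" "v \<le> w" for u v w
    proof -
      have "I \<in> {{a} |a. True} \<union> open_intervals" using F(2) I(1) by blast
      then show ?thesis using that unfolding open_intervals_def by auto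
    qed
    moreover have "loc (\<lambda>z. z \<in> {z. G z y}) w \<or> loc (\<lambda>z. z \<notin> {z. G z y}) w" if w: "w \<in> I" for w
    proof -
      have "w \<in> W" using w I(1) F(3) by blast
      then obtain v where v: "loc (\<lambda>x. G x v) w" unfolding W_def by blast
      show ?thesis
      proof (cases "v = y")
        case False
        then have "loc (\<lambda>z. z \<notin> {z. G z y}) w" using v fn by (auto elim!: loc_mono)
        then show ?thesis ..
      qed (use v in simp)
    qed
    ultimately have "x' \<in> {z. G z y}"
      by (rule locally_decided_constant[where x = x and I = I]) (use x x' loc_here[OF x(2)] in auto)
    then show "y = y'" using fn loc_here[OF x'(2)] by blast
  qed
  have "finite (V I)" if "I \<in> \<F>" for I
  proof (cases "V I = {}")
    case False
    then obtain y where "y \<in> V I" by blast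
    then have "V I \<subseteq> {y}" using one[OF that] by blast
    then show ?thesis using finite_subset by blast
  qed simp
  then have "finite (\<Union>I\<in>\<F>. V I)" using F(1) by blast
  moreover have "{p<..<q} \<subseteq> (\<Union>I\<in>\<F>. V I)"
  proof
    fix y assume "y \<in> {p<..<q}"
    then have y: "p < y" "y < q" by auto
    then obtain x where x: "loc (\<lambda>x. G x y) x" using pq(2) by blast
    then have "x \<in> W" using y unfolding W_def by blast
    then obtain I where "I \<in> \<F>" "x \<in> I" using F(3) by blast
    then show "y \<in> (\<Union>I\<in>\<F>. V I)" using x y unfolding V_def by blast
  qed
  ultimately show False using infinite_interval[OF pq(1)] finite_subset by blast
qed

text \<open>\<open>b\<close> is the value at \<open>a\<close> of a partial function \<open>G\<close>
  definable over \<open>A\<close>. Were \<open>a\<close> generic over \<open>b\<close>, the fibre of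
  \<open>b\<close> would contain a neighbourhood of \<open>a\<close>, so \<open>b\<close> would be a
  value taken locally constantly. Being generic over \<open>A\<close>, it would lie in a whole
  interval of such values, whereas only finitely many values can be taken in this way on any
  interval.\<close>

lemma exchange:
  assumes b: "b \<in> dcl (insert a A)" "b \<notin> dcl A" shows "a \<in> dcl (insert b A)"
proof (rule ccontr)
  assume a: "a \<notin> dcl (insert b A)"
  have "udef L (insert a A) {b}" using b(1) by (simp add: dcl_def)
  then obtain R where R: "dpred M L A (\<lambda>E. R (E 0 0) (E 1 0))" "\<And>y. R a y \<longleftrightarrow> y \<in> {b}"
    by (rule udef_abstract) blast
  \<comment> \<open>Abstracting \<open>a\<close> gives a relation \<open>R\<close> that is
    single-valued at \<open>a\<close> but perhaps not elsewhere; \<open>G\<close> keeps the points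
    with exactly one value.\<close>
  define G where "G x y \<longleftrightarrow> R x y \<and> (\<forall>z. R x z \<longrightarrow> z = y)" for x y
  have G: "dpred M L A (\<lambda>E. G (E 0 0) (E 1 0))" unfolding G_def
    by (intro dpred_conj R(1), rule dpred_all[where k = 2 and j = 0],
        intro dpred_imp dpred_eq sterm_var dpred_app2[OF R(1)]) simp
  have fn: "y = z" if "G x y" "G x z" for x y z using that unfolding G_def by blast
  have Gab: "G a b" using R(2) by (simp add: G_def)
  have G': "dpred M L A (\<lambda>E. G (E 1 0) (E 0 0))" by (rule dpred_app2[where P = G, OF G sterm_var sterm_var])
  have "dpred M L A (\<lambda>E. loc (\<lambda>x. G x (E 0 0)) (E 1 0))" by (rule dpred_loc[where R = "\<lambda>y x. G x y", OF G'])
  note lc = dpred_app2[where P = "\<lambda>y x. loc (\<lambda>x. G x y) x", OF this sterm_var sterm_var]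
  define B where "B = {y. \<exists>x. loc (\<lambda>x. G x y) x}"
  have B: "udef L A B" unfolding B_def mem_Collect_eq
    by (rule dpred_ex[where k = 1 and j = 0], intro lc) simp
  have "udef L (insert b A) {x. G x b}"
    using dpred_app2[where P = G, OF dpred_mono[OF G, of L "insert b A"] sterm_var sterm_const] by auto
  then have "loc (\<lambda>x. x \<in> {x. G x b}) a" by (rule generic_loc) (use Gab a in auto)
  then have "b \<in> B" unfolding B_def by auto
  then have "loc (\<lambda>y. y \<in> B) b" by (rule generic_loc[OF B _ b(2)])
  then obtain p q where pq: "p < b" "b < q" "\<forall>y. p < y \<and> y < q \<longrightarrow> y \<in> B" unfolding loc_def by blast
  show False
  proof (rule finite_locally_constant_values[OF G])
    show "p < q" using pq(1,2) by order
    show "\<exists>x. loc (\<lambda>x. G x y) x" if "p < y" "y < q" for y using pq(3) that unfolding B_def by blast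
  qed (rule fn)
qed

section \<open>Independent sequences, generic tuples and rank\<close>

fun indep :: "'a set \<Rightarrow> 'a list \<Rightarrow> bool" where
  "indep A [] \<longleftrightarrow> True"
| "indep A (x # xs) \<longleftrightarrow> x \<notin> dcl A \<and> indep (insert x A) xs"

lemma indep_append: "indep A (xs @ ys) \<longleftrightarrow> indep A xs \<and> indep (A \<union> set xs) ys"
  by (induction xs arbitrary: A) auto

text \<open>Symmetry of independence, by repeated exchange: choosing auxiliary points generically
  over \<open>x\<close> keeps \<open>x\<close> generic over them. It is the device by which interval
  endpoints become harmless parameters.\<close>

lemma exchange_list: "x \<notin> dcl A \<Longrightarrow> indep (insert x A) zs \<Longrightarrow> x \<notin> dcl (A \<union> set zs)"
proof (induction zs arbitrary: A)
  case (Cons z zs)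
  then have "z \<notin> dcl (insert x A)" "indep (insert x (insert z A)) zs" by (auto simp: insert_commute)
  moreover have "x \<notin> dcl (insert z A)" using exchange[of x z A] Cons.prems(1) calculation(1) by blast
  ultimately show ?case using Cons.IH[of "insert z A"] by simp
qed simp

lemma choose_indep:
  assumes "\<And>p. p \<in> set ps \<Longrightarrow> fst p < snd p" "countable B"
  shows "\<exists>zs. length zs = length ps \<and> (\<forall>i<length ps. fst (ps ! i) < zs ! i \<and> zs ! i < snd (ps ! i)) \<and> indep B zs"
  using assms
proof (induction ps arbitrary: B)
  case (Cons p ps)
  obtain z where z: "fst p < z" "z < snd p" "z \<notin> dcl B"
    using generic_in_interval[of "fst p" "snd p" B] Cons.prems by auto
  obtain zs where "length zs = length ps" "\<forall>i<length ps. fst (ps ! i) < zs ! i \<and> zs ! i < snd (ps ! i)" "indep (insert z B) zs"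
    using Cons.IH[of "insert z B"] Cons.prems by auto
  with z show ?case by (intro exI[of _ "z # zs"]) (auto simp: nth_Cons split: nat.split)
qed simp

lemma dpred_tbox:
  assumes "set cs \<subseteq> A" "set ds \<subseteq> A" "length ds = length cs" "tterm A (length cs) t"
  shows "dpred M L' A (\<lambda>E. t E \<in> tbox cs ds)"
proof -
  have "dpred M L' A (\<lambda>E. \<forall>i\<in>{..<length cs}. cs ! i < t E ! i \<and> t E ! i < ds ! i)"
  proof (rule dpred_all_finite)
    fix i assume "i \<in> {..<length cs}"
    then have "cs ! i \<in> A" "ds ! i \<in> A" "i < length cs" using assms nth_mem[of i cs] nth_mem[of i ds] by auto
    then show "dpred M L' A (\<lambda>E. cs ! i < t E ! i \<and> t E ! i < ds ! i)"
      by (intro dpred_conj dpred_less sterm_const tterm_nth[OF assms(4)]) auto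
  qed simp
  then show ?thesis by (rule dpred_cong) (auto simp: tbox_def tterm_length[OF assms(4)])
qed

text \<open>By induction the fibre over \<open>x\<close> contains a box around \<open>xs\<close>.
  Its endpoints are replaced by ones independent over \<open>x\<close>, so that \<open>x\<close>
  stays generic over them; the set of first coordinates over which the whole smaller box lies in
  \<open>D\<close> is definable over these endpoints, contains \<open>x\<close>, and hence contains
  an interval around it.\<close>

lemma generic_tuple_interior:
  assumes "indep A xs" "dset M L A (length xs) D" "xs \<in> D" "countable A"
  shows "\<exists>cs ds. length cs = length xs \<and> length ds = length xs \<and> xs \<in> tbox cs ds \<and> tbox cs ds \<subseteq> D"
  using assms
proof (induction xs arbitrary: A D)
  case Nil
  then have "tbox [] [] \<subseteq> D" by (auto simp: tbox_def)
  then show ?case by (auto simp: tbox_def)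
next
  case (Cons x xs)
  let ?k = "length xs"
  define Dx where "Dx = {y. length y = ?k \<and> x # y \<in> D}"
  have "dset M L (insert x A) (Suc ?k) D" by (rule dset_mono[OF Cons.prems(2)[simplified]]) auto
  then have "dpred M L (insert x A) (\<lambda>E. x # tup ?k (E 0) \<in> D)"
    by (rule dpred_mem) (intro tterm_Cons sterm_const tterm_tup, simp)
  then have "dset M L (insert x A) ?k Dx" unfolding Dx_def by (rule dsetI)
  then obtain cs ds where cd: "length cs = ?k" "length ds = ?k" "xs \<in> tbox cs ds" "tbox cs ds \<subseteq> Dx"
    using Cons.IH[of "insert x A" Dx] Cons.prems by (auto simp: Dx_def)
  \<comment> \<open>The new lower endpoints are taken between \<open>cs\<close> and
    \<open>xs\<close>, the new upper ones between \<open>xs\<close> and \<open>ds\<close>, all in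
    one independent sequence.\<close>
  let ?ps = "zip cs xs @ zip xs ds"
  have "fst p < snd p" if "p \<in> set ?ps" for p
    using that cd(1-3) by (auto simp: tbox_def in_set_zip)
  then obtain zs where zs: "length zs = length ?ps" "\<forall>i<length ?ps. fst (?ps ! i) < zs ! i \<and> zs ! i < snd (?ps ! i)"
      "indep (insert x A) zs"
    using choose_indep[of ?ps "insert x A"] Cons.prems(4) by auto
  define cs' where "cs' = take ?k zs"
  define ds' where "ds' = drop ?k zs"
  have l: "length zs = ?k + ?k" "length cs' = ?k" "length ds' = ?k" using zs(1) cd by (auto simp: cs'_def ds'_def)
  have between: "cs ! i < cs' ! i" "cs' ! i < xs ! i" "xs ! i < ds' ! i" "ds' ! i < ds ! i" if "i < ?k" for i
  proof -
    show "cs ! i < cs' ! i" "cs' ! i < xs ! i"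
      using zs(2)[rule_format, of i] that cd l by (auto simp: cs'_def nth_append)
    show "xs ! i < ds' ! i" "ds' ! i < ds ! i"
      using zs(2)[rule_format, of "?k + i"] that cd l by (auto simp: ds'_def nth_append)
  qed
  have xsb: "xs \<in> tbox cs' ds'" using between l by (auto simp: tbox_def)
  have sub: "tbox cs' ds' \<subseteq> Dx"
  proof -
    have "cs ! i < y ! i \<and> y ! i < ds ! i" if "y \<in> tbox cs' ds'" "i < ?k" for y i
    proof -
      have "cs' ! i < y ! i" "y ! i < ds' ! i" using that l by (auto simp: tbox_def)
      then show ?thesis using between[OF that(2)] by (intro conjI) order+
    qed
    then have "tbox cs' ds' \<subseteq> tbox cs ds" using cd l by (auto simp: tbox_def)
    then show ?thesis using cd(4) by blast
  qed
  let ?B = "A \<union> set zs"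
  have set': "set cs' \<subseteq> ?B" "set ds' \<subseteq> ?B" unfolding cs'_def ds'_def using set_take_subset set_drop_subset by fast+
  have x: "x \<notin> dcl ?B" using exchange_list[of x A zs] Cons.prems(1) zs(3) by auto
  define S where "S = {x'. \<not> (\<exists>y. length y = ?k \<and> (y \<in> tbox cs' ds' \<and> \<not> x' # y \<in> D))}"
  have DB: "dset M L ?B (Suc ?k) D" by (rule dset_mono[OF Cons.prems(2)[simplified]]) auto
  have "udef L ?B S" unfolding S_def mem_Collect_eq
  proof (rule dpred_not, rule dpred_ex_tuple[where k = 1])
    show "dpred M L ?B (\<lambda>E. tup ?k (E 1) \<in> tbox cs' ds' \<and> \<not> E 0 0 # tup ?k (E 1) \<in> D)"
      by (intro dpred_conj dpred_not dpred_mem[OF DB] dpred_tbox set' tterm_Cons sterm_var) (auto simp: l tterm_tup)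
  qed simp
  moreover have "x \<in> S" using sub by (auto simp: S_def Dx_def)
  ultimately have "loc (\<lambda>y. y \<in> S) x" using x by (rule generic_loc)
  then obtain a b where ab: "a < x" "x < b" "\<forall>y. a < y \<and> y < b \<longrightarrow> y \<in> S" unfolding loc_def by blast
  have "tbox (a # cs') (b # ds') \<subseteq> D"
  proof
    fix z assume z: "z \<in> tbox (a # cs') (b # ds')"
    then obtain z0 y where zy: "z = z0 # y" "length y = ?k" using l by (auto simp: tbox_def length_Suc_conv)
    have zi: "(a # cs') ! i < z ! i \<and> z ! i < (b # ds') ! i" if "i < Suc ?k" for i
      using z that l by (auto simp: tbox_def)
    have "a < z0" "z0 < b" using zi[of 0] zy by auto
    then have "z0 \<in> S" using ab(3) by blast
    moreover have "y \<in> tbox cs' ds'" using zi[of "Suc _"] zy l by (auto simp: tbox_def)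
    ultimately show "z \<in> D" using zy unfolding S_def by blast
  qed
  moreover have "x # xs \<in> tbox (a # cs') (b # ds')" using ab xsb l by (auto simp: tbox_def nth_Cons split: nat.split)
  ultimately show ?case using l by (intro exI[of _ "a # cs'"] exI[of _ "b # ds'"]) auto
qed

text \<open>Each \<open>w\<close> is exchanged for one element of \<open>S\<close>; after
  \<open>w\<close> joins the base, the rest of \<open>S\<close> still spans the remaining
  entries.\<close>

lemma steinitz:
  assumes "indep A ws" "set ws \<subseteq> dcl (A \<union> S)" "finite S" shows "length ws \<le> card S"
  using assms
proof (induction ws arbitrary: A S)
  case (Cons w ws)
  have w: "w \<in> dcl (A \<union> S)" "w \<notin> dcl A" using Cons.prems by auto
  \<comment> \<open>When the elements of \<open>S\<close> are added to \<open>A\<close> one at a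
    time, \<open>s\<close> is the one at which \<open>w\<close> enters the closure, and
    \<open>T\<close> is what was added before it.\<close>
  have "\<exists>s\<in>S. \<exists>T\<subseteq>S. s \<notin> T \<and> w \<in> dcl (insert s (A \<union> T)) \<and> w \<notin> dcl (A \<union> T)"
    using \<open>finite S\<close> w(1)
  proof (induction S rule: finite_induct)
    case empty
    then show ?case using w(2) by simp
  next
    case (insert s S)
    show ?case
    proof (cases "w \<in> dcl (A \<union> S)")
      case True
      then obtain s' T where "s' \<in> S" "T \<subseteq> S" "s' \<notin> T \<and> w \<in> dcl (insert s' (A \<union> T)) \<and> w \<notin> dcl (A \<union> T)"
        using insert.IH by blast
      then show ?thesis by (intro bexI[of _ s'] exI[of _ T] conjI) auto
    next
      case False
      then show ?thesis using insert by (intro bexI[of _ s] exI[of _ S]) auto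
    qed
  qed
  then obtain s T where sT: "s \<in> S" "T \<subseteq> S" "s \<notin> T" "w \<in> dcl (insert s (A \<union> T))" "w \<notin> dcl (A \<union> T)" by blast
  let ?S = "S - {s}"
  have "s \<in> dcl (insert w (A \<union> T))" by (rule exchange[OF sT(4,5)])
  then have s: "s \<in> dcl (insert w A \<union> ?S)" using dcl_mono[of "insert w (A \<union> T)" "insert w A \<union> ?S"] sT by auto
  have "A \<union> S \<subseteq> dcl (insert w A \<union> ?S)" using s subset_dcl[of "insert w A \<union> ?S"] by auto
  then have "dcl (A \<union> S) \<subseteq> dcl (insert w A \<union> ?S)" by (rule dcl_subset)
  then have "length ws \<le> card ?S" using Cons by (intro Cons.IH[of "insert w A"]) auto
  then show ?case using sT(1) Cons.prems(3) by (metis One_nat_def Suc_le_mono Suc_pred card_Diff_singleton card_gt_0_iff empty_iff length_Cons)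
qed simp

text \<open>Greedy choice from left to right gives increasing positions, the shape of the coordinate
  projections in \<open>def_dim\<close>.\<close>

lemma exists_basis:
  "\<exists>js. sorted_wrt (<) js \<and> set js \<subseteq> {..<length b} \<and> indep A (map ((!) b) js) \<and> set b \<subseteq> dcl (A \<union> set (map ((!) b) js))"
proof (induction b rule: rev_induct)
  case (snoc x b)
  then obtain js where js: "sorted_wrt (<) js" "set js \<subseteq> {..<length b}" "indep A (map ((!) b) js)"
    "set b \<subseteq> dcl (A \<union> set (map ((!) b) js))" by blast
  have eq: "map ((!) (b @ [x])) js = map ((!) b) js" using js(2) by (auto simp: nth_append)
  show ?case
  proof (cases "x \<in> dcl (A \<union> set (map ((!) b) js))")
    case True
    then have "set (b @ [x]) \<subseteq> dcl (A \<union> set (map ((!) b) js))" using js(4) by auto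
    moreover have "set js \<subseteq> {..<length (b @ [x])}" using js(2) by auto
    ultimately show ?thesis using js(1,3) unfolding eq[symmetric] by blast
  next
    case False
    let ?js = "js @ [length b]"
    have eq': "map ((!) (b @ [x])) ?js = map ((!) b) js @ [x]" using eq by simp
    have "set (b @ [x]) \<subseteq> dcl (A \<union> set (map ((!) b) js @ [x]))"
      using js(4) dcl_mono[of "A \<union> set (map ((!) b) js)" "A \<union> set (map ((!) b) js @ [x])"]
        subset_dcl[of "A \<union> set (map ((!) b) js @ [x])"] by auto
    moreover have "indep A (map ((!) b) js @ [x])" using js(3) False by (simp add: indep_append)
    moreover have "sorted_wrt (<) ?js" using js(1,2) by (auto simp: sorted_wrt_append)
    moreover have "set ?js \<subseteq> {..<length (b @ [x])}" using js(2) by auto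
    ultimately show ?thesis unfolding eq'[symmetric] by blast
  qed
qed simp

text \<open>The bounds \<open>c\<close> and \<open>d\<close> are tightened to \<open>c'\<close> and
  \<open>d'\<close> chosen generically over \<open>a\<close>, so that \<open>a\<close> stays generic
  over them. The preimage of the tighter interval is definable over these parameters and contains
  \<open>a\<close>, hence also a neighbourhood of it.\<close>

lemma generic_continuous:
  assumes f: "dpred M L A (\<lambda>E. E 0 0 \<in> S \<and> f (E 0 0) = E 1 0)"
    and a: "a \<in> S" "a \<notin> dcl A" "countable A" "c < f a" "f a < d"
  shows "loc (\<lambda>x. x \<in> S \<and> c < f x \<and> f x < d) a"
proof -
  obtain c' where c': "c < c'" "c' < f a" "c' \<notin> dcl (insert a A)"
    using generic_in_interval[of c "f a" "insert a A"] a by auto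
  obtain d' where d': "f a < d'" "d' < d" "d' \<notin> dcl (insert c' (insert a A))"
    using generic_in_interval[of "f a" d "insert c' (insert a A)"] a by auto
  note b = c'(1,2) d'(1,2)
  let ?B = "A \<union> {c', d'}"
  have aB: "a \<notin> dcl ?B" using exchange_list[OF a(2), of "[c', d']"] c'(3) d'(3) by simp
  let ?S = "{x. \<exists>y. (x \<in> S \<and> f x = y) \<and> c' < y \<and> y < d'}"
  have f': "dpred M L ?B (\<lambda>E. E 0 0 \<in> S \<and> f (E 0 0) = E 1 0)" by (rule dpred_mono[OF f]) auto
  have "udef L ?B ?S" unfolding mem_Collect_eq
    by (rule dpred_ex[where k = 1 and j = 0], intro dpred_conj[OF f'] dpred_conj dpred_less sterm_var sterm_const) auto
  then have "loc (\<lambda>y. y \<in> ?S) a" by (rule generic_loc[OF _ _ aB]) (use a b in auto)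
  then show ?thesis
  proof (rule loc_mono)
    fix y assume "y \<in> ?S"
    then have "y \<in> S" "c' < f y" "f y < d'" by auto
    then show "y \<in> S \<and> c < f y \<and> f y < d" using b by (intro conjI) (assumption | order)+
  qed
qed

end

section \<open>Boundary points and definable choice\<close>

context omin
begin

definition bd :: "'a set \<Rightarrow> 'a set" where
  "bd S = {x. \<not> loc (\<lambda>y. y \<in> S) x \<and> \<not> loc (\<lambda>y. y \<notin> S) x}"

lemma udef_bd: assumes "udef L A S" shows "udef L A (bd S)"
  unfolding bd_def
  using dpred_conj[OF dpred_not[OF dpred_loc1[OF assms]] dpred_not[OF dpred_loc1[of L A "- S"]]] dpred_not[OF assms]
  by simp

lemma finite_bd: assumes "udef L A S" shows "finite (bd S)"
proof -
  have "udef L A (- S)" using dpred_not[OF assms] by simp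
  from finite_boundary[OF this] finite_boundary[OF assms]
  have "finite ({x \<in> S. \<not> loc (\<lambda>y. y \<in> S) x} \<union> {x \<in> - S. \<not> loc (\<lambda>y. y \<in> - S) x})" by blast
  then show ?thesis by (rule finite_subset[rotated]) (auto simp: bd_def)
qed

lemma decided_off_bd:
  assumes "udef L A S" "\<And>x y z. x \<in> I \<Longrightarrow> z \<in> I \<Longrightarrow> x \<le> y \<Longrightarrow> y \<le> z \<Longrightarrow> y \<in> I" "I \<inter> bd S = {}" "x \<in> I" "x \<in> S"
  shows "I \<subseteq> S"
proof
  fix y assume "y \<in> I"
  then show "y \<in> S"
    using locally_decided_constant[OF assms(1), of I x y] assms(2-) unfolding bd_def by blast
qed

end

context pregeo
begin

lemma bd_subset_dcl: "udef L A S \<Longrightarrow> bd S \<subseteq> dcl A"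
  using finite_udef_subset_dcl udef_bd finite_bd by blast

text \<open>Neither divisibility nor commutativity is available, so there is no midpoint to write
  down. The set \<open>T\<close> of points at least as close to \<open>l\<close> as to
  \<open>r\<close> takes its place: both \<open>T\<close> and its complement meet the interval, so
  \<open>T\<close> has a boundary point inside it, and boundary points are definable.\<close>

lemma dcl_between:
  assumes lr: "l < r" "l \<in> dcl A" "r \<in> dcl A" shows "\<exists>m\<in>dcl A. l < m \<and> m < r"
proof -
  define T where "T = {x. \<exists>u v. (l + u = x \<and> x + v = r) \<and> \<not> v < u}"
  have "udef L (A \<union> {l, r}) T" unfolding T_def mem_Collect_eq
    by (rule dpred_ex[where k = 1 and j = 0], rule dpred_ex[where k = 2 and j = 0],
        intro dpred_conj dpred_not dpred_add dpred_less sterm_var sterm_const) auto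
  then have T: "udef L A T" by (rule dpred_dcl_elim) (use lr in auto)
  have iff: "x \<in> T \<longleftrightarrow> - l + x \<le> - x + r" for x
  proof -
    have "l + u = x \<longleftrightarrow> u = - l + x" "x + v = r \<longleftrightarrow> v = - x + r" for u v
      by (auto simp: add.assoc[symmetric])
    then show ?thesis unfolding T_def by (auto simp: not_less)
  qed
  have up: "- l + x < - l + y" "- y + r < - x + r" if "x < y" for x y
  proof -
    show "- l + x < - l + y" using that by (rule add_left_strict_mono_group)
    have "- y + (x + (- x + r)) < - y + (y + (- x + r))"
      by (intro add_left_strict_mono_group add_right_strict_mono_group that)
    then show "- y + r < - x + r" by simp
  qed
  obtain z where z: "l < z" "z < r" using dense_order[OF lr(1)] by blast
  define u where "u = - l + z"
  define v where "v = - z + r"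
  have uv: "u > 0" "v > 0" "l + u = z" "z + v = r"
    using add_left_strict_mono_group[OF z(1), of "- l"] add_left_strict_mono_group[OF z(2), of "- z"]
    by (auto simp: u_def v_def add.assoc[symmetric])
  \<comment> \<open>\<open>w\<close> mirrors \<open>z\<close>: its distance from \<open>l\<close> is
    the distance from \<open>z\<close> to \<open>r\<close>. If the two distances at \<open>z\<close>
    differ, exactly one of \<open>z\<close> and \<open>w\<close> is in \<open>T\<close>.\<close>
  define w where "w = l + v"
  have w: "- l + w = v" "l < w" "w < r"
  proof -
    show "- l + w = v" by (simp add: w_def add.assoc[symmetric])
    show "l < w" using add_left_strict_mono_group[OF uv(2), of l] by (simp add: w_def)
    have "l + (0 + v) < l + (u + v)" by (intro add_left_strict_mono_group add_right_strict_mono_group uv)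
    then show "w < r" using uv by (simp add: w_def add.assoc[symmetric])
  qed
  have "\<exists>p q. l < p \<and> p < r \<and> l < q \<and> q < r \<and> p \<in> T \<and> q \<notin> T"
  proof (cases u v rule: linorder_cases)
    case less
    then have "l + u < l + v" by (rule add_left_strict_mono_group)
    then have "z < w" using uv by (simp add: w_def)
    then have "w \<notin> T" using up(2)[of z w] w(1) by (simp add: iff v_def)
    moreover have "z \<in> T" using less by (simp add: iff u_def v_def)
    ultimately show ?thesis using z w by blast
  next
    case equal
    obtain y where y: "z < y" "y < r" using dense_order[OF z(2)] by blast
    have "y \<notin> T" using up[OF y(1)] equal unfolding iff u_def v_def by order
    moreover have "z \<in> T" using equal by (simp add: iff u_def v_def)
    moreover have "l < y" using z y by order
    ultimately show ?thesis using z y by blast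
  next
    case greater
    then have "l + v < l + u" by (rule add_left_strict_mono_group)
    then have "w < z" using uv by (simp add: w_def)
    then have "w \<in> T" using up(2)[of w z] w(1) by (simp add: iff v_def)
    moreover have "z \<notin> T" using greater by (simp add: iff u_def v_def)
    ultimately show ?thesis using z w by blast
  qed
  then obtain p q where pq: "l < p" "p < r" "l < q" "q < r" "p \<in> T" "q \<notin> T" by blast
  have "{l<..<r} \<inter> bd T \<noteq> {}"
  proof
    assume "{l<..<r} \<inter> bd T = {}"
    then have "{l<..<r} \<subseteq> T" by (rule decided_off_bd[OF T, rotated]) (use pq in auto)
    then show False using pq by auto
  qed
  then show ?thesis using bd_subset_dcl[OF T] by auto
qed

lemma dcl_add: assumes "a \<in> dcl A" "b \<in> dcl A" shows "a + b \<in> dcl A"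
proof -
  have "udef L (A \<union> {a, b}) {a + b}"
    by (rule dpred_cong[of M L _ "\<lambda>E. a + b = E 0 0"], intro dpred_add sterm_var sterm_const) auto
  then have "udef L A {a + b}" by (rule dpred_dcl_elim) (use assms in auto)
  then show ?thesis by (simp add: dcl_def)
qed

lemma dcl_diff: assumes "a \<in> dcl A" "b \<in> dcl A" shows "a - b \<in> dcl A"
proof -
  have "dpred M L (A \<union> {a, b}) (\<lambda>E. E 0 0 + b = a)" by (intro dpred_add sterm_var sterm_const) auto
  then have "udef L (A \<union> {a, b}) {a - b}" by (rule dpred_cong) (auto simp: eq_diff_eq)
  then have "udef L A {a - b}" by (rule dpred_dcl_elim) (use assms in auto)
  then show ?thesis by (simp add: dcl_def)
qed

text \<open>Definable choice in one variable. Either some boundary point is in \<open>S\<close>, or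
  \<open>S\<close> contains a whole interval between neighbouring boundary points. A bounded
  interval is met by \<open>dcl_between\<close>; on a ray the positive element \<open>c\<close>
  gives the step away from the endpoint, and on the full line \<open>c\<close> itself will
  do.\<close>

lemma dcl_meets:
  assumes S: "udef L A S" "S \<noteq> {}" and c: "c \<in> dcl A" "c > 0" shows "\<exists>a\<in>S. a \<in> dcl A"
proof -
  obtain x where x: "x \<in> S" using S(2) by blast
  have fin: "finite (bd S)" and E: "bd S \<subseteq> dcl A" using finite_bd[OF S(1)] bd_subset_dcl[OF S(1)] by auto
  show ?thesis
  proof (cases "x \<in> bd S")
    case True then show ?thesis using x E by blast
  next
    case xb: False
    let ?D = "{e \<in> bd S. e < x}" and ?U = "{e \<in> bd S. x < e}"
    have fD: "finite ?D" "finite ?U" using fin by auto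
    have lo: "Max ?D \<in> ?D" "e \<in> bd S \<Longrightarrow> e < x \<Longrightarrow> e \<le> Max ?D" if "?D \<noteq> {}" for e
      using Max_in[OF fD(1) that] Max_ge[OF fD(1), of e] by auto
    have hi: "Min ?U \<in> ?U" "e \<in> bd S \<Longrightarrow> x < e \<Longrightarrow> Min ?U \<le> e" if "?U \<noteq> {}" for e
      using Min_in[OF fD(2) that] Min_le[OF fD(2), of e] by auto
    have xe: "e < x \<or> x < e" if "e \<in> bd S" for e using that xb by (metis linorder_neqE)
    consider "?D \<noteq> {}" "?U \<noteq> {}" | "?D \<noteq> {}" "?U = {}" | "?D = {}" "?U \<noteq> {}" | "?D = {}" "?U = {}" by blast
    then show ?thesis
    proof cases
      case 1
      have "{Max ?D<..<Min ?U} \<inter> bd S = {}" using lo(2)[OF 1(1)] hi(2)[OF 1(2)] xe by (fastforce simp: not_less)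
      then have "{Max ?D<..<Min ?U} \<subseteq> S"
        by (rule decided_off_bd[OF S(1), rotated]) (use lo(1)[OF 1(1)] hi(1)[OF 1(2)] x in auto)
      moreover have "Max ?D < Min ?U" using lo(1)[OF 1(1)] hi(1)[OF 1(2)] by auto
      then have "\<exists>m\<in>dcl A. Max ?D < m \<and> m < Min ?U"
        by (rule dcl_between) (use lo(1)[OF 1(1)] hi(1)[OF 1(2)] E in auto)
      ultimately show ?thesis by auto
    next
      case 2
      have "{Max ?D<..} \<inter> bd S = {}" using lo(2)[OF 2(1)] 2(2) xe by (fastforce simp: not_less)
      then have "{Max ?D<..} \<subseteq> S"
        by (rule decided_off_bd[OF S(1), rotated]) (use lo(1)[OF 2(1)] x in auto)
      moreover have "Max ?D < Max ?D + c" using add_left_strict_mono_group[OF c(2), of "Max ?D"] by simp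
      moreover have "Max ?D + c \<in> dcl A" by (rule dcl_add) (use lo(1)[OF 2(1)] E c in auto)
      ultimately show ?thesis by auto
    next
      case 3
      have "{..<Min ?U} \<inter> bd S = {}" using hi(2)[OF 3(2)] 3(1) xe by (fastforce simp: not_less)
      then have "{..<Min ?U} \<subseteq> S"
        by (rule decided_off_bd[OF S(1), rotated]) (use hi(1)[OF 3(2)] x in auto)
      moreover have "Min ?U - c < Min ?U" using add_left_strict_mono_group[OF c(2), of "Min ?U - c"] by simp
      moreover have "Min ?U - c \<in> dcl A" by (rule dcl_diff) (use hi(1)[OF 3(2)] E c in auto)
      ultimately show ?thesis by auto
    next
      case 4
      then have "UNIV \<inter> bd S = {}" using xe by blast
      then have "UNIV \<subseteq> S" by (rule decided_off_bd[OF S(1), rotated]) (use x in auto)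
      then show ?thesis using c(1) by auto
    qed
  qed
qed

lemma dcl_meets_tuple:
  assumes "dset M L A k D" "D \<noteq> {}" "c \<in> dcl A" "c > 0" shows "\<exists>x\<in>D. set x \<subseteq> dcl A"
  using assms(1-3)
proof (induction k arbitrary: A D)
  case 0
  then have "[] \<in> D" by (auto simp: dset_def)
  then show ?case by (intro bexI[of _ "[]"]) auto
next
  case (Suc k)
  have len: "length z = Suc k" if "z \<in> D" for z using Suc.prems(1) that by (simp add: dset_def)
  let ?S = "{a. \<exists>y. length y = k \<and> a # y \<in> D}"
  have uS: "udef L A ?S" unfolding mem_Collect_eq
    by (rule dpred_ex_tuple[where k = 1], intro dpred_mem[OF Suc.prems(1)] tterm_Cons sterm_var tterm_tup) simp
  have "?S \<noteq> {}" using Suc.prems(2) len by (auto simp: length_Suc_conv)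
  from dcl_meets[OF uS this Suc.prems(3) assms(4)] obtain a where a: "a \<in> ?S" "a \<in> dcl A" by blast
  let ?D = "{y. length y = k \<and> a # y \<in> D}"
  have "dset M L (insert a A) (Suc k) D" by (rule dset_mono[OF Suc.prems(1)]) auto
  then have "dpred M L (insert a A) (\<lambda>E. a # tup k (E 0) \<in> D)"
    by (rule dpred_mem) (intro tterm_Cons sterm_const tterm_tup, simp)
  then have dD: "dset M L (insert a A) k ?D" by (rule dsetI)
  have ca: "c \<in> dcl (insert a A)" using Suc.prems(3) dcl_mono[of A "insert a A"] by blast
  have "?D \<noteq> {}" using a(1) by blast
  from Suc.IH[OF dD this ca] obtain y where y: "y \<in> ?D" "set y \<subseteq> dcl (insert a A)" by blast
  have "dcl (insert a A) \<subseteq> dcl A" using dcl_subset[of "insert a A" A] a(2) subset_dcl[of A] by blast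
  then show ?case using y a by (intro bexI[of _ "a # y"]) auto
qed

end

section \<open>Dimension\<close>

lemma openin_tuple_topology:
  "openin (tuple_topology k) S \<longleftrightarrow>
     (\<exists>B. openin (product_topology (\<lambda>_. euclidean) {..<k}) B \<and> S = {xs. length xs = k \<and> (\<lambda>i\<in>{..<k}. xs ! i) \<in> B})"
  unfolding tuple_topology_def openin_pullback_topology by (auto simp: vimage_def Int_def conj_commute)

lemma openin_tbox:
  fixes cs ds :: "'a::linorder_topology list"
  assumes "length cs = k" shows "openin (tuple_topology k) (tbox cs ds)"
proof -
  let ?B = "\<Pi>\<^sub>E i\<in>{..<k}. {cs ! i<..<ds ! i}"
  have "openin (product_topology (\<lambda>_. euclidean) {..<k}) ?B"
    by (simp add: openin_PiE_gen)
  moreover have "tbox cs ds = {xs. length xs = k \<and> (\<lambda>i\<in>{..<k}. xs ! i) \<in> ?B}"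
    using assms unfolding tbox_def by (auto simp: PiE_iff)
  ultimately show ?thesis unfolding openin_tuple_topology by blast
qed

context omin
begin

lemma open_interval_around:
  fixes x :: 'a assumes "open S" "x \<in> S" shows "\<exists>a b. a < x \<and> x < b \<and> {a<..<b} \<subseteq> S"
proof -
  obtain p where "p < x" using ex_lt by blast
  then obtain a where a: "a < x" "{a<..x} \<subseteq> S" using open_left[OF assms] by blast
  obtain q where "x < q" using ex_gt by blast
  then obtain b where b: "x < b" "{x..<b} \<subseteq> S" using open_right[OF assms] by blast
  have "{a<..<b} \<subseteq> {a<..x} \<union> {x..<b}" by auto
  then show ?thesis using a b by blast
qed

lemma tbox_in_open:
  assumes W: "openin (tuple_topology k) W" "(x::'a list) \<in> W"
  shows "\<exists>cs ds. length cs = k \<and> length ds = k \<and> x \<in> tbox cs ds \<and> tbox cs ds \<subseteq> W"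
proof -
  obtain B where B: "openin (product_topology (\<lambda>_. euclidean) {..<k}) B"
    "W = {xs. length xs = k \<and> (\<lambda>i\<in>{..<k}. xs ! i) \<in> B}"
    using W(1) unfolding openin_tuple_topology by blast
  have xB: "(\<lambda>i\<in>{..<k}. x ! i) \<in> B" "length x = k" using W(2) B(2) by auto
  from B(1)[unfolded openin_product_topology_alt, rule_format, OF xB(1)]
  obtain V where V: "\<forall>i\<in>{..<k}. openin euclidean (V i)" "(\<lambda>i\<in>{..<k}. x ! i) \<in> Pi\<^sub>E {..<k} V" "Pi\<^sub>E {..<k} V \<subseteq> B"
    by (elim exE conjE)
  have "\<forall>i\<in>{..<k}. \<exists>ab. fst ab < x ! i \<and> x ! i < snd ab \<and> {fst ab<..<snd ab} \<subseteq> V i"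
  proof
    fix i assume i: "i \<in> {..<k}"
    then have "x ! i \<in> V i" using V(2) by (auto simp: PiE_iff)
    moreover have "open (V i)" using V(1) i by (intro iffD2[OF open_openin]) blast
    ultimately obtain a b where "a < x ! i" "x ! i < b" "{a<..<b} \<subseteq> V i" using open_interval_around by blast
    then show "\<exists>ab. fst ab < x ! i \<and> x ! i < snd ab \<and> {fst ab<..<snd ab} \<subseteq> V i" by (intro exI[of _ "(a, b)"]) auto
  qed
  from bchoice[OF this] obtain ab where ab: "\<forall>i\<in>{..<k}. fst (ab i) < x ! i \<and> x ! i < snd (ab i) \<and> {fst (ab i)<..<snd (ab i)} \<subseteq> V i"
    by blast
  let ?cs = "map (\<lambda>i. fst (ab i)) [0..<k]" and ?ds = "map (\<lambda>i. snd (ab i)) [0..<k]"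
  have "x \<in> tbox ?cs ?ds" using ab xB(2) by (auto simp: tbox_def)
  moreover have "tbox ?cs ?ds \<subseteq> W"
  proof
    fix y assume "y \<in> tbox ?cs ?ds"
    then have y: "length y = k" "\<And>i. i < k \<Longrightarrow> fst (ab i) < y ! i \<and> y ! i < snd (ab i)" by (auto simp: tbox_def)
    then have "(\<lambda>i\<in>{..<k}. y ! i) \<in> Pi\<^sub>E {..<k} V" using ab by (auto simp: PiE_iff subset_iff)
    then show "y \<in> W" using V(3) B(2) y(1) by blast
  qed
  ultimately show ?thesis by (intro exI[of _ ?cs] exI[of _ ?ds]) auto
qed

lemma sorted_wrt_less_length:
  assumes "sorted_wrt (<) js" "set js \<subseteq> {..<n::nat}" shows "length js \<le> n" "length js = n \<Longrightarrow> js = [0..<n]"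
proof -
  have d: "sorted js" "distinct js" using assms(1) by (simp_all add: strict_sorted_iff)
  have c: "length js = card (set js)" using d by (simp add: distinct_card)
  show "length js \<le> n" unfolding c using card_mono[OF _ assms(2)] by simp
  assume "length js = n"
  then have "set js = {..<n}" using card_subset_eq[OF _ assms(2)] c by simp
  then have eq: "set js = set [0..<n]" unfolding atLeast_upt .
  show "js = [0..<n]" by (rule sorted_distinct_set_unique[OF d _ _ eq]) simp_all
qed

text \<open>The numbers whose maximum is taken are at most \<open>n\<close>, and for nonempty
  \<open>X\<close> the empty projection contributes 0, so \<open>Max\<close> has its intended
  meaning.\<close>

lemma def_dim_bounds:
  fixes X :: "'a list set"
  shows "sorted_wrt (<) js \<Longrightarrow> set js \<subseteq> {..<n} \<Longrightarrow> x \<in> tbox cs ds \<Longrightarrow> tbox cs ds \<subseteq> (\<lambda>x. map ((!) x) js) ` X \<Longrightarrow>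
      length cs = length js \<Longrightarrow> length js \<le> def_dim n X"
    and "X \<noteq> {} \<Longrightarrow> def_dim n X \<le> n"
proof -
  let ?S = "{k. \<exists>js. length js = k \<and> sorted_wrt (<) js \<and> set js \<subseteq> {..<n} \<and>
               tuple_topology k interior_of ((\<lambda>x. map ((!) x) js) ` X) \<noteq> {}}"
  have sub: "?S \<subseteq> {..n}" using sorted_wrt_less_length(1) by auto
  then have fin: "finite ?S" using finite_subset by blast
  have in_S: "length js \<in> ?S" if "sorted_wrt (<) js" "set js \<subseteq> {..<n}" "x \<in> tbox cs ds"
      "tbox cs ds \<subseteq> (\<lambda>x. map ((!) x) js) ` X" "length cs = length js" for js cs ds x
  proof -
    have "tbox cs ds \<subseteq> tuple_topology (length js) interior_of ((\<lambda>x. map ((!) x) js) ` X)"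
      by (rule interior_of_maximal[OF that(4) openin_tbox[OF that(5)]])
    then show ?thesis using that by blast
  qed
  then show "sorted_wrt (<) js \<Longrightarrow> set js \<subseteq> {..<n} \<Longrightarrow> x \<in> tbox cs ds \<Longrightarrow> tbox cs ds \<subseteq> (\<lambda>x. map ((!) x) js) ` X \<Longrightarrow>
      length cs = length js \<Longrightarrow> length js \<le> def_dim n X"
    unfolding def_dim_def using Max_ge[OF fin] by blast
  assume "X \<noteq> {}"
  then have "tbox [] [] \<subseteq> (\<lambda>x. map ((!) x) []) ` X" "[] \<in> tbox [] ([]::'a list)" by (auto simp: tbox_def)
  then have "length ([]::nat list) \<in> ?S" using in_S[of "[]" "[]" "[]" "[]"] by simp
  then have "?S \<noteq> {}" by blast
  then have "Max ?S \<in> ?S" by (rule Max_in[OF fin])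
  then show "def_dim n X \<le> n" unfolding def_dim_def using sub by blast
qed

lemma def_dim_le_vdim:
  assumes "definable M n X" "X \<subseteq> C" "X \<noteq> {}" shows "def_dim n X \<le> vdim M n C"
proof -
  have "{def_dim n X |X. definable M n X \<and> X \<subseteq> C \<and> X \<noteq> {}} \<subseteq> {..n}" using def_dim_bounds(2) by auto
  then have "finite {def_dim n X |X. definable M n X \<and> X \<subseteq> C \<and> X \<noteq> {}}" using finite_subset by blast
  then show ?thesis unfolding vdim_def by (rule Max_ge) (use assms in auto)
qed

lemma vdim_mono:
  assumes "definable M n X" "X \<subseteq> C" "X \<noteq> {}" shows "vdim M n X \<le> vdim M n C"
proof -
  let ?S = "{def_dim n Z |Z. definable M n Z \<and> Z \<subseteq> X \<and> Z \<noteq> {}}"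
  have "?S \<subseteq> {..n}" using def_dim_bounds(2) by auto
  then have fin: "finite ?S" using finite_subset by blast
  have "?S \<noteq> {}" using assms by blast
  then have "Max ?S \<in> ?S" by (rule Max_in[OF fin])
  then obtain Z where "Max ?S = def_dim n Z" "definable M n Z" "Z \<subseteq> X" "Z \<noteq> {}" by blast
  then show ?thesis unfolding vdim_def[of M n X] using def_dim_le_vdim[of n Z C] assms(2) by auto
qed

end

lemma tterm_map_nth: "tterm A n t \<Longrightarrow> set js \<subseteq> {..<n} \<Longrightarrow> tterm A (length js) (\<lambda>E. map ((!) (t E)) js)"
proof (induction js)
  case (Cons j js)
  then have "tterm A (Suc (length js)) (\<lambda>E. t E ! j # map ((!) (t E)) js)"
    by (intro tterm_Cons tterm_nth) auto
  then show ?case by simp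
qed (simp add: tterm_Nil)

lemma finite_family_dset:
  assumes "finite I" "\<And>i. i \<in> I \<Longrightarrow> definable M (k i) (D i)"
  obtains F R A where "finite F" "finite R" "finite A" "\<forall>i\<in>I. dset M (F, R) A (k i) (D i)"
proof -
  have "\<exists>F R A. finite F \<and> finite R \<and> finite A \<and> (\<forall>i\<in>I. dset M (F, R) A (k i) (D i))" using assms
  proof (induction I rule: finite_induct)
    case (insert j I)
    then obtain F R A where 1: "finite F" "finite R" "finite A" "\<forall>i\<in>I. dset M (F, R) A (k i) (D i)" by auto
    obtain F' R' A' where 2: "finite F'" "finite R'" "finite A'" "dset M (F', R') A' (k j) (D j)"
      by (rule definable_imp_dset[OF insert.prems[of j]]) auto
    have "dset M (F \<union> F', R \<union> R') (A \<union> A') (k i) (D i)" if "i \<in> insert j I" for i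
    proof (cases "i = j")
      case True show ?thesis unfolding True by (rule dset_mono[OF 2(4)]) auto
    next
      case False
      then have "dset M (F, R) A (k i) (D i)" using that 1(4) by auto
      then show ?thesis by (rule dset_mono) auto
    qed
    then show ?case using 1(1-3) 2(1-3)
      by (intro exI[of _ "F \<union> F'"] exI[of _ "R \<union> R'"] exI[of _ "A \<union> A'"]) auto
  qed auto
  then show thesis using that by blast
qed

context pregeo
begin

text \<open>Quantifying away the other coordinates defines each coordinate of the only
  solution.\<close>

lemma dcl_unique_tuple:
  assumes Q: "dpred M L A (\<lambda>E. Q (tup m (E 0)))" and z: "length z = m" "Q z" "\<And>z'. length z' = m \<Longrightarrow> Q z' \<Longrightarrow> z' = z"
  shows "set z \<subseteq> dcl A"
proof
  fix a assume "a \<in> set z"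
  then obtain i where i: "i < m" "a = z ! i" using z(1) by (auto simp: in_set_conv_nth)
  have D: "dset M L A m {z. length z = m \<and> Q z}" by (rule dsetI[OF Q])
  have "dpred M L A (\<lambda>E. \<exists>z'. length z' = m \<and> (z' \<in> {z. length z = m \<and> Q z} \<and> z' ! i = E 0 0))"
    by (rule dpred_ex_tuple[where k = 1], intro dpred_conj dpred_mem[OF D tterm_tup] dpred_eq[OF tterm_nth[OF tterm_tup i(1)] sterm_var]) simp
  then have "udef L A {a}"
  proof (rule dpred_cong)
    fix E :: "nat \<Rightarrow> nat \<Rightarrow> 'a"
    show "(\<exists>z'. length z' = m \<and> (z' \<in> {z. length z = m \<and> Q z} \<and> z' ! i = E 0 0)) = (E 0 0 \<in> {a})"
    proof
      assume "\<exists>z'. length z' = m \<and> (z' \<in> {z. length z = m \<and> Q z} \<and> z' ! i = E 0 0)"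
      then obtain z' where z': "length z' = m" "Q z'" "z' ! i = E 0 0" by blast
      show "E 0 0 \<in> {a}" using z(3)[OF z'(1,2)] z'(3) i(2) by simp
    next
      assume "E 0 0 \<in> {a}"
      then show "\<exists>z'. length z' = m \<and> (z' \<in> {z. length z = m \<and> Q z} \<and> z' ! i = E 0 0)"
        using z(1,2) i(2) by (intro exI[of _ z]) simp
    qed
  qed
  then show "a \<in> dcl A" by (simp add: dcl_def)
qed

text \<open>Projecting to the coordinates of a basis of \<open>x\<close> sends \<open>x\<close> to a
  generic tuple of the image, so the image has interior and the basis is no longer than the
  dimension.\<close>

lemma rank_le_def_dim:
  assumes Z: "dset M L A n Z" "x \<in> Z" and "countable A"
  shows "\<exists>S. finite S \<and> card S \<le> def_dim n Z \<and> set x \<subseteq> dcl (A \<union> S)"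
proof -
  have len: "length z = n" if "z \<in> Z" for z using Z(1) that by (simp add: dset_def)
  obtain js where js: "sorted_wrt (<) js" "set js \<subseteq> {..<length x}" "indep A (map ((!) x) js)"
    "set x \<subseteq> dcl (A \<union> set (map ((!) x) js))" using exists_basis by blast
  have jn: "set js \<subseteq> {..<n}" using js(2) len[OF Z(2)] by simp
  let ?D = "(\<lambda>x. map ((!) x) js) ` Z"
  let ?k = "length js"
  have "dpred M L A (\<lambda>E. \<exists>z. length z = n \<and> (z \<in> Z \<and> map ((!) z) js = tup ?k (E 0)))"
    by (rule dpred_ex_tuple[where k = 1], intro dpred_conj dpred_mem[OF Z(1) tterm_tup] dpred_eq_tuple[OF tterm_map_nth[OF tterm_tup jn] tterm_tup]) simp
  then have "dset M L A ?k {y. length y = ?k \<and> (\<exists>z. length z = n \<and> (z \<in> Z \<and> map ((!) z) js = y))}"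
    by (rule dsetI)
  moreover have "{y. length y = ?k \<and> (\<exists>z. length z = n \<and> (z \<in> Z \<and> map ((!) z) js = y))} = ?D" using len by auto
  ultimately have D: "dset M L A (length (map ((!) x) js)) ?D" by simp
  have "map ((!) x) js \<in> ?D" using Z(2) by blast
  from generic_tuple_interior[OF js(3) D this assms(3)] obtain cs ds where
    "length cs = ?k" "map ((!) x) js \<in> tbox cs ds" "tbox cs ds \<subseteq> ?D" by auto
  then have "?k \<le> def_dim n Z" using def_dim_bounds(1)[OF js(1) jn] by blast
  moreover have "card (set (map ((!) x) js)) \<le> ?k" using card_length[of "map ((!) x) js"] by simp
  ultimately show ?thesis using js(4) by (intro exI[of _ "set (map ((!) x) js)"]) auto
qed

text \<open>A basis of full length uses every coordinate, so \<open>z\<close> itself is independent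
  over \<open>A\<close> and has a box around it inside \<open>C\<close>.\<close>

lemma full_rank_interior:
  assumes C: "dset M L A d C" "z \<in> C" and "countable A"
    and full: "\<And>S. finite S \<Longrightarrow> set z \<subseteq> dcl (A \<union> S) \<Longrightarrow> d \<le> card S"
  shows "\<exists>cs ds. length cs = d \<and> length ds = d \<and> z \<in> tbox cs ds \<and> tbox cs ds \<subseteq> C"
proof -
  have len: "length z = d" using C by (simp add: dset_def)
  obtain js where js: "sorted_wrt (<) js" "set js \<subseteq> {..<length z}" "indep A (map ((!) z) js)"
    "set z \<subseteq> dcl (A \<union> set (map ((!) z) js))" using exists_basis by blast
  have "d \<le> card (set (map ((!) z) js))" by (rule full[OF _ js(4)]) simp
  also have "\<dots> \<le> length js" using card_length[of "map ((!) z) js"] by simp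
  finally have "length js = d" using sorted_wrt_less_length(1)[OF js(1,2)] len by simp
  then have "js = [0..<d]" using sorted_wrt_less_length(2)[OF js(1,2)] len by simp
  then have "map ((!) z) js = z" using len map_nth[of z] by simp
  then show ?thesis using generic_tuple_interior[of A z C] js(3) C len assms(3) by simp
qed

end

section \<open>Covering the quotient by translates of charts\<close>

locale vtop = vlattice U \<kappa> M n N Y + omin \<kappa> M
  for U :: "'a::linordered_group_add list monoid" (structure) and \<kappa> :: "'k rel"
    and M :: "('a, 'f, 'r) interp" and n :: nat and N Y :: "'a list set" +
  fixes T :: "'a list topology"
  assumes canonical: "canonical_group_topology \<kappa> M n U T"
begin

definition d :: nat where "d = vdim M n (carrier U)"

definition chart :: "'a list set \<Rightarrow> ('a list \<Rightarrow> 'a list) \<Rightarrow> 'a list set \<Rightarrow> bool" where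
  "chart V f W \<longleftrightarrow> dsub V \<and> openin T V \<and> definable_fun M n d V f \<and> openin (tuple_topology d) W \<and>
     homeomorphic_map (subtopology T V) (subtopology (tuple_topology d) W) f"

lemma topspace_T: "topspace T = carrier U"
  and cont_mult: "continuous_map (prod_topology T T) T (\<lambda>(x, y). x \<otimes> y)"
  and cont_inv: "continuous_map T T (\<lambda>x. inv x)"
  using canonical unfolding canonical_group_topology_def by auto

lemma charts: "\<exists>\<V>. small \<kappa> \<V> \<and> \<Union>\<V> = carrier U \<and> (\<forall>V\<in>\<V>. \<exists>f W. chart V f W)"
proof -
  obtain \<V> where V: "small \<kappa> \<V>" "\<Union>\<V> = carrier U" "\<forall>V\<in>\<V>. definable M n V \<and> openin T V \<and>
      (\<exists>f W. definable_fun M n d V f \<and> openin (tuple_topology d) W \<and>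
        homeomorphic_map (subtopology T V) (subtopology (tuple_topology d) W) f)"
    using canonical unfolding canonical_group_topology_def Let_def d_def by blast
  then have "\<exists>f W. chart V f W" if "V \<in> \<V>" for V
    using that unfolding chart_def dsub_def by blast
  then show ?thesis using V(1,2) by blast
qed

lemma finite_charts:
  assumes "dsub Z" shows "\<exists>\<V>. finite \<V> \<and> Z \<subseteq> \<Union>\<V> \<and> (\<forall>V\<in>\<V>. \<exists>f W. chart V f W)"
proof -
  obtain \<V> where V: "small \<kappa> \<V>" "\<Union>\<V> = carrier U" "\<forall>V\<in>\<V>. \<exists>f W. chart V f W" using charts by blast
  obtain \<F> where "\<F> \<subseteq> \<V>" "finite \<F>" "Z \<subseteq> \<Union>\<F>"
  proof (rule definable_finite_cover[OF suff_sat, of n Z \<V>])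
    show "definable M n D" if "D \<in> \<V>" for D using V(3) that unfolding chart_def dsub_def by blast
  qed (use assms V in \<open>auto simp: dsub_def\<close>)
  then show ?thesis using V(3) by (intro exI[of _ \<F>]) auto
qed

lemma chart_facts:
  assumes "chart V f W"
  shows "V \<subseteq> carrier U" "f ` V = W" "inj_on f V" "\<And>x. x \<in> V \<Longrightarrow> length (f x) = d"
    "definable M (n + d) {x @ f x |x. x \<in> V}" "\<And>x. x \<in> V \<Longrightarrow> length x = n"
proof -
  show V: "V \<subseteq> carrier U" using assms unfolding chart_def dsub_def by blast
  then have tV: "topspace (subtopology T V) = V" using topspace_T by auto
  have "W \<subseteq> topspace (tuple_topology d)" using assms openin_subset unfolding chart_def by blast
  then have tW: "topspace (subtopology (tuple_topology d) W) = W" by auto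
  have h: "homeomorphic_map (subtopology T V) (subtopology (tuple_topology d) W) f"
    using assms unfolding chart_def by blast
  show "f ` V = W" using homeomorphic_imp_surjective_map[OF h] tV tW by simp
  show "inj_on f V" using homeomorphic_imp_injective_map[OF h] tV by simp
  show "\<And>x. x \<in> V \<Longrightarrow> length (f x) = d" "definable M (n + d) {x @ f x |x. x \<in> V}"
    using assms unfolding chart_def definable_fun_def by blast+
  show "\<And>x. x \<in> V \<Longrightarrow> length x = n" using V length_carrier by blast
qed

text \<open>The part of \<open>V \<inter> K\<close> lying in its interior, read off in the chart.
  Boxes in place of open sets make the definition first-order.\<close>

definition chart_core :: "'a list set \<Rightarrow> ('a list \<Rightarrow> 'a list) \<Rightarrow> 'a list set" where
  "chart_core V f = {x \<in> V \<inter> K. \<exists>cs ds. length cs = d \<and> length ds = d \<and> f x \<in> tbox cs ds \<and> tbox cs ds \<subseteq> f ` (V \<inter> K)}"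

end

lemma (in pregeo) choose_indep_tuples:
  assumes "\<And>i. i < d \<Longrightarrow> cs ! i < ds ! i" "length cs = d" "length ds = d" "countable A"
  shows "\<exists>ws. length ws = m \<and> (\<forall>w\<in>set ws. w \<in> tbox cs ds) \<and> indep A (concat ws)"
proof (induction m)
  case (Suc m)
  then obtain ws where ws: "length ws = m" "\<forall>w\<in>set ws. w \<in> tbox cs ds" "indep A (concat ws)" by blast
  have 1: "fst p < snd p" if p: "p \<in> set (zip cs ds)" for p 
  proof -
    obtain i where "i < d" "p = (cs ! i, ds ! i)" using p assms(2,3) by (auto simp: set_zip)
    then show ?thesis using assms(1) by simp
  qed
  have 2: "countable (A \<union> set (concat ws))" by (intro countable_Un assms(4) countable_finite[OF finite_set])
  have "\<exists>w. length w = length (zip cs ds) \<and> (\<forall>i<length (zip cs ds). fst (zip cs ds ! i) < w ! i \<and>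
      w ! i < snd (zip cs ds ! i)) \<and> indep (A \<union> set (concat ws)) w"
    by (rule choose_indep[OF _ 2]) (rule 1)
  then obtain w where w: "length w = length (zip cs ds)"
    "\<forall>i<length (zip cs ds). fst (zip cs ds ! i) < w ! i \<and> w ! i < snd (zip cs ds ! i)" "indep (A \<union> set (concat ws)) w"
    by (elim exE conjE)
  have "w \<in> tbox cs ds" using w(1,2) assms(2,3) by (auto simp: tbox_def)
  then show ?case using ws w(3) by (intro exI[of _ "ws @ [w]"]) (auto simp: indep_append)
qed simp

context vtop
begin

text \<open>Take \<open>d + 1\<close> points of a box in a chart at the identity whose coordinates
  are jointly independent, and translate by the corresponding group elements \<open>g\<close>. If no
  translate of a core reaches \<open>x\<close>, each \<open>\<mu> (x - g)\<close> lies outside every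
  core and has rank below \<open>d\<close>; as \<open>g\<close> is recovered from \<open>x\<close>
  and this point, all the coordinates together have too small a rank.\<close>

lemma covering:
  obtains Gs \<C> where "finite Gs" "Gs \<subseteq> carrier U" "finite \<C>" "\<And>V f. (V, f) \<in> \<C> \<Longrightarrow> \<exists>W. chart V f W"
    "K \<subseteq> (\<Union>g\<in>Gs. \<Union>(V, f)\<in>\<C>. (\<lambda>x. \<mu> (g \<otimes> x)) ` chart_core V f)" "d \<le> def_dim n K"
proof -
  obtain \<V> where \<V>: "finite \<V>" "K \<subseteq> \<Union>\<V>" "\<forall>V\<in>\<V>. \<exists>f W. chart V f W" using finite_charts[OF dsub_K] by blast
  from bchoice[OF \<V>(3)] obtain fv where fv: "\<forall>V\<in>\<V>. \<exists>W. chart V (fv V) W" by blast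
  obtain V1 f1 W1 where ch1: "chart V1 f1 W1" and one1: "\<one> \<in> V1"
  proof -
    obtain \<V>' where v: "\<Union>\<V>' = carrier U" "\<forall>V\<in>\<V>'. \<exists>f W. chart V f W" using charts by blast
    then obtain V where "V \<in> \<V>'" "\<one> \<in> V" using one_closed by blast
    then show thesis using v(2) that by blast
  qed
  note c1 = chart_facts[OF ch1]
  have dV1: "dsub V1" using ch1 by (simp add: chart_def)
  have "f1 \<one> \<in> W1" using c1(2) one1 by blast
  moreover have "openin (tuple_topology d) W1" using ch1 by (simp add: chart_def)
  ultimately obtain cs ds where cd: "length cs = d" "length ds = d" "f1 \<one> \<in> tbox cs ds" "tbox cs ds \<subseteq> W1"
    using tbox_in_open by blast
  have lt: "cs ! i < ds ! i" if "i < d" for i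
  proof -
    have "cs ! i < f1 \<one> ! i" "f1 \<one> ! i < ds ! i" using cd(1,3) that by (auto simp: tbox_def)
    then show ?thesis by order
  qed
  \<comment> \<open>These are the lattice elements by which \<open>\<mu>\<close> can move a point of
    \<open>V1\<close>, or a difference of a point of \<open>K\<close> and a point of
    \<open>V1\<close>. By finiteness of lattice traces there are finitely many.\<close>
  define EE where "EE = (N \<inter> (V1 <#> m_inv U ` K)) \<union> (N \<inter> ((K <#> m_inv U ` V1) <#> m_inv U ` K))"
  have finEE: "finite EE" unfolding EE_def
    by (intro finite_UnI finN dsub_mult dsub_inv dV1 dsub_K)
  have EEN: "e \<in> N" "e \<in> carrier U" if "e \<in> EE" for e using that N_carrier by (auto simp: EE_def)
  \<comment> \<open>All factors of the products needed below are gathered in one definable set, so a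
    single graph \<open>G\<close> describes multiplication.\<close>
  define Q where "Q = K \<union> V1 \<union> (V1 <#> K) \<union> EE"
  have dQ: "dsub Q" unfolding Q_def
    using EEN by (intro dsub_Un dsub_mult dV1 dsub_K dsub_finite finEE) auto
  have Qc: "x \<in> carrier U" if "x \<in> Q" for x using dQ that by (auto simp: dsub_def)
  define G where "G = {x @ y @ (x \<otimes> y) |x y. x \<in> Q \<and> y \<in> Q}"
  have G: "definable M (n + n + n) G" using definable_mult_dsub[OF dQ dQ] unfolding definable_mult_def G_def .
  have G_iff: "a @ b @ c \<in> G \<longleftrightarrow> a \<in> Q \<and> b \<in> Q \<and> c = a \<otimes> b" if "length a = n" "length b = n" for a b c
  proof
    assume "a @ b @ c \<in> G"
    then obtain x y where xy: "x \<in> Q" "y \<in> Q" "a @ b @ c = x @ y @ (x \<otimes> y)" unfolding G_def by blast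
    moreover have "length x = n" "length y = n" using dsub_length[OF dQ] xy by auto
    ultimately show "a \<in> Q \<and> b \<in> Q \<and> c = a \<otimes> b" using that by simp
  next
    assume "a \<in> Q \<and> b \<in> Q \<and> c = a \<otimes> b" then show "a @ b @ c \<in> G" unfolding G_def by blast
  qed
  define gr where "gr V f = {x @ f x |x. x \<in> V}" for V and f :: "'a list \<Rightarrow> 'a list"
  define Fam where "Fam = {(n, K), (n + n + n, G), (n + d, gr V1 f1)} \<union> (\<lambda>V. (n + d, gr V (fv V))) ` \<V>"
  have "finite Fam" using \<V>(1) by (simp add: Fam_def)
  moreover have "definable M (fst i) (snd i)" if i: "i \<in> Fam" for i
  proof -
    have "definable M (n + d) (gr V (fv V))" if V: "V \<in> \<V>" for V
    proof -
      obtain W where "chart V (fv V) W" using fv V by blast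
      then show ?thesis unfolding gr_def by (rule chart_facts(5))
    qed
    moreover have "definable M (n + d) (gr V1 f1)" unfolding gr_def by (rule c1(5))
    moreover have "definable M n K" using dsub_K by (simp add: dsub_def)
    ultimately show ?thesis using i G unfolding Fam_def by auto
  qed
  ultimately obtain F R A0 where FRA: "finite F" "finite R" "finite A0" "\<forall>i\<in>Fam. dset M (F, R) A0 (fst i) (snd i)"
    by (rule finite_family_dset[where M = M and k = fst and D = snd])
  \<comment> \<open>The coordinates of the elements of \<open>EE\<close> become parameters, so
    applying \<open>\<mu>\<close> costs no rank.\<close>
  define A where "A = A0 \<union> \<Union> (set ` EE)"
  have finA: "finite A" using FRA(3) finEE by (auto simp: A_def)
  then have cA: "countable A" by (rule countable_finite)
  interpret P: pregeo \<kappa> M "(F, R)" by unfold_locales (use FRA in \<open>auto intro: countable_finite\<close>)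
  have up: "dset M (F, R) B k D" if "(k, D) \<in> Fam" "A \<subseteq> B" for k D B
    by (rule dset_mono[OF FRA(4)[rule_format, OF that(1), simplified]]) (use that(2) in \<open>auto simp: A_def\<close>)
  have EEA: "set e \<subseteq> A" if "e \<in> EE" for e using that by (auto simp: A_def)
  have dcl_step: "X \<subseteq> P.dcl (A \<union> S)" if "X \<subseteq> P.dcl (A \<union> B)" "B \<subseteq> P.dcl (A \<union> S)" for X B S
  proof -
    have "A \<union> B \<subseteq> P.dcl (A \<union> S)" using that(2) P.subset_dcl[of "A \<union> S"] by blast
    then show ?thesis using P.dcl_subset that(1) by blast
  qed
  have chart_dcl: "set (f x) \<subseteq> P.dcl (A \<union> set x)" "set x \<subseteq> P.dcl (A \<union> set (f x))"
    if V: "chart V f W" "(n + d, gr V f) \<in> Fam" "x \<in> V" for V f W x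
  proof -
    note cf = chart_facts[OF V(1)]
    have lx: "length x = n" "length (f x) = d" using cf V(3) by auto
    show "set (f x) \<subseteq> P.dcl (A \<union> set x)"
    proof (rule P.dcl_unique_tuple[where Q = "\<lambda>z. x @ z \<in> gr V f" and m = d])
      show "dpred M (F, R) (A \<union> set x) (\<lambda>E. x @ tup d (E 0) \<in> gr V f)"
        by (rule dpred_mem[OF up[OF V(2)]]) (auto intro!: tterm_append tterm_const tterm_tup lx)
      show "z' = f x" if z: "length z' = d" "x @ z' \<in> gr V f" for z'
      proof -
        obtain x' where x': "x' \<in> V" "x @ z' = x' @ f x'" using z(2) unfolding gr_def by blast
        then show ?thesis using lx cf(6)[OF x'(1)] by simp
      qed
    qed (use lx V(3) in \<open>auto simp: gr_def\<close>)
    show "set x \<subseteq> P.dcl (A \<union> set (f x))"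
    proof (rule P.dcl_unique_tuple[where Q = "\<lambda>z. z @ f x \<in> gr V f" and m = n])
      show "dpred M (F, R) (A \<union> set (f x)) (\<lambda>E. tup n (E 0) @ f x \<in> gr V f)"
        by (rule dpred_mem[OF up[OF V(2)]]) (auto intro!: tterm_append tterm_const tterm_tup lx)
      show "z' = x" if z: "length z' = n" "z' @ f x \<in> gr V f" for z'
      proof -
        obtain x' where x': "x' \<in> V" "z' @ f x = x' @ f x'" using z(2) unfolding gr_def by blast
        then have "z' = x'" "f x = f x'" using z(1) cf(6)[OF x'(1)] by auto
        then show ?thesis using inj_onD[OF cf(3)] V(3) x'(1) by metis
      qed
    qed (use lx V(3) in \<open>auto simp: gr_def\<close>)
  qed
  have KF: "(n, K) \<in> Fam" and GF: "(n + n + n, G) \<in> Fam" and F1: "(n + d, gr V1 f1) \<in> Fam"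
    by (auto simp: Fam_def)
  have prod_dcl: "set (k \<otimes> e) \<subseteq> P.dcl (A \<union> set k)" if "k \<in> Q" "e \<in> EE" for k e
  proof (rule P.dcl_unique_tuple[where Q = "\<lambda>z. k @ e @ z \<in> G" and m = n])
    have eQ: "e \<in> Q" using that(2) by (simp add: Q_def)
    have l: "length k = n" "length e = n" using Qc that(1) eQ length_carrier by auto
    show "dpred M (F, R) (A \<union> set k) (\<lambda>E. k @ e @ tup n (E 0) \<in> G)"
    proof (rule dpred_mem[OF up[OF GF]])
      have "tterm (A \<union> set k) (n + (n + n)) (\<lambda>E. k @ e @ tup n (E 0))"
        by (intro tterm_append tterm_const tterm_tup l) (use EEA[OF that(2)] in auto)
      then show "tterm (A \<union> set k) (n + n + n) (\<lambda>E. k @ e @ tup n (E 0))" by (simp add: add.assoc)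
    qed simp
    show "length (k \<otimes> e) = n" using Qc that(1) eQ length_carrier by auto
    show "k @ e @ k \<otimes> e \<in> G" "\<And>z'. k @ e @ z' \<in> G \<Longrightarrow> z' = k \<otimes> e" using G_iff[OF l] that(1) eQ by auto
  qed
  \<comment> \<open>Cancelling \<open>e\<close> and \<open>y\<close> recovers \<open>g\<close> from
    \<open>x\<close> and \<open>y\<close>. The existentially quantified \<open>s\<close> stands for
    the intermediate product \<open>g \<otimes> y\<close>.\<close>
  have quot_dcl: "set g \<subseteq> P.dcl (A \<union> (set x \<union> set y))"
    if g: "g \<in> V1" "y \<in> K" "e \<in> EE" "x \<in> K" "x = (g \<otimes> y) \<otimes> e" for g x y e
  proof (rule P.dcl_unique_tuple[where Q = "\<lambda>z. \<exists>s. length s = n \<and> (z @ y @ s \<in> G \<and> s @ e @ x \<in> G)" and m = n])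
    let ?B = "A \<union> (set x \<union> set y)"
    have gy: "g \<otimes> y \<in> V1 <#> K" using g unfolding set_mult_def by blast
    have inQ: "g \<in> Q" "y \<in> Q" "e \<in> Q" "x \<in> Q" "g \<otimes> y \<in> Q" using g gy by (auto simp: Q_def)
    have l: "length g = n" "length y = n" "length e = n" "length x = n" "length (g \<otimes> y) = n"
      using inQ Qc length_carrier by blast+
    have GB: "dset M (F, R) ?B (n + n + n) G" by (rule up[OF GF]) simp
    show "dpred M (F, R) ?B (\<lambda>E. \<exists>s. length s = n \<and> (tup n (E 0) @ y @ s \<in> G \<and> s @ e @ x \<in> G))"
    proof (rule dpred_ex_tuple[where k = 1], rule dpred_conj)
      have "tterm ?B (n + (n + n)) (\<lambda>E. tup n (E 0) @ y @ tup n (E 1))"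
        by (intro tterm_append tterm_const tterm_tup l) auto
      then show "dpred M (F, R) ?B (\<lambda>E. tup n (E 0) @ y @ tup n (E 1) \<in> G)"
        by (intro dpred_mem[OF GB]) (simp add: add.assoc)
      have "tterm ?B (n + (n + n)) (\<lambda>E. tup n (E 1) @ e @ x)"
        by (intro tterm_append tterm_const tterm_tup l) (use EEA[OF g(3)] in auto)
      then show "dpred M (F, R) ?B (\<lambda>E. tup n (E 1) @ e @ x \<in> G)"
        by (intro dpred_mem[OF GB]) (simp add: add.assoc)
    qed simp
    show "length g = n" by (rule l)
    show "\<exists>s. length s = n \<and> (g @ y @ s \<in> G \<and> s @ e @ x \<in> G)"
      using G_iff[OF l(1,2)] G_iff[OF l(5,3)] inQ g(5) l(5) by (intro exI[of _ "g \<otimes> y"]) simp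
    show "z' = g" if z: "length z' = n" "\<exists>s. length s = n \<and> (z' @ y @ s \<in> G \<and> s @ e @ x \<in> G)" for z'
    proof -
      obtain s where s: "length s = n" "z' @ y @ s \<in> G" "s @ e @ x \<in> G" using z(2) by blast
      have "z' \<in> Q" "s = z' \<otimes> y" "x = s \<otimes> e" using s(2,3) G_iff[OF z(1) l(2)] G_iff[OF s(1) l(3)] by auto
      then have "(z' \<otimes> y) \<otimes> e = (g \<otimes> y) \<otimes> e" "z' \<in> carrier U" using g(5) Qc by auto
      then show ?thesis using inQ Qc by simp
    qed
  qed
  have rankK: "\<exists>S. finite S \<and> card S \<le> def_dim n K \<and> set k \<subseteq> P.dcl (A \<union> S)" if "k \<in> K" for k
    by (rule P.rank_le_def_dim[OF up[OF KF] that cA]) simp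
  have preim: "\<exists>g\<in>V1. f1 g = w" if "w \<in> tbox cs ds" for w using that cd(4) c1(2) by blast
  \<comment> \<open>A chart point with \<open>d\<close> independent coordinates comes from some
    \<open>x\<close> in \<open>V1\<close>. Since \<open>x\<close> is definable from
    \<open>\<mu> x\<close> over \<open>A\<close>, the point \<open>\<mu> x\<close> of
    \<open>K\<close> has rank at least \<open>d\<close>.\<close>
  have dimK: "d \<le> def_dim n K"
  proof -
    obtain ws where ws: "length ws = 1" "\<forall>w\<in>set ws. w \<in> tbox cs ds" "P.indep A (concat ws)"
      using P.choose_indep_tuples[OF lt cd(1,2) cA, of 1] by blast
    then obtain w where w: "ws = [w]" by (auto simp: length_Suc_conv)
    have wb: "w \<in> tbox cs ds" "P.indep A w" using ws(2,3) w by auto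
    obtain x where x: "x \<in> V1" "f1 x = w" using preim[OF wb(1)] by blast
    have xc: "x \<in> carrier U" using x c1(1) by blast
    obtain e where e: "e \<in> N" "x = \<mu> x \<otimes> e" by (rule \<mu>_decomp[OF xc])
    let ?k = "\<mu> x"
    have kK: "?k \<in> K" "?k \<in> carrier U" using \<mu>(1)[OF xc] K_carrier by auto
    have "x \<otimes> inv ?k = e \<otimes> (?k \<otimes> inv ?k)" using N_carrier[OF e(1)] kK(2) e(2) by (metis inv_closed m_assoc m_comm)
    then have "e = x \<otimes> inv ?k" using N_carrier[OF e(1)] kK by simp
    moreover have "x \<otimes> inv ?k \<in> V1 <#> m_inv U ` K" unfolding set_mult_def using x kK by blast
    ultimately have "e \<in> EE" using e(1) by (simp add: EE_def)
    moreover have "?k \<in> Q" using kK by (simp add: Q_def)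
    ultimately have sx: "set x \<subseteq> P.dcl (A \<union> set ?k)" using prod_dcl[of ?k e] e(2) by simp
    obtain S where S: "finite S" "card S \<le> def_dim n K" "set ?k \<subseteq> P.dcl (A \<union> S)" using rankK[OF kK(1)] by blast
    have "set x \<subseteq> P.dcl (A \<union> S)" by (rule dcl_step[OF sx S(3)])
    moreover have "set w \<subseteq> P.dcl (A \<union> set x)" using chart_dcl(1)[OF ch1 F1 x(1)] x(2) by simp
    ultimately have "set w \<subseteq> P.dcl (A \<union> S)" using dcl_step by blast
    then have "length w \<le> card S" using P.steinitz[OF wb(2)] S(1) by blast
    moreover have "length w = d" using wb(1) cd(1) by (simp add: tbox_def)
    ultimately show ?thesis using S(2) by simp
  qed
  have dimK': "def_dim n K \<le> d" unfolding d_def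
    using def_dim_le_vdim[of n K "carrier U"] dsub_K \<mu>(1)[OF one_closed] unfolding dsub_def by blast
  obtain ws where ws: "length ws = Suc d" "\<forall>w\<in>set ws. w \<in> tbox cs ds" "P.indep A (concat ws)"
    using P.choose_indep_tuples[OF lt cd(1,2) cA, of "Suc d"] by blast
  define gg where "gg w = (SOME g. g \<in> V1 \<and> f1 g = w)" for w
  have gg: "gg w \<in> V1" "f1 (gg w) = w" if "w \<in> set ws" for w
    using someI_ex[of "\<lambda>g. g \<in> V1 \<and> f1 g = w"] preim[of w] ws(2) that unfolding gg_def by blast+
  define \<C> where "\<C> = (\<lambda>V. (V, fv V)) ` \<V>"
  have cover: "x \<in> (\<Union>g\<in>gg ` set ws. \<Union>(V, f)\<in>\<C>. (\<lambda>x. \<mu> (g \<otimes> x)) ` chart_core V f)" if xK: "x \<in> K" for x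
  proof (rule ccontr)
    assume nx: "x \<notin> (\<Union>g\<in>gg ` set ws. \<Union>(V, f)\<in>\<C>. (\<lambda>x. \<mu> (g \<otimes> x)) ` chart_core V f)"
    have xc: "x \<in> carrier U" using xK K_carrier by blast
    \<comment> \<open>With \<open>y = \<mu> (x - g)\<close> the point \<open>x\<close> equals
      \<open>\<mu> (g + y)\<close>, so \<open>y\<close> cannot be in a core. By the contrapositive
      of \<open>full_rank_interior\<close> its chart image, and hence \<open>y\<close>, has rank
      below \<open>d\<close>; over \<open>x\<close> the same bound passes to \<open>g\<close> and to
      \<open>w\<close>.\<close>
    have low: "\<exists>S. finite S \<and> card S < d \<and> set w \<subseteq> P.dcl (A \<union> (set x \<union> S))" if w: "w \<in> set ws" for w
    proof -
      let ?g = "gg w"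
      have gc: "?g \<in> carrier U" using gg(1)[OF w] c1(1) by blast
      let ?v = "x \<otimes> inv ?g"
      have vc: "?v \<in> carrier U" using xc gc by simp
      let ?y = "\<mu> ?v"
      have yK: "?y \<in> K" "?y \<in> carrier U" using \<mu>(1)[OF vc] K_carrier by auto
      obtain e where e: "e \<in> N" "?v = ?y \<otimes> e" by (rule \<mu>_decomp[OF vc])
      have ec: "e \<in> carrier U" using N_carrier[OF e(1)] .
      have "?v \<otimes> inv ?y = e"
      proof -
        have "?v \<otimes> inv ?y = ?y \<otimes> e \<otimes> inv ?y" using e(2) by simp
        also have "\<dots> = e \<otimes> (?y \<otimes> inv ?y)" using yK ec by (simp add: m_ac)
        finally show ?thesis using yK ec by simp
      qed
      moreover have "?v \<in> K <#> m_inv U ` V1" unfolding set_mult_def using xK gg(1)[OF w] by blast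
      then have "?v \<otimes> inv ?y \<in> (K <#> m_inv U ` V1) <#> m_inv U ` K" unfolding set_mult_def using yK(1) by blast
      ultimately have eE: "e \<in> EE" using e(1) by (simp add: EE_def)
      have x_eq: "x = (?g \<otimes> ?y) \<otimes> e"
      proof -
        have "(?g \<otimes> ?y) \<otimes> e = ?g \<otimes> ?v" using gc yK ec e(2) by (simp add: m_assoc)
        also have "\<dots> = x \<otimes> (?g \<otimes> inv ?g)" using gc xc by (simp add: m_ac)
        finally show ?thesis using gc xc by simp
      qed
      have gdcl: "set ?g \<subseteq> P.dcl (A \<union> (set x \<union> set ?y))" by (rule quot_dcl[OF gg(1)[OF w] yK(1) eE xK x_eq])
      have "\<exists>S. finite S \<and> card S < d \<and> set ?y \<subseteq> P.dcl (A \<union> S)"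
      proof (rule ccontr)
        assume no: "\<not> ?thesis"
        obtain V where V: "V \<in> \<V>" "?y \<in> V" using \<V>(2) yK(1) by blast
        obtain W where ch: "chart V (fv V) W" using fv V(1) by blast
        have VF: "(n + d, gr V (fv V)) \<in> Fam" using V(1) by (auto simp: Fam_def)
        let ?z = "fv V ?y"
        have "dpred M (F, R) A (\<lambda>E. \<exists>y. length y = n \<and> (y @ tup d (E 0) \<in> gr V (fv V) \<and> y \<in> K))"
          by (rule dpred_ex_tuple[where k = 1], intro dpred_conj dpred_mem[OF up[OF VF]] dpred_mem[OF up[OF KF]] tterm_append tterm_tup) auto
        then have "dset M (F, R) A d {z. length z = d \<and> (\<exists>y. length y = n \<and> (y @ z \<in> gr V (fv V) \<and> y \<in> K))}" by (rule dsetI)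
        moreover have "{z. length z = d \<and> (\<exists>y. length y = n \<and> (y @ z \<in> gr V (fv V) \<and> y \<in> K))} = fv V ` (V \<inter> K)"
        proof
          show "fv V ` (V \<inter> K) \<subseteq> {z. length z = d \<and> (\<exists>y. length y = n \<and> (y @ z \<in> gr V (fv V) \<and> y \<in> K))}"
            using chart_facts(4,6)[OF ch] unfolding gr_def by blast
          show "{z. length z = d \<and> (\<exists>y. length y = n \<and> (y @ z \<in> gr V (fv V) \<and> y \<in> K))} \<subseteq> fv V ` (V \<inter> K)"
          proof
            fix z assume "z \<in> {z. length z = d \<and> (\<exists>y. length y = n \<and> (y @ z \<in> gr V (fv V) \<and> y \<in> K))}"
            then obtain y y' where y: "length y = n" "y \<in> K" "y' \<in> V" "y @ z = y' @ fv V y'" unfolding gr_def by blast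
            then have "y = y'" "z = fv V y'" using chart_facts(6)[OF ch y(3)] by auto
            then show "z \<in> fv V ` (V \<inter> K)" using y by blast
          qed
        qed
        ultimately have dC: "dset M (F, R) A d (fv V ` (V \<inter> K))" by simp
        have zC: "?z \<in> fv V ` (V \<inter> K)" using V yK by blast
        have "\<exists>cs ds. length cs = d \<and> length ds = d \<and> ?z \<in> tbox cs ds \<and> tbox cs ds \<subseteq> fv V ` (V \<inter> K)"
        proof (rule P.full_rank_interior[OF dC zC cA])
          fix S assume S: "finite S" "set ?z \<subseteq> P.dcl (A \<union> S)"
          have "set ?y \<subseteq> P.dcl (A \<union> S)" by (rule dcl_step[OF chart_dcl(2)[OF ch VF V(2)] S(2)])
          then show "d \<le> card S" using no S(1) by (meson not_le)
        qed
        then have "?y \<in> chart_core V (fv V)" using V yK(1) unfolding chart_core_def by blast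
        moreover have "x = \<mu> (?g \<otimes> ?y)"
        proof -
          have "\<mu> x = \<mu> (?g \<otimes> ?y)" using \<mu>_mult_N[of "?g \<otimes> ?y" e] gc yK e(1) x_eq by simp
          then show ?thesis using \<mu>_K[OF xK] by simp
        qed
        moreover have "(V, fv V) \<in> \<C>" using V(1) by (simp add: \<C>_def)
        ultimately have "x \<in> (\<Union>g\<in>gg ` set ws. \<Union>(V, f)\<in>\<C>. (\<lambda>x. \<mu> (g \<otimes> x)) ` chart_core V f)"
          using w by (intro UN_I[of ?g] UN_I[of "(V, fv V)"]) auto
        then show False using nx by contradiction
      qed
      then obtain S where S: "finite S" "card S < d" "set ?y \<subseteq> P.dcl (A \<union> S)" by blast
      have "set x \<union> set ?y \<subseteq> P.dcl (A \<union> (set x \<union> S))"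
        using S(3) P.dcl_mono[of "A \<union> S" "A \<union> (set x \<union> S)"] P.subset_dcl[of "A \<union> (set x \<union> S)"] by blast
      from dcl_step[OF gdcl this] have "set ?g \<subseteq> P.dcl (A \<union> (set x \<union> S))" .
      moreover have "set w \<subseteq> P.dcl (A \<union> set ?g)" using chart_dcl(1)[OF ch1 F1 gg(1)[OF w]] gg(2)[OF w] by simp
      ultimately have "set w \<subseteq> P.dcl (A \<union> (set x \<union> S))" using dcl_step by blast
      then show ?thesis using S by blast
    qed
    then have "\<forall>w\<in>set ws. \<exists>S. finite S \<and> card S < d \<and> set w \<subseteq> P.dcl (A \<union> (set x \<union> S))" by blast
    from bchoice[OF this] obtain SS where SS: "\<forall>w\<in>set ws. finite (SS w) \<and> card (SS w) < d \<and> set w \<subseteq> P.dcl (A \<union> (set x \<union> SS w))" by blast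
    obtain Sx where Sx: "finite Sx" "card Sx \<le> def_dim n K" "set x \<subseteq> P.dcl (A \<union> Sx)" using rankK[OF xK] by blast
    let ?S = "Sx \<union> (\<Union>w\<in>set ws. SS w)"
    have "set w \<subseteq> P.dcl (A \<union> ?S)" if w: "w \<in> set ws" for w
    proof (rule dcl_step)
      show "set w \<subseteq> P.dcl (A \<union> (set x \<union> SS w))" using SS w by blast
      have "P.dcl (A \<union> Sx) \<subseteq> P.dcl (A \<union> ?S)" by (rule P.dcl_mono) auto
      moreover have "SS w \<subseteq> P.dcl (A \<union> ?S)" using P.subset_dcl[of "A \<union> ?S"] w by blast
      ultimately show "set x \<union> SS w \<subseteq> P.dcl (A \<union> ?S)" using Sx(3) by blast
    qed
    then have "set (concat ws) \<subseteq> P.dcl (A \<union> ?S)" by auto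
    moreover have "finite ?S" using Sx(1) SS by auto
    ultimately have st: "length (concat ws) \<le> card ?S" by (rule P.steinitz[OF ws(3)])
    have "\<forall>w\<in>set ws. length w = d" using ws(2) cd(1) by (auto simp: tbox_def)
    then have "map length ws = replicate (Suc d) d" using ws(1) by (intro replicate_eqI) auto
    then have len: "length (concat ws) = Suc d * d" by (simp add: length_concat sum_list_replicate)
    \<comment> \<open>The count: \<open>x\<close> contributes at most \<open>d\<close>, each of the
      \<open>d + 1\<close> tuples at most \<open>d - 1\<close>, in total
      \<open>d * (d + 1) - 1\<close>, one less than the length of the independent sequence.\<close>
    have "card (\<Union>w\<in>set ws. SS w) \<le> (\<Sum>w\<in>set ws. card (SS w))" by (rule card_UN_le) simp
    also have "\<dots> \<le> of_nat (card (set ws)) * (d - 1)" by (rule sum_bounded_above) (use SS in fastforce)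
    also have "\<dots> \<le> Suc d * (d - 1)"
      using mult_le_mono1[of "card (set ws)" "Suc d" "d - 1"] card_length[of ws] ws(1) by (simp only: of_nat_id)
    finally have "card ?S \<le> d + Suc d * (d - 1)" using card_Un_le[of Sx "\<Union>w\<in>set ws. SS w"] Sx(2) dimK' by linarith
    moreover have "d > 0" using SS ws(1) by (cases ws) auto
    then have "d + Suc d * (d - 1) < Suc d * d" by (cases d) auto
    ultimately show False using st len by linarith
  qed
  show thesis
  proof (rule that[of "gg ` set ws" \<C>])
    show "finite (gg ` set ws)" "gg ` set ws \<subseteq> carrier U" "finite \<C>"
      using gg(1) c1(1) \<V>(1) by (auto simp: \<C>_def)
    show "\<exists>W. chart V f W" if "(V, f) \<in> \<C>" for V f using that fv by (auto simp: \<C>_def)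
    show "K \<subseteq> (\<Union>g\<in>gg ` set ws. \<Union>(V, f)\<in>\<C>. (\<lambda>x. \<mu> (g \<otimes> x)) ` chart_core V f)" using cover by (rule subsetI)
  qed (rule dimK)
qed

end

section \<open>The topology of the quotient\<close>

lemma DP_tbox:
  assumes "tterm UNIV k t" "tterm UNIV k c" "tterm UNIV k e"
  shows "DP M (\<lambda>E. t E \<in> tbox (c E) (e E))"
proof -
  have "DP M (\<lambda>E. \<forall>i\<in>{..<k}. c E ! i < t E ! i \<and> t E ! i < e E ! i)"
    by (rule dpred_all_finite) (auto intro!: dpred_conj dpred_less tterm_nth assms)
  then show ?thesis
    by (rule dpred_cong) (auto simp: tbox_def tterm_length[OF assms(1)] tterm_length[OF assms(2)])
qed

context vtop
begin

text \<open>The quotient topology along \<open>\<mu>\<close>, carried by the representatives. It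
  generally differs from the subspace topology of \<open>K\<close>: opposite edges of
  \<open>K\<close> are glued.\<close>

definition TK :: "'a list topology" where
  "TK = topology (\<lambda>S. S \<subseteq> K \<and> openin T {u \<in> carrier U. \<mu> u \<in> S})"

lemma openin_TK: "openin TK S \<longleftrightarrow> S \<subseteq> K \<and> openin T {u \<in> carrier U. \<mu> u \<in> S}"
proof -
  have "istopology (\<lambda>S. S \<subseteq> K \<and> openin T {u \<in> carrier U. \<mu> u \<in> S})"
    unfolding istopology_def
  proof (intro conjI allI impI)
    fix S S' assume "S \<subseteq> K \<and> openin T {u \<in> carrier U. \<mu> u \<in> S}" "S' \<subseteq> K \<and> openin T {u \<in> carrier U. \<mu> u \<in> S'}"
    moreover have "{u \<in> carrier U. \<mu> u \<in> S \<inter> S'} = {u \<in> carrier U. \<mu> u \<in> S} \<inter> {u \<in> carrier U. \<mu> u \<in> S'}" by blast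
    ultimately show "S \<inter> S' \<subseteq> K" "openin T {u \<in> carrier U. \<mu> u \<in> S \<inter> S'}" by auto
  next
    fix \<S> assume "\<forall>S\<in>\<S>. S \<subseteq> K \<and> openin T {u \<in> carrier U. \<mu> u \<in> S}"
    moreover have "{u \<in> carrier U. \<mu> u \<in> \<Union>\<S>} = (\<Union>S\<in>\<S>. {u \<in> carrier U. \<mu> u \<in> S})" by blast
    ultimately show "\<Union>\<S> \<subseteq> K" "openin T {u \<in> carrier U. \<mu> u \<in> \<Union>\<S>}" by auto
  qed
  then show ?thesis unfolding TK_def by (simp add: topology_inverse')
qed

lemma topspace_TK: "topspace TK = K"
proof
  show "topspace TK \<subseteq> K" using openin_topspace[of TK] unfolding openin_TK by blast
  have "{u \<in> carrier U. \<mu> u \<in> K} = topspace T" using \<mu>(1) topspace_T by auto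
  then have "openin TK K" unfolding openin_TK by simp
  then show "K \<subseteq> topspace TK" by (rule openin_subset)
qed

lemma cont_\<mu>: "continuous_map T TK \<mu>"
  unfolding continuous_map_def using \<mu>(1) by (auto simp: topspace_T topspace_TK openin_TK)

lemma cont_translate: assumes "g \<in> carrier U" shows "continuous_map T T (\<lambda>x. g \<otimes> x)"
proof -
  have "continuous_map T (prod_topology T T) (\<lambda>x. (g, x))"
    using assms by (intro continuous_map_pairedI) (auto simp: topspace_T)
  from continuous_map_compose[OF this cont_mult] show ?thesis by (simp add: comp_def)
qed

lemma open_translate: assumes "openin T B" "g \<in> carrier U" shows "openin T ((\<lambda>x. g \<otimes> x) ` B)"
proof -
  have B: "B \<subseteq> carrier U" using openin_subset[OF assms(1)] topspace_T by simp
  have "openin T {x \<in> topspace T. inv g \<otimes> x \<in> B}"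
    by (rule openin_continuous_map_preimage[OF cont_translate assms(1)]) (use assms in simp)
  moreover have "{x \<in> topspace T. inv g \<otimes> x \<in> B} = (\<lambda>x. g \<otimes> x) ` B"
  proof
    show "(\<lambda>x. g \<otimes> x) ` B \<subseteq> {x \<in> topspace T. inv g \<otimes> x \<in> B}"
      using B assms(2) by (auto simp: topspace_T subset_iff m_assoc[symmetric])
    show "{x \<in> topspace T. inv g \<otimes> x \<in> B} \<subseteq> (\<lambda>x. g \<otimes> x) ` B"
    proof
      fix x assume x: "x \<in> {x \<in> topspace T. inv g \<otimes> x \<in> B}"
      then have "g \<otimes> (inv g \<otimes> x) = x" using assms(2) by (simp add: topspace_T m_assoc[symmetric])
      then show "x \<in> (\<lambda>x. g \<otimes> x) ` B" using x by (intro image_eqI[of _ _ "inv g \<otimes> x"]) auto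
    qed
  qed
  ultimately show ?thesis by simp
qed

text \<open>The preimage of the image is the union of all translates of \<open>B\<close> by elements
  of \<open>N\<close>, and translations are homeomorphisms.\<close>

lemma open_\<mu>: assumes "openin T B" shows "openin TK (\<mu> ` B)"
proof -
  have B: "B \<subseteq> carrier U" using openin_subset[OF assms] topspace_T by simp
  have "{u \<in> carrier U. \<mu> u \<in> \<mu> ` B} = (\<Union>e\<in>N. (\<lambda>x. e \<otimes> x) ` B)"
  proof
    show "{u \<in> carrier U. \<mu> u \<in> \<mu> ` B} \<subseteq> (\<Union>e\<in>N. (\<lambda>x. e \<otimes> x) ` B)"
    proof
      fix u assume "u \<in> {u \<in> carrier U. \<mu> u \<in> \<mu> ` B}"
      then obtain b where b: "u \<in> carrier U" "b \<in> B" "\<mu> b = \<mu> u" by auto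
      then obtain e where e: "e \<in> N" "u = b \<otimes> e" using \<mu>_eq_iff[of b u] B by blast
      then have "u = e \<otimes> b" using m_comm[of b e] N_carrier[OF e(1)] B b(2) by auto
      then show "u \<in> (\<Union>e\<in>N. (\<lambda>x. e \<otimes> x) ` B)" using e(1) b(2) by blast
    qed
    show "(\<Union>e\<in>N. (\<lambda>x. e \<otimes> x) ` B) \<subseteq> {u \<in> carrier U. \<mu> u \<in> \<mu> ` B}"
    proof
      fix u assume "u \<in> (\<Union>e\<in>N. (\<lambda>x. e \<otimes> x) ` B)"
      then obtain e b where e: "e \<in> N" "b \<in> B" "u = e \<otimes> b" by blast
      then have c: "e \<in> carrier U" "b \<in> carrier U" using N_carrier B by auto
      then have "\<mu> u = \<mu> b" using \<mu>_mult_N[OF c(2) e(1)] e(3) by (simp add: m_comm)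
      then show "u \<in> {u \<in> carrier U. \<mu> u \<in> \<mu> ` B}" using c e by auto
    qed
  qed
  moreover have "openin T (\<Union>e\<in>N. (\<lambda>x. e \<otimes> x) ` B)"
    using open_translate[OF assms] N_carrier by blast
  moreover have "\<mu> ` B \<subseteq> K" using \<mu>(1) B by blast
  ultimately show ?thesis unfolding openin_TK by simp
qed

text \<open>As \<open>\<mu>\<close> is open, an open rectangle in the preimage upstairs maps to an
  open rectangle downstairs.\<close>

lemma cont_mult_KG: "continuous_map (prod_topology TK TK) TK (\<lambda>(x, y). x \<otimes>\<^bsub>KG\<^esub> y)"
  unfolding continuous_map_def
proof (intro conjI allI impI)
  show "(\<lambda>(x, y). x \<otimes>\<^bsub>KG\<^esub> y) \<in> topspace (prod_topology TK TK) \<rightarrow> topspace TK"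
    using \<mu>(1) K_carrier by (auto simp: topspace_TK KG_simps)
  fix S assume S: "openin TK S"
  have oS: "openin T {u \<in> carrier U. \<mu> u \<in> S}" using S unfolding openin_TK by auto
  have pre: "openin (prod_topology T T) {p \<in> topspace (prod_topology T T). (case p of (x, y) \<Rightarrow> x \<otimes> y) \<in> {u \<in> carrier U. \<mu> u \<in> S}}"
    by (rule openin_continuous_map_preimage[OF cont_mult oS])
  show "openin (prod_topology TK TK) {x \<in> topspace (prod_topology TK TK). (case x of (x, y) \<Rightarrow> x \<otimes>\<^bsub>KG\<^esub> y) \<in> S}"
    unfolding openin_prod_topology_alt
  proof (intro allI impI)
    fix x y assume "(x, y) \<in> {x \<in> topspace (prod_topology TK TK). (case x of (x, y) \<Rightarrow> x \<otimes>\<^bsub>KG\<^esub> y) \<in> S}"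
    then have xy: "x \<in> K" "y \<in> K" "\<mu> (x \<otimes> y) \<in> S" by (auto simp: topspace_TK KG_simps)
    then have c: "x \<in> carrier U" "y \<in> carrier U" using K_carrier by auto
    then have "(x, y) \<in> {p \<in> topspace (prod_topology T T). (case p of (x, y) \<Rightarrow> x \<otimes> y) \<in> {u \<in> carrier U. \<mu> u \<in> S}}"
      using xy by (auto simp: topspace_T)
    from pre[unfolded openin_prod_topology_alt, rule_format, OF this]
    obtain A B where AB: "openin T A" "openin T B" "x \<in> A" "y \<in> B"
      "A \<times> B \<subseteq> {p \<in> topspace (prod_topology T T). (case p of (x, y) \<Rightarrow> x \<otimes> y) \<in> {u \<in> carrier U. \<mu> u \<in> S}}"
      by (elim exE conjE)
    have "\<mu> ` A \<times> \<mu> ` B \<subseteq> {x \<in> topspace (prod_topology TK TK). (case x of (x, y) \<Rightarrow> x \<otimes>\<^bsub>KG\<^esub> y) \<in> S}"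
    proof
      fix q assume "q \<in> \<mu> ` A \<times> \<mu> ` B"
      then obtain a b where ab: "a \<in> A" "b \<in> B" "q = (\<mu> a, \<mu> b)" by blast
      then have "(a, b) \<in> A \<times> B" by simp
      then have h: "a \<in> carrier U" "b \<in> carrier U" "\<mu> (a \<otimes> b) \<in> S" using AB(5) topspace_T by auto
      then show "q \<in> {x \<in> topspace (prod_topology TK TK). (case x of (x, y) \<Rightarrow> x \<otimes>\<^bsub>KG\<^esub> y) \<in> S}"
        using ab(3) \<mu>_mult[OF h(1,2)] \<mu>(1) by (simp add: topspace_TK KG_simps)
    qed
    moreover have "x \<in> \<mu> ` A" "y \<in> \<mu> ` B" using AB \<mu>_K xy by (metis image_eqI)+
    ultimately show "\<exists>A B. openin TK A \<and> openin TK B \<and> x \<in> A \<and> y \<in> B \<and>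
        A \<times> B \<subseteq> {x \<in> topspace (prod_topology TK TK). (case x of (x, y) \<Rightarrow> x \<otimes>\<^bsub>KG\<^esub> y) \<in> S}"
      using open_\<mu>[OF AB(1)] open_\<mu>[OF AB(2)] by blast
  qed
qed

lemma inv_KG: assumes "x \<in> K" shows "inv\<^bsub>KG\<^esub> x = \<mu> (inv x)"
proof -
  interpret KG: comm_group KG by (rule group_KG)
  have c: "x \<in> carrier U" using assms K_carrier by blast
  have "\<mu> (inv x) \<otimes>\<^bsub>KG\<^esub> x = \<one>\<^bsub>KG\<^esub>" using \<mu>_mult[of "inv x" x] c \<mu>_K[OF assms] by (simp add: KG_simps)
  then show ?thesis using assms c by (intro KG.inv_equality) (auto simp: KG_simps \<mu>)
qed

lemma cont_inv_KG: "continuous_map TK TK (\<lambda>x. inv\<^bsub>KG\<^esub> x)"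
  unfolding continuous_map_def
proof (intro conjI allI impI)
  show "(\<lambda>x. inv\<^bsub>KG\<^esub> x) \<in> topspace TK \<rightarrow> topspace TK"
    using \<mu>(1) K_carrier by (auto simp: topspace_TK inv_KG)
  fix S assume S: "openin TK S"
  have "openin T {u \<in> topspace T. inv u \<in> {u \<in> carrier U. \<mu> u \<in> S}}"
    by (rule openin_continuous_map_preimage[OF cont_inv]) (use S openin_TK in blast)
  moreover have "{u \<in> carrier U. \<mu> u \<in> {x \<in> topspace TK. inv\<^bsub>KG\<^esub> x \<in> S}} = {u \<in> topspace T. inv u \<in> {u \<in> carrier U. \<mu> u \<in> S}}"
  proof -
    have "inv\<^bsub>KG\<^esub> (\<mu> u) = \<mu> (inv u)" if u: "u \<in> carrier U" for u
    proof -
      interpret KG: comm_group KG by (rule group_KG)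
      have "\<mu> (inv u) \<otimes>\<^bsub>KG\<^esub> \<mu> u = \<one>\<^bsub>KG\<^esub>" using \<mu>_mult[of "inv u" u] u by (simp add: KG_simps)
      then show ?thesis using u by (intro KG.inv_equality) (auto simp: KG_simps \<mu>)
    qed
    then show ?thesis using \<mu>(1) by (auto simp: topspace_T topspace_TK)
  qed
  ultimately show "openin TK {x \<in> topspace TK. inv\<^bsub>KG\<^esub> x \<in> S}"
    unfolding openin_TK[of "{x \<in> topspace TK. inv\<^bsub>KG\<^esub> x \<in> S}"] by (auto simp: topspace_TK)
qed

definition core_image :: "'a list set \<Rightarrow> ('a list \<Rightarrow> 'a list) \<Rightarrow> 'a list set" where
  "core_image V f = {y. \<exists>cs ds. length cs = d \<and> length ds = d \<and> y \<in> tbox cs ds \<and> tbox cs ds \<subseteq> f ` (V \<inter> K)}"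

lemma core_facts:
  assumes ch: "chart V f W"
  shows "openin (tuple_topology d) (core_image V f)" "chart_core V f = {x \<in> V. f x \<in> core_image V f}"
    "f ` chart_core V f = core_image V f" "openin T (chart_core V f)" "dsub (chart_core V f)"
proof -
  note cf = chart_facts[OF ch]
  have sub: "core_image V f \<subseteq> f ` (V \<inter> K)" unfolding core_image_def by blast
  show op: "openin (tuple_topology d) (core_image V f)"
  proof (subst openin_subopen, intro ballI)
    fix y assume "y \<in> core_image V f"
    then obtain cs ds where *: "length cs = d" "length ds = d" "y \<in> tbox cs ds" "tbox cs ds \<subseteq> f ` (V \<inter> K)"
      unfolding core_image_def by blast
    then have "tbox cs ds \<subseteq> core_image V f" unfolding core_image_def by blast
    then show "\<exists>B. openin (tuple_topology d) B \<and> y \<in> B \<and> B \<subseteq> core_image V f" using openin_tbox[OF *(1)] *(3) by blast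
  qed
  show eq: "chart_core V f = {x \<in> V. f x \<in> core_image V f}"
  proof
    show "{x \<in> V. f x \<in> core_image V f} \<subseteq> chart_core V f"
    proof
      fix x assume x: "x \<in> {x \<in> V. f x \<in> core_image V f}"
      then obtain x' where "x' \<in> V \<inter> K" "f x = f x'" using sub by blast
      then have "x \<in> K" using inj_onD[OF cf(3), of x x'] x by auto
      then show "x \<in> chart_core V f" using x unfolding chart_core_def core_image_def by blast
    qed
  qed (auto simp: chart_core_def core_image_def)
  show "f ` chart_core V f = core_image V f" unfolding eq using sub by blast
  have hm: "homeomorphic_map (subtopology T V) (subtopology (tuple_topology d) W) f" using ch by (simp add: chart_def)
  then have "continuous_map (subtopology T V) (tuple_topology d) f"
    using homeomorphic_imp_continuous_map continuous_map_into_fulltopology by blast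
  from openin_continuous_map_preimage[OF this op]
  have "openin (subtopology T V) {x \<in> topspace (subtopology T V). f x \<in> core_image V f}" .
  moreover have "{x \<in> topspace (subtopology T V). f x \<in> core_image V f} = chart_core V f"
    unfolding eq using cf(1) topspace_T by auto
  moreover have "openin T V" using ch by (simp add: chart_def)
  ultimately show "openin T (chart_core V f)" using openin_open_subtopology by metis
  define C where "C = f ` (V \<inter> K)"
  have K: "definable M n K" using dsub_K by (simp add: dsub_def)
  have C: "definable M d C"
  proof (rule definableI)
    have "DP M (\<lambda>E. \<exists>x\<in>K. x @ tup d (E 0) \<in> {x @ f x |x. x \<in> V})"
      by (rule DP_bex[OF K, where k = 1], intro dpred_imp DP_mem[OF K] DP_mem[OF cf(5)] tterm_append tterm_tup) simp
    then show "DP M (\<lambda>E. tup d (E 0) \<in> C)"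
    proof (rule dpred_cong)
      fix E
      show "(\<exists>x\<in>K. x @ tup d (E 0) \<in> {x @ f x |x. x \<in> V}) = (tup d (E 0) \<in> C)"
      proof
        assume "\<exists>x\<in>K. x @ tup d (E 0) \<in> {x @ f x |x. x \<in> V}"
        then obtain x x' where x: "x \<in> K" "x' \<in> V" "x @ tup d (E 0) = x' @ f x'" by blast
        moreover have "length x = length x'" using x K_carrier length_carrier cf(6) by metis
        ultimately have "x = x'" "tup d (E 0) = f x'" by auto
        then show "tup d (E 0) \<in> C" using x unfolding C_def by blast
      next
        assume "tup d (E 0) \<in> C"
        then show "\<exists>x\<in>K. x @ tup d (E 0) \<in> {x @ f x |x. x \<in> V}" unfolding C_def by blast
      qed
    qed
  qed (use cf(4) in \<open>auto simp: C_def\<close>)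
  have D: "definable M d (core_image V f)"
  proof (rule definableI)
    have "DP M (\<lambda>E. \<exists>cs. length cs = d \<and> (\<exists>ds. length ds = d \<and> (tup d (E 0) \<in> tbox cs ds \<and>
        \<not> (\<exists>z. length z = d \<and> (z \<in> tbox cs ds \<and> \<not> z \<in> C)))))"
    proof (rule dpred_ex_tuple[where k = 1], rule dpred_ex_tuple[where k = 2], rule dpred_conj)
      show "DP M (\<lambda>E. tup d (E 0) \<in> tbox (tup d (E 1)) (tup d (E 2)))"
        by (rule DP_tbox[OF tterm_tup tterm_tup tterm_tup])
      show "DP M (\<lambda>E. \<not> (\<exists>z. length z = d \<and> (z \<in> tbox (tup d (E 1)) (tup d (E 2)) \<and> \<not> z \<in> C)))"
        by (rule dpred_not, rule dpred_ex_tuple[where k = 3],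
            intro dpred_conj dpred_not DP_tbox[OF tterm_tup tterm_tup tterm_tup] DP_mem[OF C tterm_tup]) simp
    qed simp_all
    then show "DP M (\<lambda>E. tup d (E 0) \<in> core_image V f)"
    proof (rule dpred_cong)
      fix E
      have tl: "length z = length cs" if "z \<in> tbox cs ds" for z cs ds :: "'a list" using that by (simp add: tbox_def)
      have sub: "(tbox cs ds \<subseteq> C) \<longleftrightarrow> \<not> (\<exists>z. length z = d \<and> (z \<in> tbox cs ds \<and> \<not> z \<in> C))" if "length cs = d" for cs ds :: "'a list"
        using that tl[of _ cs ds] by auto
      show "(\<exists>cs. length cs = d \<and> (\<exists>ds. length ds = d \<and> (tup d (E 0) \<in> tbox cs ds \<and>
        \<not> (\<exists>z. length z = d \<and> (z \<in> tbox cs ds \<and> \<not> z \<in> C))))) = (tup d (E 0) \<in> core_image V f)"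
        unfolding core_image_def C_def[symmetric] mem_Collect_eq using sub by (intro ex_cong1 conj_cong refl) auto
    qed
  qed (auto simp: core_image_def tbox_def)
  have "definable M n (chart_core V f)"
  proof (rule definableI)
    have "DP M (\<lambda>E. \<exists>y\<in>core_image V f. tup n (E 0) @ y \<in> {x @ f x |x. x \<in> V})"
      by (rule DP_bex[OF D, where k = 1], intro dpred_imp DP_mem[OF D] DP_mem[OF cf(5)] tterm_append tterm_tup) simp
    then show "DP M (\<lambda>E. tup n (E 0) \<in> chart_core V f)"
    proof (rule dpred_cong)
      fix E
      have iff: "tup n (E 0) @ y \<in> {x @ f x |x. x \<in> V} \<longleftrightarrow> tup n (E 0) \<in> V \<and> y = f (tup n (E 0))" for y
      proof
        assume "tup n (E 0) @ y \<in> {x @ f x |x. x \<in> V}"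
        then obtain x where x: "x \<in> V" "tup n (E 0) @ y = x @ f x" by blast
        then show "tup n (E 0) \<in> V \<and> y = f (tup n (E 0))" using cf(6)[OF x(1)] by simp
      qed blast
      show "(\<exists>y\<in>core_image V f. tup n (E 0) @ y \<in> {x @ f x |x. x \<in> V}) = (tup n (E 0) \<in> chart_core V f)"
        unfolding eq iff by blast
    qed
  qed (use cf(6) in \<open>auto simp: chart_core_def\<close>)
  moreover have "chart_core V f \<subseteq> carrier U" using cf(1) by (auto simp: chart_core_def)
  ultimately show "dsub (chart_core V f)" by (simp add: dsub_def)
qed

text \<open>On a translate of the core, \<open>\<mu>\<close> is injective: congruent points
  \<open>g + x\<close> and \<open>g + y\<close> give congruent \<open>x\<close> and
  \<open>y\<close>, which are equal because the core consists of representatives. Being also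
  continuous and open, the map is a homeomorphism, and its inverse followed by \<open>f\<close> is
  the chart.\<close>

lemma chart_KG:
  assumes ch: "chart V f W" and g: "g \<in> carrier U"
  defines "C \<equiv> (\<lambda>x. \<mu> (g \<otimes> x)) ` chart_core V f"
  shows "definable M n C" "openin TK C" "\<exists>h. definable_fun M n d C h \<and>
    homeomorphic_map (subtopology TK C) (subtopology (tuple_topology d) (core_image V f)) h"
proof -
  note cf = chart_facts[OF ch] and co = core_facts[OF ch]
  define CO where "CO = chart_core V f"
  define p where "p x = \<mu> (g \<otimes> x)" for x
  have Cp: "C = p ` CO" by (simp add: C_def CO_def p_def)
  have OK: "x \<in> K" "x \<in> V" if "x \<in> CO" for x using that by (auto simp: CO_def chart_core_def)
  have Oc: "x \<in> carrier U" if "x \<in> CO" for x using OK[OF that] K_carrier by blast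
  have oO: "openin T CO" and dO: "dsub CO" using co by (simp_all add: CO_def)
  have inj: "inj_on p CO"
  proof (rule inj_onI)
    fix x y assume xy: "x \<in> CO" "y \<in> CO" "p x = p y"
    then obtain e where e: "e \<in> N" "g \<otimes> y = (g \<otimes> x) \<otimes> e" using \<mu>_eq_iff[of "g \<otimes> x" "g \<otimes> y"] g Oc unfolding p_def by auto
    then have "g \<otimes> y = g \<otimes> (x \<otimes> e)" using g Oc[OF xy(1)] N_carrier[OF e(1)] by (simp add: m_assoc)
    then have "y = x \<otimes> e" using g Oc[OF xy(1)] Oc[OF xy(2)] N_carrier[OF e(1)] by simp
    then have "\<mu> y = \<mu> x" using \<mu>_mult_N[OF Oc[OF xy(1)] e(1)] by simp
    then show "x = y" using \<mu>_K OK xy by simp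
  qed
  have p_img: "p ` B = \<mu> ` ((\<lambda>x. g \<otimes> x) ` B)" for B by (auto simp: p_def)
  have p_open: "openin TK (p ` B)" if "openin T B" for B
    unfolding p_img by (rule open_\<mu>[OF open_translate[OF that g]])
  show oC: "openin TK C" unfolding Cp by (rule p_open[OF oO])
  have p_cont: "continuous_map T TK p"
    using continuous_map_compose[OF cont_translate[OF g] cont_\<mu>] unfolding p_def comp_def .
  have tO: "topspace (subtopology T CO) = CO" using Oc topspace_T by auto
  have CK: "C \<subseteq> K" using openin_subset[OF oC] topspace_TK by simp
  have tC: "topspace (subtopology TK C) = C" using CK topspace_TK by auto
  have hp: "homeomorphic_map (subtopology T CO) (subtopology TK C) p"
  proof (rule bijective_open_imp_homeomorphic_map)
    show "continuous_map (subtopology T CO) (subtopology TK C) p"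
      by (rule continuous_map_into_subtopology[OF continuous_map_from_subtopology[OF p_cont]]) (auto simp: Cp tO)
    show "open_map (subtopology T CO) (subtopology TK C) p"
      unfolding open_map_def
    proof (intro allI impI)
      fix B assume "openin (subtopology T CO) B"
      then have "openin T B" "B \<subseteq> CO" using openin_open_subtopology[OF oO] by auto
      then show "openin (subtopology TK C) (p ` B)" using p_open openin_open_subtopology[OF oC] unfolding Cp by blast
    qed
    show "p ` topspace (subtopology T CO) = topspace (subtopology TK C)" unfolding tO tC by (rule Cp[symmetric])
    show "inj_on p (topspace (subtopology T CO))" unfolding tO by (rule inj)
  qed
  then obtain q where "homeomorphic_maps (subtopology T CO) (subtopology TK C) p q"
    unfolding homeomorphic_map_maps by blast
  then have hq: "homeomorphic_map (subtopology TK C) (subtopology T CO) q" "\<And>x. x \<in> CO \<Longrightarrow> q (p x) = x"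
    unfolding homeomorphic_maps_map tO by auto
  have hf: "homeomorphic_map (subtopology T CO) (subtopology (tuple_topology d) (core_image V f)) f"
  proof -
    have "homeomorphic_map (subtopology T V) (subtopology (tuple_topology d) W) f" using ch by (simp add: chart_def)
    moreover have "f ` (topspace (subtopology T V) \<inter> CO) = topspace (subtopology (tuple_topology d) W) \<inter> core_image V f"
    proof -
      have "topspace (subtopology T V) \<inter> CO = CO" using OK Oc topspace_T by auto
      moreover have "core_image V f \<subseteq> W" using cf(2) co(3) unfolding chart_core_def by blast
      moreover have "W \<subseteq> topspace (tuple_topology d)" using ch openin_subset by (auto simp: chart_def)
      ultimately show ?thesis using co(3) by (auto simp: CO_def)
    qed
    ultimately have "homeomorphic_map (subtopology (subtopology T V) CO) (subtopology (subtopology (tuple_topology d) W) (core_image V f)) f"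
      by (rule homeomorphic_map_subtopologies)
    moreover have "V \<inter> CO = CO" "W \<inter> core_image V f = core_image V f"
      using OK cf(2) co(3) unfolding chart_core_def by blast+
    ultimately show ?thesis by (simp add: subtopology_subtopology)
  qed
  have "homeomorphic_map (subtopology TK C) (subtopology (tuple_topology d) (core_image V f)) (f \<circ> q)"
    by (rule homeomorphic_map_compose[OF hq(1) hf])
  moreover have "definable_fun M n d C (f \<circ> q)"
    unfolding definable_fun_def
  proof
    show "\<forall>x\<in>C. length ((f \<circ> q) x) = d" using hq(2) cf(4) OK unfolding Cp by auto
    have dS: "dsub ({g} <#> CO)" using g by (intro dsub_mult dO dsub_finite) auto
    have tg: "tterm UNIV n (\<lambda>E. g)" using g by (intro tterm_const) (auto simp: length_carrier)
    have CO: "definable M n CO" and S: "definable M n ({g} <#> CO)" using dO dS by (auto simp: dsub_def)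
    have dg: "dsub {g}" using g by (intro dsub_finite) auto
    \<comment> \<open>The graph of the new chart is described without its inverse \<open>q\<close>,
      as the set of pairs of \<open>p x\<close> and \<open>f x\<close> for \<open>x\<close> in the
      core.\<close>
    let ?R = "\<lambda>k y. \<exists>x\<in>CO. (\<exists>s\<in>{g} <#> CO. (g \<in> {g} \<and> x \<in> CO \<and> g \<otimes> x = s) \<and> (s \<in> {g} <#> CO \<and> \<mu> s = k)) \<and> x @ y \<in> {x @ f x |x. x \<in> V}"
    have R: "?R k y \<longleftrightarrow> (\<exists>x\<in>CO. k = p x \<and> y = f x)" for k y
    proof -
      have s: "g \<otimes> x \<in> {g} <#> CO" if "x \<in> CO" for x using that unfolding set_mult_def by blast
      have f: "x @ y \<in> {x @ f x |x. x \<in> V} \<longleftrightarrow> y = f x" if x: "x \<in> CO" for x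
      proof
        assume "x @ y \<in> {x @ f x |x. x \<in> V}"
        then obtain x' where x': "x' \<in> V" "x @ y = x' @ f x'" by blast
        then show "y = f x" using cf(6)[OF x'(1)] cf(6)[OF OK(2)[OF x]] by simp
      qed (use OK(2)[OF x] in blast)
      have "(\<exists>s\<in>{g} <#> CO. (g \<in> {g} \<and> x \<in> CO \<and> g \<otimes> x = s) \<and> (s \<in> {g} <#> CO \<and> \<mu> s = k)) \<longleftrightarrow> k = p x" if "x \<in> CO" for x
        using s[OF that] that unfolding p_def by blast
      then show ?thesis using f by blast
    qed
    show "definable M (n + d) {x @ (f \<circ> q) x |x. x \<in> C}"
    proof (rule definable_append2[where R = ?R])
      show "DP M (\<lambda>E. ?R (tup n (E 0)) (tup d (E 1)))"
      proof (rule DP_bex[OF CO, where k = 2], rule dpred_imp[OF DP_mem[OF CO tterm_tup]], rule dpred_conj)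
        show "DP M (\<lambda>E. \<exists>s\<in>{g} <#> CO. (g \<in> {g} \<and> tup n (E 2) \<in> CO \<and> g \<otimes> tup n (E 2) = s) \<and> (s \<in> {g} <#> CO \<and> \<mu> s = tup n (E 0)))"
          by (rule DP_bex[OF S, where k = 3], intro dpred_imp dpred_conj[OF DP_mult DP_\<mu>] DP_mem[OF S] tterm_tup dg dO dS tg) simp
        show "DP M (\<lambda>E. tup n (E 2) @ tup d (E 1) \<in> {x @ f x |x. x \<in> V})"
          by (rule DP_mem[OF cf(5) tterm_append[OF tterm_tup tterm_tup]])
      qed simp
      show "length k = n \<and> length y = d" if ky: "?R k y" for k y
      proof -
        obtain x where x: "x \<in> CO" "k = p x" "y = f x" using ky unfolding R by blast
        have "p x \<in> K" using CK x(1) unfolding Cp by blast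
        then show ?thesis using x K_carrier length_carrier cf(4) OK by auto
      qed
      have "{x @ (f \<circ> q) x |x. x \<in> C} = {p x @ f x |x. x \<in> CO}" using hq(2) unfolding Cp by force
      then show "{x @ (f \<circ> q) x |x. x \<in> C} = {k @ y |k y. ?R k y}" unfolding R by blast
    qed
  qed
  ultimately show "\<exists>h. definable_fun M n d C h \<and> homeomorphic_map (subtopology TK C) (subtopology (tuple_topology d) (core_image V f)) h"
    by blast
  show "definable M n C"
  proof (rule definableI)
    have dS: "dsub ({g} <#> CO)" using g by (intro dsub_mult dO dsub_finite) auto
    then have S: "definable M n ({g} <#> CO)" by (simp add: dsub_def)
    have "DP M (\<lambda>E. \<exists>s\<in>{g} <#> CO. s \<in> {g} <#> CO \<and> \<mu> s = tup n (E 0))"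
      by (rule DP_bex[OF S, where k = 1], intro dpred_imp DP_mem[OF S] DP_\<mu> dS tterm_tup) simp
    then show "DP M (\<lambda>E. tup n (E 0) \<in> C)"
      by (rule dpred_cong) (auto simp: Cp p_def set_mult_def image_iff eq_commute[of "tup _ _"])
  qed (use CK K_carrier length_carrier in blast)
qed

lemma canonical_KG: "canonical_group_topology \<kappa> M n KG TK"
proof -
  obtain Gs \<C> where GC: "finite Gs" "Gs \<subseteq> carrier U" "finite \<C>" "\<And>V f. (V, f) \<in> \<C> \<Longrightarrow> \<exists>W. chart V f W"
    "K \<subseteq> (\<Union>g\<in>Gs. \<Union>(V, f)\<in>\<C>. (\<lambda>x. \<mu> (g \<otimes> x)) ` chart_core V f)" "d \<le> def_dim n K"
    by (rule covering) blast
  have K: "definable M n K" "K \<subseteq> carrier U" "K \<noteq> {}" using dsub_K \<mu>(1)[OF one_closed] by (auto simp: dsub_def)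
  \<comment> \<open>Charts of the quotient must map to the dimension of the quotient. One inequality
    is monotonicity, the other is the lower bound on the dimension of \<open>K\<close> obtained with
    the covering.\<close>
  have dK: "vdim M n (carrier KG) = d"
    unfolding KG_simps using vdim_mono[OF K] def_dim_le_vdim[OF K(1) subset_refl K(3)] GC(6) by (simp add: d_def)
  define \<V> where "\<V> = (\<lambda>(g, V, f). (\<lambda>x. \<mu> (g \<otimes> x)) ` chart_core V f) ` (Gs \<times> \<C>)"
  have fin: "finite \<V>" using GC by (simp add: \<V>_def)
  have each: "definable M n C \<and> openin TK C \<and> (\<exists>h W. definable_fun M n d C h \<and> openin (tuple_topology d) W \<and>
      homeomorphic_map (subtopology TK C) (subtopology (tuple_topology d) W) h)" if C: "C \<in> \<V>" for C
  proof -
    obtain g V f where gVf: "g \<in> Gs" "(V, f) \<in> \<C>" "C = (\<lambda>x. \<mu> (g \<otimes> x)) ` chart_core V f"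
      using C by (auto simp: \<V>_def)
    obtain W where ch: "chart V f W" using GC(4) gVf(2) by blast
    have g: "g \<in> carrier U" using gVf(1) GC(2) by blast
    show ?thesis unfolding gVf(3) using chart_KG[OF ch g] core_facts(1)[OF ch] by blast
  qed
  have "\<Union>\<V> = K"
  proof
    show "\<Union>\<V> \<subseteq> K" using each openin_subset topspace_TK by blast
    show "K \<subseteq> \<Union>\<V>"
    proof
      fix x assume "x \<in> K"
      then obtain g V f where "g \<in> Gs" "(V, f) \<in> \<C>" "x \<in> (\<lambda>x. \<mu> (g \<otimes> x)) ` chart_core V f" using GC(5) by blast
      then show "x \<in> \<Union>\<V>" unfolding \<V>_def by (intro UnionI[of "(\<lambda>x. \<mu> (g \<otimes> x)) ` chart_core V f"] image_eqI[of _ _ "(g, V, f)"]) auto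
    qed
  qed
  moreover have "small \<kappa> \<V>" by (rule small_countable[OF suff_sat countable_finite[OF fin]])
  ultimately show ?thesis
    unfolding canonical_group_topology_def dK Let_def
    using each topspace_TK cont_mult_KG cont_inv_KG by (auto simp: KG_simps(1) intro!: exI[of _ \<V>])
qed

end

section \<open>Curves\<close>

lemma DP_cons_mem: "definable M (1 + m) G \<Longrightarrow> sterm UNIV s \<Longrightarrow> tterm UNIV m t \<Longrightarrow> DP M (\<lambda>E. s E # t E \<in> G)"
  by (rule DP_mem[where n = "1 + m"]) (auto intro: tterm_Cons)

lemma definable_cons:
  assumes "DP M (\<lambda>E. R (E 0 0) (tup m (E 1)))" "\<And>t y. R t y \<Longrightarrow> length y = m" "D = {t # y |t y. R t y}"
  shows "definable M (1 + m) D"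
proof (rule definable_append2[where R = "\<lambda>x y. length x = 1 \<and> R (hd x) y"])
  show "DP M (\<lambda>E. length (tup 1 (E 0)) = 1 \<and> R (hd (tup 1 (E 0))) (tup m (E 1)))"
    using assms(1) by (simp add: tup_Suc_0)
  show "D = {x @ y |x y. length x = 1 \<and> R (hd x) y}"
    unfolding assms(3)
  proof safe
    fix t y assume "R t y"
    then show "\<exists>x ya. t # y = x @ ya \<and> length x = 1 \<and> R (hd x) ya" by (intro exI[of _ "[t]"] exI[of _ y]) simp
  next
    fix x y assume "length x = (1::nat)" "R (hd x) y"
    then show "\<exists>t ya. x @ y = t # ya \<and> R t ya" by (cases x) auto
  qed
qed (use assms(2) in auto)

lemma DP_curve:
  assumes "definable M (1 + m) {t # \<gamma> t |t. t \<in> J}" "sterm UNIV s" "tterm UNIV m u"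
  shows "DP M (\<lambda>E. s E \<in> J \<and> \<gamma> (s E) = u E)"
  by (rule dpred_cong[OF DP_cons_mem[OF assms]]) auto

context omin
begin

text \<open>Cutting the interval at the nearest point of \<open>B\<close> keeps the filter of the
  chosen end. At infinity the interval becomes a ray.\<close>

lemma interval_end_avoid:
  assumes "interval_end I F" "finite (B::'a set)" shows "\<exists>J\<subseteq>I. interval_end J F \<and> J \<inter> B = {}"
proof -
  have right: "\<exists>c. a < c \<and> c \<le> b \<and> {a<..<c} \<inter> B = {}" if "a < b" for a b
  proof -
    let ?S = "insert b {x \<in> B. a < x}"
    have fin: "finite ?S" using assms(2) by simp
    have "Min ?S \<in> ?S" by (rule Min_in[OF fin]) simp
    moreover have "\<And>x. x \<in> ?S \<Longrightarrow> Min ?S \<le> x" by (rule Min_le[OF fin])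
    ultimately show ?thesis using that by (intro exI[of _ "Min ?S"]) (fastforce simp: not_less)
  qed
  have left: "\<exists>c. c < b \<and> a \<le> c \<and> {c<..<b} \<inter> B = {}" if "a < b" for a b
  proof -
    let ?S = "insert a {x \<in> B. x < b}"
    have fin: "finite ?S" using assms(2) by simp
    have "Max ?S \<in> ?S" by (rule Max_in[OF fin]) simp
    moreover have "\<And>x. x \<in> ?S \<Longrightarrow> x \<le> Max ?S" by (rule Max_ge[OF fin])
    ultimately show ?thesis using that by (intro exI[of _ "Max ?S"]) (fastforce simp: not_less)
  qed
  have top: "\<exists>c. a \<le> c \<and> {c<..} \<inter> B = {}" for a
  proof -
    have fin: "finite (insert a B)" using assms(2) by simp
    show ?thesis using Max_ge[OF fin] by (intro exI[of _ "Max (insert a B)"]) (fastforce simp: not_less)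
  qed
  have bot: "\<exists>c. c \<le> a \<and> {..<c} \<inter> B = {}" for a
  proof -
    have fin: "finite (insert a B)" using assms(2) by simp
    show ?thesis using Min_le[OF fin] by (intro exI[of _ "Min (insert a B)"]) (fastforce simp: not_less)
  qed
  from assms(1) show ?thesis
  proof cases
    case (1 a b)
    then obtain c where "a < c" "c \<le> b" "{a<..<c} \<inter> B = {}" using right by blast
    then show ?thesis using 1 interval_end.intros(1)[of a c] by (intro exI[of _ "{a<..<c}"]) auto
  next
    case (2 a b)
    then obtain c where "c < b" "a \<le> c" "{c<..<b} \<inter> B = {}" using left by blast
    then show ?thesis using 2 interval_end.intros(2)[of c b] by (intro exI[of _ "{c<..<b}"]) auto
  next
    case (3 a)
    obtain b where "a < b" using ex_gt by blast
    then obtain c where "a < c" "{a<..<c} \<inter> B = {}" using right by blast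
    then show ?thesis using 3 interval_end.intros(1)[of a c] by (intro exI[of _ "{a<..<c}"]) auto
  next
    case (4 a)
    obtain c where "a \<le> c" "{c<..} \<inter> B = {}" using top by blast
    then show ?thesis using 4 interval_end.intros(4)[of c] by (intro exI[of _ "{c<..}"]) auto
  next
    case (5 b)
    obtain c where "c \<le> b" "{..<c} \<inter> B = {}" using bot by blast
    then show ?thesis using 5 interval_end.intros(5)[of c] by (intro exI[of _ "{..<c}"]) auto
  next
    case (6 b)
    obtain a where "a < b" using ex_lt by blast
    then obtain c where "c < b" "{c<..<b} \<inter> B = {}" using left by blast
    then show ?thesis using 6 interval_end.intros(2)[of c b] by (intro exI[of _ "{c<..<b}"]) auto
  next
    case 7
    obtain c where "{..<c} \<inter> B = {}" using bot by blast
    then show ?thesis using 7 interval_end.intros(5)[of c] by (intro exI[of _ "{..<c}"]) auto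
  next
    case 8
    obtain c where "{c<..} \<inter> B = {}" using top by blast
    then show ?thesis using 8 interval_end.intros(4)[of c] by (intro exI[of _ "{c<..}"]) auto
  qed
qed

lemma interval_end_facts:
  assumes "interval_end J (F::'a filter)"
  shows "eventually (\<lambda>t. t \<in> J) F" "\<And>x y z. x \<in> J \<Longrightarrow> z \<in> J \<Longrightarrow> x \<le> y \<Longrightarrow> y \<le> z \<Longrightarrow> y \<in> J"
    "J \<noteq> {}" "DP M (\<lambda>E. E 0 0 \<in> J)"
proof -
  have top: "eventually (\<lambda>t. c < t) at_top" for c :: 'a
  proof -
    obtain b where "c < b" using ex_gt by blast
    then show ?thesis unfolding eventually_at_top_linorder by (intro exI[of _ b]) auto
  qed
  have bot: "eventually (\<lambda>t. t < c) at_bot" for c :: 'a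
  proof -
    obtain b where "b < c" using ex_lt by blast
    then show ?thesis unfolding eventually_at_bot_linorder by (intro exI[of _ b]) auto
  qed
  have right: "eventually (\<lambda>t. t \<in> {a<..<b}) (at_right a)" "eventually (\<lambda>t. t \<in> {a<..}) (at_right a)" if "a < b" for a b :: 'a
    unfolding eventually_at_right[OF that] using that by auto
  have left: "eventually (\<lambda>t. t \<in> {a<..<b}) (at_left b)" "eventually (\<lambda>t. t \<in> {..<b}) (at_left b)" if "a < b" for a b :: 'a
    unfolding eventually_at_left[OF that] using that by auto
  from assms show "eventually (\<lambda>t. t \<in> J) F"
  proof cases
    case (3 a)
    obtain b where "a < b" using ex_gt by blast
    then show ?thesis using 3 right by simp
  next
    case (6 b)
    obtain a where "a < b" using ex_lt by blast
    then show ?thesis using 6 left by simp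
  qed (use top bot right left in \<open>simp_all\<close>)
  from assms show "\<And>x y z. x \<in> J \<Longrightarrow> z \<in> J \<Longrightarrow> x \<le> y \<Longrightarrow> y \<le> z \<Longrightarrow> y \<in> J" by cases auto
  from assms show "J \<noteq> {}"
  proof cases
    case (1 a b) then show ?thesis using dense_order[of a b] by auto
  next
    case (2 a b) then show ?thesis using dense_order[of a b] by auto
  next
    case (3 a) then show ?thesis using ex_gt[of a] by auto
  next
    case (4 a) then show ?thesis using ex_gt[of a] by auto
  next
    case (5 b) then show ?thesis using ex_lt[of b] by auto
  next
    case (6 b) then show ?thesis using ex_lt[of b] by auto
  qed auto
  from assms show "DP M (\<lambda>E. E 0 0 \<in> J)"
    by cases (auto intro!: dpred_conj dpred_less sterm_var sterm_const dpred_const)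
qed

text \<open>The sets of the family have finitely many boundary points altogether; beyond these,
  membership in each set is constant.\<close>

lemma interval_end_decide:
  assumes J: "interval_end J F" and S: "finite \<S>" "\<And>S. S \<in> \<S> \<Longrightarrow> DP M (\<lambda>E. E 0 0 \<in> S)"
  shows "\<exists>J'\<subseteq>J. interval_end J' F \<and> (\<forall>S\<in>\<S>. J' \<subseteq> S \<or> J' \<inter> S = {})"
proof -
  have "finite (\<Union>S\<in>\<S>. bd S)" using S finite_bd by blast
  from interval_end_avoid[OF J this] obtain J' where J': "J' \<subseteq> J" "interval_end J' F" "J' \<inter> (\<Union>S\<in>\<S>. bd S) = {}" by blast
  have "J' \<subseteq> S \<or> J' \<inter> S = {}" if "S \<in> \<S>" for S
  proof (rule disjCI)
    assume "J' \<inter> S \<noteq> {}"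
    then obtain x where x: "x \<in> J'" "x \<in> S" by blast
    have av: "J' \<inter> bd S = {}" using J'(3) that by blast
    show "J' \<subseteq> S"
    proof (rule decided_off_bd[OF S(2)[OF that] _ av x])
      show "v \<in> J'" if "u \<in> J'" "w \<in> J'" "u \<le> v" "v \<le> w" for u v w
        by (rule interval_end_facts(2)[OF J'(2) that])
    qed
  qed
  then show ?thesis using J' by blast
qed

lemma interval_end_cover:
  assumes "interval_end J F" "finite \<S>" "\<And>S. S \<in> \<S> \<Longrightarrow> DP M (\<lambda>E. E 0 0 \<in> S)" "J \<subseteq> \<Union>\<S>"
  shows "\<exists>J'\<subseteq>J. interval_end J' F \<and> (\<exists>S\<in>\<S>. J' \<subseteq> S)"
proof -
  obtain J' where J': "J' \<subseteq> J" "interval_end J' F" "\<forall>S\<in>\<S>. J' \<subseteq> S \<or> J' \<inter> S = {}"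
    using interval_end_decide[OF assms(1-3)] by blast
  obtain t where "t \<in> J'" using interval_end_facts(3)[OF J'(2)] by blast
  then obtain S where "S \<in> \<S>" "t \<in> S" using assms(4) J'(1) by blast
  then show ?thesis using J' \<open>t \<in> J'\<close> by blast
qed

definition cont_at :: "('a \<Rightarrow> 'a) \<Rightarrow> 'a set \<Rightarrow> 'a \<Rightarrow> bool" where
  "cont_at f S t \<longleftrightarrow> (\<forall>c e. c < f t \<and> f t < e \<longrightarrow> loc (\<lambda>x. x \<in> S \<and> c < f x \<and> f x < e) t)"

text \<open>The set of discontinuities is definable, so if infinite it would contain a point generic
  over the parameters of \<open>f\<close>, where \<open>f\<close> is continuous.\<close>

lemma finite_discontinuities:
  assumes f: "DP M (\<lambda>E. E 0 0 \<in> S \<and> f (E 0 0) = E 1 0)"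
  shows "finite {t \<in> S. \<not> cont_at f S t}"
proof (rule ccontr)
  let ?D = "{t \<in> S. \<not> cont_at f S t}"
  assume inf: "infinite ?D"
  note f' = dpred_app2[where P = "\<lambda>x y. x \<in> S \<and> f x = y", OF f]
  \<comment> \<open>Failure of \<open>cont_at\<close>, with every value of \<open>f\<close> replaced
    by a variable tied to it through the graph.\<close>
  let ?Q = "\<lambda>t. \<exists>y. (t \<in> S \<and> f t = y) \<and> (\<exists>c. \<exists>e. (c < y \<and> y < e) \<and>
      \<not> (\<exists>a. \<exists>b. (a < t \<and> t < b) \<and> (\<forall>x. a < x \<and> x < b \<longrightarrow> (\<exists>z. (x \<in> S \<and> f x = z) \<and> c < z \<and> z < e))))"
  have "DP M (\<lambda>E. ?Q (E 0 0))"
    by (rule dpred_ex[where k = 1 and j = 0], rule dpred_conj[OF f'[OF sterm_var sterm_var]],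
        rule dpred_ex[where k = 2 and j = 0], rule dpred_ex[where k = 3 and j = 0],
        intro dpred_conj dpred_less sterm_var, rule dpred_not,
        rule dpred_ex[where k = 4 and j = 0], rule dpred_ex[where k = 5 and j = 0],
        intro dpred_conj dpred_less sterm_var, rule dpred_all[where k = 6 and j = 0],
        intro dpred_imp dpred_conj dpred_less sterm_var, rule dpred_ex[where k = 7 and j = 0],
        rule dpred_conj[OF f'[OF sterm_var sterm_var]], intro dpred_conj dpred_less sterm_var) simp_all
  moreover have "?Q t \<longleftrightarrow> t \<in> ?D" for t
    unfolding cont_at_def loc_def by auto
  ultimately have D: "udef full UNIV ?D" by (rule dpred_cong)
  have "definable M (1 + 1) {t # y |t y. t \<in> S \<and> [f t] = y}"
  proof (rule definable_cons[where R = "\<lambda>t y. t \<in> S \<and> [f t] = y"])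
    show "DP M (\<lambda>E. E 0 0 \<in> S \<and> [f (E 0 0)] = tup 1 (E 1))" using f by (simp add: tup_Suc_0)
  qed auto
  then obtain F R A where FRA: "finite F" "finite R" "finite A" "dset M (F, R) A (1 + 1) {t # y |t y. t \<in> S \<and> [f t] = y}"
    by (rule definable_imp_dset)
  interpret P: pregeo \<kappa> M "(F, R)" by unfold_locales (use FRA in \<open>auto intro: countable_finite\<close>)
  have "tterm A (Suc (Suc 0)) (\<lambda>E. [E 0 0, E 1 0])" by (intro tterm_Cons tterm_Nil sterm_var)
  then have "tterm A (1 + 1) (\<lambda>E. [E 0 0, E 1 0])" by simp
  from dpred_mem[OF FRA(4) this]
  have "dpred M (F, R) A (\<lambda>E. [E 0 0, E 1 0] \<in> {t # y |t y. t \<in> S \<and> [f t] = y})" .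
  then have fA: "dpred M (F, R) A (\<lambda>E. E 0 0 \<in> S \<and> f (E 0 0) = E 1 0)"
    by (rule dpred_cong) auto
  have cA: "countable A" using FRA(3) by (rule countable_finite)
  obtain a where a: "a \<in> ?D" "a \<notin> P.dcl A" using P.generic_exists[OF D inf cA] by blast
  have "cont_at f S a" unfolding cont_at_def using P.generic_continuous[OF fA _ a(2) cA] a(1) by blast
  then show False using a(1) by blast
qed

lemma loc_all_finite: "finite I \<Longrightarrow> (\<And>i. i \<in> I \<Longrightarrow> loc (P i) t) \<Longrightarrow> loc (\<lambda>x. \<forall>i\<in>I. P i x) t"
proof (induction I rule: finite_induct)
  case empty
  obtain a where "a < t" using ex_lt by blast
  moreover obtain b where "t < b" using ex_gt by blast
  ultimately show ?case unfolding loc_def by auto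
next
  case (insert i I)
  then have "loc (\<lambda>x. P i x \<and> (\<forall>i\<in>I. P i x)) t" by (intro loc_conj) auto
  then show ?case by (rule loc_mono) auto
qed

end

text \<open>The counterpart of \<open>dpred_abstract\<close> for sets of tuples: the parameter
  \<open>a\<close> becomes a new leading coordinate, so \<open>S\<close> is a fibre of a set
  definable over \<open>A\<close> alone.\<close>

lemma (in pregeo) dset_abstract:
  assumes "dset M L (insert a A) k S"
  shows "\<exists>H. dset M L A (Suc k) H \<and> (\<forall>y. a # y \<in> H \<longleftrightarrow> y \<in> S)"
proof -
  have S: "dpred M L (insert a A) (\<lambda>E. tup k (E 0) \<in> S)" "\<forall>y\<in>S. length y = k" using assms by (auto simp: dset_def)
  obtain R where R: "dpred M L A R" "\<And>E f. f 0 = a \<Longrightarrow> tup k (E 0) \<in> S \<longleftrightarrow> R (case_nat f E)"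
    using S(1) by (rule dpred_abstract) blast
  define \<sigma> :: "nat \<Rightarrow> nat \<Rightarrow> 'a slot" where "\<sigma> i j = (case i of 0 \<Rightarrow> Inl (0, 0) | Suc i' \<Rightarrow> if j < k then Inl (0, Suc j) else Inr 0)" for i j
  have "\<sigma> i j \<in> slots A" for i j by (auto simp: \<sigma>_def slots_def split: nat.splits)
  from dpred_reindex[OF R(1) this]
  have *: "dpred M L A (\<lambda>E. R (\<lambda>i j. slot_val E (\<sigma> i j)))" .
  define env where "env z = (\<lambda>i j. case i of 0 \<Rightarrow> hd z | Suc i' \<Rightarrow> if j < k then tl z ! j else 0)" for z :: "'a list" and i j :: nat
  have "(\<lambda>i j. slot_val E (\<sigma> i j)) = env (tup (Suc k) (E 0))" for E
    by (auto simp: fun_eq_iff \<sigma>_def env_def nth_tl hd_conv_nth tup_def simp del: upt_Suc split: nat.splits)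
  then have "dpred M L A (\<lambda>E. R (env (tup (Suc k) (E 0))))" using * by simp
  then have "dset M L A (Suc k) {z. length z = Suc k \<and> R (env z)}" by (rule dsetI)
  moreover have "a # y \<in> {z. length z = Suc k \<and> R (env z)} \<longleftrightarrow> y \<in> S" for y
  proof (cases "length y = k")
    case True
    let ?E = "\<lambda>(i::nat) j. if j < k then y ! j else 0"
    have "env (a # y) = case_nat (\<lambda>_. a) ?E" by (auto simp: fun_eq_iff env_def split: nat.splits)
    moreover have "tup k (?E 0) = y" using True by (simp add: list_eq_iff_nth_eq)
    ultimately show ?thesis using R(2)[of "\<lambda>_. a" ?E] True by simp
  qed (use S(2) in auto)
  ultimately show ?thesis by blast
qed

text \<open>Definable choice along a curve: the fibre over \<open>t\<close> contains a tuple in the definable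
  closure of \<open>t\<close>, and by saturation finitely many formulas produce such tuples for all \<open>t\<close>; one of
  them works on a whole segment at the given end.\<close>

lemma (in omin) curve_choice:
  assumes J: "interval_end J F" and D: "definable M (1 + k) D" and ne: "\<And>t. t \<in> J \<Longrightarrow> \<exists>z. t # z \<in> D"
  shows "\<exists>J' \<zeta>. J' \<subseteq> J \<and> interval_end J' F \<and> definable M (1 + k) {t # \<zeta> t |t. t \<in> J'} \<and> (\<forall>t\<in>J'. t # \<zeta> t \<in> D)"
proof -
  obtain F0 R0 A0 where A0: "finite F0" "finite R0" "finite A0" "dset M (F0, R0) A0 (1 + k) D"
    using D by (rule definable_imp_dset)
  obtain c :: 'a where c: "c > 0" by (rule ex_pos)
  \<comment> \<open>A positive element is added to the parameters because definable choice on rays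
    needs one.\<close>
  define A where "A = insert c A0"
  interpret P: pregeo \<kappa> M "(F0, R0)" by unfold_locales (use A0 in \<open>auto intro: countable_finite\<close>)
  have DA: "dset M (F0, R0) A (Suc k) D" using dset_mono[OF A0(4), of "(F0, R0)" A] by (auto simp: A_def)
  have len: "length z = k" if "t # z \<in> D" for t z using definable_length[OF D that] by simp
  define \<H> where "\<H> = {H. dset M (F0, R0) A (Suc k) H}"
  have cH: "countable \<H>" unfolding \<H>_def
    by (intro countable_dsets countable_finite) (use A0 in \<open>auto simp: A_def\<close>)
  have dH: "definable M (1 + k) H" if "H \<in> \<H>" for H using that dset_imp_definable unfolding \<H>_def by fastforce
  \<comment> \<open>\<open>H\<close> ranges over all sets definable over \<open>A\<close> and need
    not be a graph. \<open>good H\<close> keeps the points over which its fibre is a single tuple,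
    and one in \<open>D\<close>.\<close>
  define good where "good H = {t. \<exists>z. length z = k \<and> ((t # z \<in> D \<and> t # z \<in> H) \<and>
     \<not> (\<exists>z'. length z' = k \<and> (t # z' \<in> H \<and> \<not> z' = z)))}" for H
  have dg: "DP M (\<lambda>E. E 0 0 \<in> good H)" if H: "H \<in> \<H>" for H
    unfolding good_def mem_Collect_eq
    by (rule dpred_ex_tuple[where k = 1],
        intro dpred_conj DP_cons_mem[OF D sterm_var tterm_tup] DP_cons_mem[OF dH[OF H] sterm_var tterm_tup],
        rule dpred_not, rule dpred_ex_tuple[where k = 2],
        intro dpred_conj DP_cons_mem[OF dH[OF H] sterm_var tterm_tup] dpred_not dpred_eq_tuple[OF tterm_tup tterm_tup]) simp_all
  have cover: "\<exists>H\<in>\<H>. t \<in> good H" if t: "t \<in> J" for t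
  proof -
    let ?D = "{z. length z = k \<and> t # z \<in> D}"
    have "dset M (F0, R0) (insert t A) (Suc k) D" by (rule dset_mono[OF DA]) auto
    then have "dpred M (F0, R0) (insert t A) (\<lambda>E. t # tup k (E 0) \<in> D)"
      by (rule dpred_mem) (intro tterm_Cons sterm_const tterm_tup, simp)
    then have dD: "dset M (F0, R0) (insert t A) k ?D" by (rule dsetI)
    have "?D \<noteq> {}" using ne[OF t] len by blast
    moreover have "c \<in> P.dcl (insert t A)" using P.subset_dcl[of "insert t A"] by (auto simp: A_def)
    ultimately obtain z where z: "z \<in> ?D" "set z \<subseteq> P.dcl (insert t A)" using P.dcl_meets_tuple[OF dD _ _ c] by blast
    have "dpred M (F0, R0) (insert t A \<union> set z) (\<lambda>E. tup k (E 0) = z)"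
      by (rule dpred_eq_tuple[OF tterm_tup tterm_const]) (use z(1) in auto)
    then have "dpred M (F0, R0) (insert t A) (\<lambda>E. tup k (E 0) = z)" by (rule P.dpred_dcl_elim[OF _ z(2)])
    then have "dset M (F0, R0) (insert t A) k {z}" unfolding dset_def using z(1) by simp
    from P.dset_abstract[OF this] obtain H where H: "dset M (F0, R0) A (Suc k) H" "\<forall>y. t # y \<in> H \<longleftrightarrow> y \<in> {z}" by blast
    have "t \<in> good H" unfolding good_def using z(1) H(2) by (intro CollectI exI[of _ z]) auto
    then show ?thesis using H(1) unfolding \<H>_def by blast
  qed
  have dJ: "definable M (Suc 0) ((\<lambda>x. [x]) ` J)"
    using dset_imp_definable[OF udef_dset[OF interval_end_facts(4)[OF J]]] .
  obtain \<F> where \<F>: "\<F> \<subseteq> (\<lambda>H. (\<lambda>x. [x]) ` good H) ` \<H>" "finite \<F>" "(\<lambda>x. [x]) ` J \<subseteq> \<Union>\<F>"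
  proof (rule definable_finite_cover[OF suff_sat dJ])
    show "small \<kappa> ((\<lambda>H. (\<lambda>x. [x]) ` good H) ` \<H>)" by (intro small_countable[OF suff_sat] countable_image cH)
    show "definable M (Suc 0) C" if C: "C \<in> (\<lambda>H. (\<lambda>x. [x]) ` good H) ` \<H>" for C
    proof -
      obtain H where "H \<in> \<H>" "C = (\<lambda>x. [x]) ` good H" using C by blast
      then show ?thesis using dset_imp_definable[OF udef_dset[OF dg]] by simp
    qed
    show "(\<lambda>x. [x]) ` J \<subseteq> \<Union> ((\<lambda>H. (\<lambda>x. [x]) ` good H) ` \<H>)" using cover by blast
  qed
  obtain \<G> where \<G>: "\<G> \<subseteq> \<H>" "finite \<G>" "\<F> = (\<lambda>H. (\<lambda>x. [x]) ` good H) ` \<G>" using finite_subset_image[OF \<F>(2,1)] by blast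
  have "J \<subseteq> \<Union> (good ` \<G>)"
  proof
    fix t assume "t \<in> J"
    then have "[t] \<in> \<Union>\<F>" using \<F>(3) by blast
    then show "t \<in> \<Union> (good ` \<G>)" unfolding \<G>(3) by auto
  qed
  moreover have "finite (good ` \<G>)" using \<G>(2) by simp
  moreover have "DP M (\<lambda>E. E 0 0 \<in> S)" if "S \<in> good ` \<G>" for S using that \<G>(1) dg by blast
  ultimately obtain J' S where J': "J' \<subseteq> J" "interval_end J' F" "S \<in> good ` \<G>" "J' \<subseteq> S"
    using interval_end_cover[OF J, of "good ` \<G>"] by blast
  obtain H where H: "H \<in> \<H>" "J' \<subseteq> good H" using J'(3,4) \<G>(1) by blast
  define \<zeta> where "\<zeta> t = (THE z. t # z \<in> H)" for t
  have lenH: "length z = k" if "t # z \<in> H" for t z using definable_length[OF dH[OF H(1)] that] by simp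
  have \<zeta>: "t # \<zeta> t \<in> D" "\<And>z. t # z \<in> H \<longleftrightarrow> z = \<zeta> t" if t: "t \<in> J'" for t
  proof -
    have "t \<in> good H" using t H(2) by blast
    then obtain z where z: "length z = k" "t # z \<in> D" "t # z \<in> H" "\<not> (\<exists>z'. length z' = k \<and> (t # z' \<in> H \<and> \<not> z' = z))"
      unfolding good_def by blast
    have u: "z' = z" if "t # z' \<in> H" for z' using z(4) lenH[OF that] that by blast
    have e: "\<zeta> t = z" unfolding \<zeta>_def by (rule the_equality[of "\<lambda>z. t # z \<in> H", OF z(3)]) (rule u)
    show "t # \<zeta> t \<in> D" unfolding e by (rule z(2))
    show "t # y \<in> H \<longleftrightarrow> y = \<zeta> t" for y unfolding e using z(3) u[of y] by blast
  qed
  have "definable M (1 + k) {t # \<zeta> t |t. t \<in> J'}"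
  proof (rule definable_cons[where R = "\<lambda>t z. t \<in> J' \<and> t # z \<in> H"])
    show "DP M (\<lambda>E. E 0 0 \<in> J' \<and> E 0 0 # tup k (E 1) \<in> H)"
      by (intro dpred_conj interval_end_facts(4)[OF J'(2)] DP_cons_mem[OF dH[OF H(1)] sterm_var tterm_tup])
    show "length y = k" if "t \<in> J' \<and> t # y \<in> H" for t y using that lenH by blast
    have eq: "(t \<in> J' \<and> t # z \<in> H) \<longleftrightarrow> (t \<in> J' \<and> z = \<zeta> t)" for t z using \<zeta>(2) by blast
    show "{t # \<zeta> t |t. t \<in> J'} = {t # z |t z. t \<in> J' \<and> t # z \<in> H}" unfolding eq by blast
  qed
  then show ?thesis using J'(1,2) \<zeta>(1) by blast
qed

section \<open>Limits of definable curves in the group\<close>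

context vtop
begin

text \<open>Continuity is not demanded, since the curves produced by definable choice come without
  it.\<close>

definition curve :: "'a set \<Rightarrow> ('a \<Rightarrow> 'a list) \<Rightarrow> 'a list set \<Rightarrow> bool" where
  "curve J \<gamma> C \<longleftrightarrow> \<gamma> ` J \<subseteq> C \<and> definable M (1 + n) {t # \<gamma> t |t. t \<in> J}"

text \<open>The end \<open>F\<close> is fixed while the interval varies: a limit depends only on the
  curve near the end, so intervals may be shrunk at will.\<close>

definition has_limits :: "'a filter \<Rightarrow> 'a list set \<Rightarrow> bool" where
  "has_limits F C \<longleftrightarrow> (\<forall>J \<gamma>. interval_end J F \<and> curve J \<gamma> C \<longrightarrow> (\<exists>l\<in>C. limitin T \<gamma> l F))"

lemma curve_restrict:
  assumes "curve J \<gamma> C" "interval_end J' F" "J' \<subseteq> J" "\<gamma> ` J' \<subseteq> C'" "dsub C"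
  shows "curve J' \<gamma> C'"
  unfolding curve_def
proof (intro conjI assms(4) definable_cons[where R = "\<lambda>t y. t \<in> J' \<and> (t \<in> J \<and> \<gamma> t = y)"])
  show "DP M (\<lambda>E. E 0 0 \<in> J' \<and> (E 0 0 \<in> J \<and> \<gamma> (E 0 0) = tup n (E 1)))"
    by (intro dpred_conj[OF interval_end_facts(4)[OF assms(2)]] DP_curve[OF _ sterm_var tterm_tup])
       (use assms(1) in \<open>simp add: curve_def\<close>)
  show "length y = n" if "t \<in> J' \<and> (t \<in> J \<and> \<gamma> t = y)" for t y
    using that assms(1) dsub_length[OF assms(5)] unfolding curve_def by blast
  show "{t # \<gamma> t |t. t \<in> J'} = {t # y |t y. t \<in> J' \<and> (t \<in> J \<and> \<gamma> t = y)}" using assms(3) by blast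
qed

lemma curve_preimage:
  assumes "curve J \<gamma> C" "dsub C" "definable M n V" shows "DP M (\<lambda>E. E 0 0 \<in> {t \<in> J. \<gamma> t \<in> V})"
proof -
  have "DP M (\<lambda>E. \<exists>y\<in>V. E 0 0 \<in> J \<and> \<gamma> (E 0 0) = y)"
    by (rule DP_bex[OF assms(3), where k = 1], intro dpred_imp DP_mem[OF assms(3) tterm_tup] DP_curve[OF _ sterm_var tterm_tup])
       (use assms(1) in \<open>simp_all add: curve_def\<close>)
  then show ?thesis by (rule dpred_cong) auto
qed

text \<open>Definable compactness speaks of continuous curves, so continuity has to be found. Near
  the end the curve stays in one of finitely many charts, and its coordinates there have finitely
  many discontinuities; past all of them it is continuous for \<open>T\<close>.\<close>

lemma has_limits_compact:
  assumes Z: "definably_compact M n T Z" shows "has_limits F Z"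
  unfolding has_limits_def
proof (intro allI impI)
  fix J \<gamma> assume "interval_end J F \<and> curve J \<gamma> Z"
  then have J: "interval_end J F" and \<gamma>: "curve J \<gamma> Z" by auto
  have dZ: "dsub Z" using Z topspace_T by (simp add: definably_compact_def dsub_def)
  obtain \<V> where \<V>: "finite \<V>" "Z \<subseteq> \<Union>\<V>" "\<forall>V\<in>\<V>. \<exists>f W. chart V f W" using finite_charts[OF dZ] by blast
  have "J \<subseteq> \<Union> ((\<lambda>V. {t \<in> J. \<gamma> t \<in> V}) ` \<V>)" using \<V>(2) \<gamma> unfolding curve_def by blast
  moreover have "finite ((\<lambda>V. {t \<in> J. \<gamma> t \<in> V}) ` \<V>)" using \<V>(1) by simp
  moreover have "DP M (\<lambda>E. E 0 0 \<in> S)" if S: "S \<in> (\<lambda>V. {t \<in> J. \<gamma> t \<in> V}) ` \<V>" for S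
  proof -
    obtain V where V: "V \<in> \<V>" "S = {t \<in> J. \<gamma> t \<in> V}" using S by blast
    then have "definable M n V" using \<V>(3) unfolding chart_def dsub_def by blast
    then show ?thesis unfolding V(2) by (rule curve_preimage[OF \<gamma> dZ])
  qed
  ultimately obtain J1 S where J1: "J1 \<subseteq> J" "interval_end J1 F" "S \<in> (\<lambda>V. {t \<in> J. \<gamma> t \<in> V}) ` \<V>" "J1 \<subseteq> S"
    using interval_end_cover[OF J, of "(\<lambda>V. {t \<in> J. \<gamma> t \<in> V}) ` \<V>"] by blast
  then obtain V f W where V: "V \<in> \<V>" "J1 \<subseteq> {t \<in> J. \<gamma> t \<in> V}" "chart V f W" using \<V>(3) by blast
  note cf = chart_facts[OF V(3)]
  define \<phi> where "\<phi> i t = f (\<gamma> t) ! i" for i t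
  have inV: "\<gamma> t \<in> V" "t \<in> J" if "t \<in> J1" for t using V(2) that by auto
  have d\<phi>: "DP M (\<lambda>E. E 0 0 \<in> J1 \<and> \<phi> i (E 0 0) = E 1 0)" if i: "i < d" for i
  proof -
    have g: "definable M (1 + n) {t # \<gamma> t |t. t \<in> J}" using \<gamma> by (simp add: curve_def)
    have "DP M (\<lambda>E. E 0 0 \<in> J1 \<and> (\<exists>x. length x = n \<and> ((E 0 0 \<in> J \<and> \<gamma> (E 0 0) = x) \<and>
        (\<exists>y. length y = d \<and> (x @ y \<in> {x @ f x |x. x \<in> V} \<and> y ! i = E 1 0)))))"
    proof (rule dpred_conj[OF interval_end_facts(4)[OF J1(2)]], rule dpred_ex_tuple[where k = 2],
        rule dpred_conj[OF DP_curve[OF g sterm_var tterm_tup]], rule dpred_ex_tuple[where k = 3], rule dpred_conj)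
      show "DP M (\<lambda>E. tup n (E 2) @ tup d (E 3) \<in> {x @ f x |x. x \<in> V})"
        by (rule DP_mem[OF cf(5) tterm_append[OF tterm_tup tterm_tup]])
      show "DP M (\<lambda>E. tup d (E 3) ! i = E 1 0)" by (rule dpred_eq[OF tterm_nth[OF tterm_tup i] sterm_var])
    qed simp_all
    then show ?thesis
    proof (rule dpred_cong)
      fix E :: "nat \<Rightarrow> nat \<Rightarrow> 'a"
      show "(E 0 0 \<in> J1 \<and> (\<exists>x. length x = n \<and> ((E 0 0 \<in> J \<and> \<gamma> (E 0 0) = x) \<and>
        (\<exists>y. length y = d \<and> (x @ y \<in> {x @ f x |x. x \<in> V} \<and> y ! i = E 1 0))))) = (E 0 0 \<in> J1 \<and> \<phi> i (E 0 0) = E 1 0)"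
      proof (rule conj_cong[OF refl])
        assume t: "E 0 0 \<in> J1"
        have l: "length (\<gamma> (E 0 0)) = n" "length (f (\<gamma> (E 0 0))) = d" using cf(4,6) inV[OF t] by auto
        have eq: "(\<gamma> (E 0 0) @ y \<in> {x @ f x |x. x \<in> V}) \<longleftrightarrow> y = f (\<gamma> (E 0 0))" for y
        proof
          assume "\<gamma> (E 0 0) @ y \<in> {x @ f x |x. x \<in> V}"
          then obtain x where x: "x \<in> V" "\<gamma> (E 0 0) @ y = x @ f x" by blast
          then show "y = f (\<gamma> (E 0 0))" using cf(6)[OF x(1)] l(1) by simp
        qed (use inV[OF t] in blast)
        have e2: "(\<exists>y. length y = d \<and> (\<gamma> (E 0 0) @ y \<in> {x @ f x |x. x \<in> V} \<and> y ! i = E 1 0)) \<longleftrightarrow> \<phi> i (E 0 0) = E 1 0"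
          unfolding eq \<phi>_def using l(2) by blast
        show "(\<exists>x. length x = n \<and> ((E 0 0 \<in> J \<and> \<gamma> (E 0 0) = x) \<and>
          (\<exists>y. length y = d \<and> (x @ y \<in> {x @ f x |x. x \<in> V} \<and> y ! i = E 1 0)))) = (\<phi> i (E 0 0) = E 1 0)"
          unfolding e2[symmetric] using l(1) inV(2)[OF t] by blast
      qed
    qed
  qed
  have "finite (\<Union>i\<in>{..<d}. {t \<in> J1. \<not> cont_at (\<phi> i) J1 t})" using finite_discontinuities[OF d\<phi>] by blast
  from interval_end_avoid[OF J1(2) this] obtain J2 where
    J2: "J2 \<subseteq> J1" "interval_end J2 F" "J2 \<inter> (\<Union>i\<in>{..<d}. {t \<in> J1. \<not> cont_at (\<phi> i) J1 t}) = {}" by blast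
  have ca: "cont_at (\<phi> i) J1 t" if "t \<in> J2" "i < d" for t i using that J2(1,3) by blast
  have "continuous_map (top_of_set J2) T \<gamma>"
    unfolding continuous_map_def
  proof (intro conjI allI impI)
    show "\<gamma> \<in> topspace (top_of_set J2) \<rightarrow> topspace T" using inV J2(1) cf(1) topspace_T by auto
    fix B assume B: "openin T B"
    show "openin (top_of_set J2) {t \<in> topspace (top_of_set J2). \<gamma> t \<in> B}"
    proof (subst openin_subopen, intro ballI)
      fix t assume "t \<in> {t \<in> topspace (top_of_set J2). \<gamma> t \<in> B}"
      then have t: "t \<in> J2" "\<gamma> t \<in> B" by auto
      have tV: "\<gamma> t \<in> V" using inV t(1) J2(1) by blast
      have hm: "homeomorphic_map (subtopology T V) (subtopology (tuple_topology d) W) f" and oV: "openin T V"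
        and oW: "openin (tuple_topology d) W" using V(3) by (auto simp: chart_def)
      have "openin (subtopology T V) (V \<inter> B)" using B oV by (simp add: openin_open_subtopology openin_Int)
      then have "openin (subtopology (tuple_topology d) W) (f ` (V \<inter> B))"
        using homeomorphic_imp_open_map[OF hm] unfolding open_map_def by blast
      then have "openin (tuple_topology d) (f ` (V \<inter> B))" using openin_open_subtopology[OF oW] by blast
      moreover have "f (\<gamma> t) \<in> f ` (V \<inter> B)" using tV t(2) by blast
      ultimately obtain cs ds where cd: "length cs = d" "length ds = d" "f (\<gamma> t) \<in> tbox cs ds" "tbox cs ds \<subseteq> f ` (V \<inter> B)"
        using tbox_in_open by blast
      \<comment> \<open>A box around the image of \<open>\<gamma> t\<close> inside the image of
        \<open>B\<close> turns continuity into conditions on single coordinates, each of which holds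
        on an interval around \<open>t\<close>.\<close>
      have "loc (\<lambda>x. \<forall>i\<in>{..<d}. x \<in> J1 \<and> cs ! i < \<phi> i x \<and> \<phi> i x < ds ! i) t"
      proof (rule loc_all_finite)
        fix i assume "i \<in> {..<d}"
        then have i: "i < d" by simp
        have "cs ! i < \<phi> i t \<and> \<phi> i t < ds ! i" using cd(1,3) i by (simp add: tbox_def \<phi>_def)
        then show "loc (\<lambda>x. x \<in> J1 \<and> cs ! i < \<phi> i x \<and> \<phi> i x < ds ! i) t"
          using ca[OF t(1) i] unfolding cont_at_def by blast
      qed simp
      then obtain a b where ab: "a < t" "t < b" "\<forall>x. a < x \<and> x < b \<longrightarrow> (\<forall>i\<in>{..<d}. x \<in> J1 \<and> cs ! i < \<phi> i x \<and> \<phi> i x < ds ! i)"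
        unfolding loc_def by blast
      have "\<gamma> x \<in> B" if x: "x \<in> J2 \<inter> {a<..<b}" for x
      proof -
        have xV: "\<gamma> x \<in> V" using x J2(1) inV by blast
        have "\<forall>i<d. cs ! i < f (\<gamma> x) ! i \<and> f (\<gamma> x) ! i < ds ! i" using ab(3) x unfolding \<phi>_def by auto
        then have "f (\<gamma> x) \<in> tbox cs ds" using cf(4)[OF xV] cd(1) by (simp add: tbox_def)
        then obtain y where y: "y \<in> V" "y \<in> B" "f (\<gamma> x) = f y" using cd(4) by blast
        then show ?thesis using inj_onD[OF cf(3) y(3) xV y(1)] by simp
      qed
      then have "J2 \<inter> {a<..<b} \<subseteq> {t \<in> topspace (top_of_set J2). \<gamma> t \<in> B}" by auto
      moreover have "openin (top_of_set J2) (J2 \<inter> {a<..<b})" by (rule openin_open_Int) simp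
      moreover have "t \<in> J2 \<inter> {a<..<b}" using t ab by simp
      ultimately show "\<exists>Ta. openin (top_of_set J2) Ta \<and> t \<in> Ta \<and> Ta \<subseteq> {t \<in> topspace (top_of_set J2). \<gamma> t \<in> B}" by blast
    qed
  qed
  moreover have "curve J2 \<gamma> Z"
    by (rule curve_restrict[OF \<gamma> J2(2) _ _ dZ]) (use J2(1) J1(1) \<gamma> in \<open>auto simp: curve_def\<close>)
  ultimately show "\<exists>l\<in>Z. limitin T \<gamma> l F"
    using Z J2(2) unfolding definably_compact_def curve_def by blast
qed

lemma has_limits_one: "has_limits F {\<one>}"
  unfolding has_limits_def
proof (intro allI impI)
  fix J \<gamma> assume h: "interval_end J F \<and> curve J \<gamma> {\<one>}"
  then have "eventually (\<lambda>t. \<gamma> t = \<one>) F"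
    by (intro eventually_mono[OF interval_end_facts(1)[of J F]]) (auto simp: curve_def)
  then show "\<exists>l\<in>{\<one>}. limitin T \<gamma> l F" by (simp add: limitin_eventually topspace_T)
qed

lemma has_limits_Un:
  assumes "has_limits F A" "has_limits F B" "dsub A" "dsub B" shows "has_limits F (A \<union> B)"
  unfolding has_limits_def
proof (intro allI impI)
  fix J \<gamma> assume "interval_end J F \<and> curve J \<gamma> (A \<union> B)"
  then have J: "interval_end J F" and \<gamma>: "curve J \<gamma> (A \<union> B)" by auto
  have dAB: "dsub (A \<union> B)" using assms(3,4) by (rule dsub_Un)
  let ?SA = "{t \<in> J. \<gamma> t \<in> A}" and ?SB = "{t \<in> J. \<gamma> t \<in> B}"
  have "DP M (\<lambda>E. E 0 0 \<in> ?SA)" "DP M (\<lambda>E. E 0 0 \<in> ?SB)"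
    using assms(3,4) by (auto simp: dsub_def intro!: curve_preimage[OF \<gamma> dAB, simplified])
  then have "DP M (\<lambda>E. E 0 0 \<in> S)" if "S \<in> {?SA, ?SB}" for S using that by blast
  moreover have "J \<subseteq> \<Union>{?SA, ?SB}" using \<gamma> by (auto simp: curve_def)
  ultimately obtain J' S where J': "J' \<subseteq> J" "interval_end J' F" "S \<in> {?SA, ?SB}" "J' \<subseteq> S"
    using interval_end_cover[OF J, of "{?SA, ?SB}"] by blast
  then consider "\<gamma> ` J' \<subseteq> A" | "\<gamma> ` J' \<subseteq> B" by blast
  then show "\<exists>l\<in>A \<union> B. limitin T \<gamma> l F"
  proof cases
    case 1
    have "curve J' \<gamma> A" by (rule curve_restrict[OF \<gamma> J'(2,1) 1 dAB])
    then show ?thesis using assms(1) J'(2) unfolding has_limits_def by blast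
  next
    case 2
    have "curve J' \<gamma> B" by (rule curve_restrict[OF \<gamma> J'(2,1) 2 dAB])
    then show ?thesis using assms(2) J'(2) unfolding has_limits_def by blast
  qed
qed

lemma has_limits_inv:
  assumes "has_limits F A" "dsub A" shows "has_limits F (m_inv U ` A)"
  unfolding has_limits_def
proof (intro allI impI)
  fix J \<gamma> assume "interval_end J F \<and> curve J \<gamma> (m_inv U ` A)"
  then have J: "interval_end J F" and \<gamma>: "curve J \<gamma> (m_inv U ` A)" by auto
  have Ac: "A \<subseteq> carrier U" using assms(2) by (auto simp: dsub_def)
  have iA: "dsub (m_inv U ` A)" by (rule dsub_inv[OF assms(2)])
  have one: "tterm UNIV n (\<lambda>E. \<one>)" by (rule tterm_const) (auto simp: length_carrier)
  have g: "definable M (1 + n) {t # \<gamma> t |t. t \<in> J}" using \<gamma> by (simp add: curve_def)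
  have \<gamma>A: "inv (\<gamma> t) \<in> A" "\<gamma> t \<in> m_inv U ` A" "\<gamma> t \<in> carrier U" if t: "t \<in> J" for t
  proof -
    show "\<gamma> t \<in> m_inv U ` A" using \<gamma> t by (auto simp: curve_def)
    then obtain a where "a \<in> A" "\<gamma> t = inv a" by blast
    then show "inv (\<gamma> t) \<in> A" "\<gamma> t \<in> carrier U" using Ac by auto
  qed
  define \<delta> where "\<delta> t = inv (\<gamma> t)" for t
  have "definable M (1 + n) {t # \<delta> t |t. t \<in> J}"
  proof (rule definable_cons[where R = "\<lambda>t y. \<exists>x. length x = n \<and> ((t \<in> J \<and> \<gamma> t = x) \<and> (x \<in> m_inv U ` A \<and> y \<in> A \<and> x \<otimes> y = \<one>))"])
    show "DP M (\<lambda>E. \<exists>x. length x = n \<and> ((E 0 0 \<in> J \<and> \<gamma> (E 0 0) = x) \<and> (x \<in> m_inv U ` A \<and> tup n (E 1) \<in> A \<and> x \<otimes> tup n (E 1) = \<one>)))"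
      by (rule dpred_ex_tuple[where k = 2],
          rule dpred_conj[OF DP_curve[OF g sterm_var tterm_tup] DP_mult[OF iA assms(2) tterm_tup tterm_tup one]]) simp
    show "length y = n" if "\<exists>x. length x = n \<and> ((t \<in> J \<and> \<gamma> t = x) \<and> (x \<in> m_inv U ` A \<and> y \<in> A \<and> x \<otimes> y = \<one>))" for t y
      using that dsub_length[OF assms(2)] by blast
    have "(\<exists>x. length x = n \<and> ((t \<in> J \<and> \<gamma> t = x) \<and> (x \<in> m_inv U ` A \<and> y \<in> A \<and> x \<otimes> y = \<one>))) \<longleftrightarrow> t \<in> J \<and> y = \<delta> t" for t y
    proof (cases "t \<in> J")
      case True
      have "length (\<gamma> t) = n" using \<gamma>A(3)[OF True] by (rule length_carrier)
      moreover have "(y \<in> A \<and> \<gamma> t \<otimes> y = \<one>) \<longleftrightarrow> y = \<delta> t"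
        unfolding \<delta>_def using mult_eq_one_iff[OF \<gamma>A(3)[OF True]] \<gamma>A(1)[OF True] Ac by blast
      ultimately show ?thesis using True \<gamma>A(2) by auto
    qed simp
    then show "{t # \<delta> t |t. t \<in> J} = {t # y |t y. \<exists>x. length x = n \<and> ((t \<in> J \<and> \<gamma> t = x) \<and> (x \<in> m_inv U ` A \<and> y \<in> A \<and> x \<otimes> y = \<one>))}"
      by simp
  qed
  then have "curve J \<delta> A" using \<gamma>A(1) by (auto simp: curve_def \<delta>_def)
  then obtain l where l: "l \<in> A" "limitin T \<delta> l F" using assms(1) J unfolding has_limits_def by blast
  have "limitin T ((\<lambda>x. inv x) \<circ> \<delta>) (inv l) F" by (rule continuous_map_limit[OF cont_inv l(2)])
  moreover have "eventually (\<lambda>t. ((\<lambda>x. inv x) \<circ> \<delta>) t = \<gamma> t) F"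
    by (rule eventually_mono[OF interval_end_facts(1)[OF J]]) (simp add: \<delta>_def \<gamma>A(3))
  ultimately have "limitin T \<gamma> (inv l) F" by (rule limitin_transform_eventually[rotated])
  then show "\<exists>l\<in>m_inv U ` A. limitin T \<gamma> l F" using l(1) by blast
qed

text \<open>Near the end, definable choice splits the curve into definable curves in
  \<open>A\<close> and in \<open>B\<close>. Both have limits, and continuity of the product yields
  the limit of the original curve.\<close>

lemma has_limits_mult:
  assumes "has_limits F A" "has_limits F B" "dsub A" "dsub B" shows "has_limits F (A <#> B)"
  unfolding has_limits_def
proof (intro allI impI)
  fix J \<gamma> assume "interval_end J F \<and> curve J \<gamma> (A <#> B)"
  then have J: "interval_end J F" and \<gamma>: "curve J \<gamma> (A <#> B)" by auto
  have g: "definable M (1 + n) {t # \<gamma> t |t. t \<in> J}" using \<gamma> by (simp add: curve_def)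
  \<comment> \<open>A factorisation of \<open>\<gamma> t\<close> is coded as one tuple of length
    \<open>n + n\<close>, the form to which \<open>curve_choice\<close> applies.\<close>
  let ?R = "\<lambda>t z. t \<in> J \<and> (take n z \<in> A \<and> drop n z \<in> B \<and> take n z \<otimes> drop n z = \<gamma> t) \<and> length z = n + n"
  let ?D = "{t # z |t z. ?R t z}"
  have "definable M (1 + (n + n)) ?D"
  proof (rule definable_cons[where R = ?R])
    have tk: "tterm UNIV n (\<lambda>E. take n (tup (n + n) (E 1)))" "tterm UNIV n (\<lambda>E. drop n (tup (n + n) (E 1)))"
      unfolding tterm_def
      apply (rule exI[of _ "map (\<lambda>j. Inl (1, j)) [0..<n]"], (auto simp: slots_def fun_eq_iff list_eq_iff_nth_eq)[1])
      by (rule exI[of _ "map (\<lambda>j. Inl (1, j)) [n..<n + n]"], auto simp: slots_def fun_eq_iff list_eq_iff_nth_eq)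
    have "DP M (\<lambda>E. \<exists>x. length x = n \<and> ((E 0 0 \<in> J \<and> \<gamma> (E 0 0) = x) \<and> (take n (tup (n + n) (E 1)) \<in> A \<and> drop n (tup (n + n) (E 1)) \<in> B \<and> take n (tup (n + n) (E 1)) \<otimes> drop n (tup (n + n) (E 1)) = x)))"
      by (rule dpred_ex_tuple[where k = 2],
          rule dpred_conj[OF DP_curve[OF g sterm_var tterm_tup] DP_mult[OF assms(3,4) tk tterm_tup]]) simp
    then show "DP M (\<lambda>E. ?R (E 0 0) (tup (n + n) (E 1)))"
    proof (rule dpred_cong)
      fix E :: "nat \<Rightarrow> nat \<Rightarrow> 'a"
      have "length (\<gamma> (E 0 0)) = n" if "E 0 0 \<in> J"
        using that \<gamma> dsub_length[OF dsub_mult[OF assms(3,4)]] by (auto simp: curve_def)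
      then show "(\<exists>x. length x = n \<and> ((E 0 0 \<in> J \<and> \<gamma> (E 0 0) = x) \<and> (take n (tup (n + n) (E 1)) \<in> A \<and> drop n (tup (n + n) (E 1)) \<in> B \<and> take n (tup (n + n) (E 1)) \<otimes> drop n (tup (n + n) (E 1)) = x)))
         = ?R (E 0 0) (tup (n + n) (E 1))" by auto
    qed
  qed auto
  moreover have "\<exists>z. t # z \<in> ?D" if t: "t \<in> J" for t
  proof -
    obtain a b where ab: "a \<in> A" "b \<in> B" "\<gamma> t = a \<otimes> b" using \<gamma> t unfolding curve_def set_mult_def by blast
    then have "length a = n" "length b = n" using dsub_length assms(3,4) by blast+
    then have "?R t (a @ b)" using ab t by simp
    then show ?thesis by blast
  qed
  ultimately obtain J' \<zeta> where J': "J' \<subseteq> J" "interval_end J' F" and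
    z: "definable M (1 + (n + n)) {t # \<zeta> t |t. t \<in> J'}" "\<forall>t\<in>J'. t # \<zeta> t \<in> ?D"
    using curve_choice[OF J, of "n + n" ?D] by blast
  have R: "?R t (\<zeta> t)" if "t \<in> J'" for t using z(2) that by blast
  have "definable M (1 + n) {t # take n (\<zeta> t) |t. t \<in> J'}"
  proof (rule definable_cons[where R = "\<lambda>t x. length x = n \<and> (\<exists>y. length y = n \<and> t # (x @ y) \<in> {t # \<zeta> t |t. t \<in> J'})"])
    show "DP M (\<lambda>E. length (tup n (E 1)) = n \<and> (\<exists>y. length y = n \<and> E 0 0 # (tup n (E 1) @ y) \<in> {t # \<zeta> t |t. t \<in> J'}))"
      by (rule dpred_conj, simp add: dpred_const, rule dpred_ex_tuple[where k = 2],
          rule DP_cons_mem[OF z(1) sterm_var tterm_append[OF tterm_tup tterm_tup]]) simp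
    have "(length x = n \<and> (\<exists>y. length y = n \<and> t # (x @ y) \<in> {t # \<zeta> t |t. t \<in> J'})) \<longleftrightarrow> t \<in> J' \<and> x = take n (\<zeta> t)" for t x
    proof
      assume "length x = n \<and> (\<exists>y. length y = n \<and> t # (x @ y) \<in> {t # \<zeta> t |t. t \<in> J'})"
      then obtain y where "length x = n" "t \<in> J'" "x @ y = \<zeta> t" by auto
      then show "t \<in> J' \<and> x = take n (\<zeta> t)" by (metis append_eq_conv_conj)
    next
      assume h: "t \<in> J' \<and> x = take n (\<zeta> t)"
      then have "length (\<zeta> t) = n + n" using R by blast
      then show "length x = n \<and> (\<exists>y. length y = n \<and> t # (x @ y) \<in> {t # \<zeta> t |t. t \<in> J'})"
        using h by (intro conjI exI[of _ "drop n (\<zeta> t)"]) auto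
    qed
    then show "{t # take n (\<zeta> t) |t. t \<in> J'} = {t # x |t x. length x = n \<and> (\<exists>y. length y = n \<and> t # (x @ y) \<in> {t # \<zeta> t |t. t \<in> J'})}"
      by (simp only:) blast
  qed auto
  then have "curve J' (\<lambda>t. take n (\<zeta> t)) A" using R by (auto simp: curve_def)
  then obtain l where l: "l \<in> A" "limitin T (\<lambda>t. take n (\<zeta> t)) l F" using assms(1) J'(2) unfolding has_limits_def by blast
  have "definable M (1 + n) {t # drop n (\<zeta> t) |t. t \<in> J'}"
  proof (rule definable_cons[where R = "\<lambda>t x. length x = n \<and> (\<exists>y. length y = n \<and> t # (y @ x) \<in> {t # \<zeta> t |t. t \<in> J'})"])
    show "DP M (\<lambda>E. length (tup n (E 1)) = n \<and> (\<exists>y. length y = n \<and> E 0 0 # (y @ tup n (E 1)) \<in> {t # \<zeta> t |t. t \<in> J'}))"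
      by (rule dpred_conj, simp add: dpred_const, rule dpred_ex_tuple[where k = 2],
          rule DP_cons_mem[OF z(1) sterm_var tterm_append[OF tterm_tup tterm_tup]]) simp
    have "(length x = n \<and> (\<exists>y. length y = n \<and> t # (y @ x) \<in> {t # \<zeta> t |t. t \<in> J'})) \<longleftrightarrow> t \<in> J' \<and> x = drop n (\<zeta> t)" for t x
    proof
      assume "length x = n \<and> (\<exists>y. length y = n \<and> t # (y @ x) \<in> {t # \<zeta> t |t. t \<in> J'})"
      then obtain y where "length y = n" "t \<in> J'" "y @ x = \<zeta> t" by auto
      then show "t \<in> J' \<and> x = drop n (\<zeta> t)" by (metis append_eq_conv_conj)
    next
      assume h: "t \<in> J' \<and> x = drop n (\<zeta> t)"
      then have "length (\<zeta> t) = n + n" using R by blast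
      then show "length x = n \<and> (\<exists>y. length y = n \<and> t # (y @ x) \<in> {t # \<zeta> t |t. t \<in> J'})"
        using h by (intro conjI exI[of _ "take n (\<zeta> t)"]) auto
    qed
    then show "{t # drop n (\<zeta> t) |t. t \<in> J'} = {t # x |t x. length x = n \<and> (\<exists>y. length y = n \<and> t # (y @ x) \<in> {t # \<zeta> t |t. t \<in> J'})}"
      by (simp only:) blast
  qed auto
  then have "curve J' (\<lambda>t. drop n (\<zeta> t)) B" using R by (auto simp: curve_def)
  then obtain m where m: "m \<in> B" "limitin T (\<lambda>t. drop n (\<zeta> t)) m F" using assms(2) J'(2) unfolding has_limits_def by blast
  have "limitin (prod_topology T T) (\<lambda>t. (take n (\<zeta> t), drop n (\<zeta> t))) (l, m) F"
    unfolding limitin_pairwise using l(2) m(2) by (simp add: comp_def)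
  from continuous_map_limit[OF cont_mult this]
  have "limitin T ((\<lambda>(x, y). x \<otimes> y) \<circ> (\<lambda>t. (take n (\<zeta> t), drop n (\<zeta> t)))) (l \<otimes> m) F" by simp
  moreover have "eventually (\<lambda>t. ((\<lambda>(x, y). x \<otimes> y) \<circ> (\<lambda>t. (take n (\<zeta> t), drop n (\<zeta> t)))) t = \<gamma> t) F"
    by (rule eventually_mono[OF interval_end_facts(1)[OF J'(2)]]) (use R in simp)
  ultimately have "limitin T \<gamma> (l \<otimes> m) F" by (rule limitin_transform_eventually[rotated])
  then show "\<exists>l\<in>A <#> B. limitin T \<gamma> l F" using l(1) m(1) unfolding set_mult_def by blast
qed

text \<open>A curve in \<open>K\<close> that is continuous for \<open>TK\<close> may jump in
  \<open>T\<close>, but it is still a definable curve in one of the sets \<open>Zk k\<close>, and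
  this is all that the existence of a limit in \<open>U\<close> requires.\<close>

lemma definably_compact_KG:
  assumes Z: "definably_compact M n T Z" and gen: "generate U Z = carrier U"
  shows "definably_compact M n TK K"
proof -
  have dZ: "dsub Z" using Z topspace_T by (simp add: definably_compact_def dsub_def)
  define Z1 where "Z1 = Z \<union> m_inv U ` Z \<union> {\<one>}"
  have d1: "dsub {\<one>}" by (rule dsub_finite) auto
  have dZ1: "dsub Z1" unfolding Z1_def by (intro dsub_Un dZ dsub_inv d1)
  have lZ1: "has_limits F Z1" for F
    unfolding Z1_def by (intro has_limits_Un has_limits_inv has_limits_compact[OF Z] has_limits_one dsub_Un dZ dsub_inv d1)
  define Zk where "Zk k = ((\<lambda>C. C <#> Z1) ^^ k) {\<one>}" for k :: nat
  have Zk_Suc: "Zk (Suc k) = Zk k <#> Z1" for k by (simp add: Zk_def)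
  have dZk: "dsub (Zk k)" for k by (induction k) (simp add: Zk_def d1, simp add: Zk_Suc dsub_mult dZ1)
  have lZk: "has_limits F (Zk k)" for F k
    by (induction k) (simp add: Zk_def has_limits_one, simp add: Zk_Suc has_limits_mult lZ1 dZk dZ1)
  have Zkc: "x \<in> carrier U" if "x \<in> Zk k" for x k using dZk that by (auto simp: dsub_def)
  have Z1c: "x \<in> carrier U" if "x \<in> Z1" for x using dZ1 that by (auto simp: dsub_def)
  have mono1: "Zk k \<subseteq> Zk (Suc k)" for k
  proof
    fix x assume x: "x \<in> Zk k"
    have "x \<otimes> \<one> \<in> Zk k <#> Z1" unfolding set_mult_def Z1_def using x by blast
    then show "x \<in> Zk (Suc k)" using Zkc[OF x] by (simp add: Zk_Suc)
  qed
  have mono: "Zk j \<subseteq> Zk k" if "j \<le> k" for j k using lift_Suc_mono_le[of Zk, OF mono1 that] .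
  have add: "x \<otimes> y \<in> Zk (j + k)" if "x \<in> Zk j" "y \<in> Zk k" for x y j k
    using that(2)
  proof (induction k arbitrary: y)
    case 0
    then have "y = \<one>" by (simp add: Zk_def)
    then show ?case using that(1) Zkc[OF that(1)] by simp
  next
    case (Suc k)
    then obtain a b where ab: "a \<in> Zk k" "b \<in> Z1" "y = a \<otimes> b" unfolding Zk_Suc set_mult_def by blast
    have "x \<otimes> a \<in> Zk (j + k)" by (rule Suc.IH[OF ab(1)])
    then have "(x \<otimes> a) \<otimes> b \<in> Zk (j + k) <#> Z1" unfolding set_mult_def using ab(2) by blast
    then show ?case using ab Zkc[OF that(1)] Zkc[OF ab(1)] Z1c[OF ab(2)] by (simp add: Zk_Suc m_assoc)
  qed
  have Z1k: "x \<in> Zk 1" if "x \<in> Z1" for x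
  proof -
    have "\<one> \<otimes> x \<in> {\<one>} <#> Z1" unfolding set_mult_def using that by blast
    then show ?thesis using Z1c[OF that] by (simp add: Zk_def)
  qed
  have all: "\<exists>k. x \<in> Zk k" if x: "x \<in> generate U Z" for x
    using x
  proof induction
    case one
    have "\<one> \<in> Zk 0" by (simp add: Zk_def)
    then show ?case by blast
  next
    case (incl h)
    have "h \<in> Z1" using incl by (simp add: Z1_def)
    then show ?case using Z1k by blast
  next
    case (inv h)
    have "inv h \<in> Z1" using inv by (simp add: Z1_def)
    then show ?case using Z1k by blast
  next
    case (eng a b)
    then show ?case using add by blast
  qed
  obtain \<F> where \<F>: "\<F> \<subseteq> range Zk" "finite \<F>" "K \<subseteq> \<Union>\<F>"
  proof (rule definable_finite_cover[OF suff_sat, of n K "range Zk"])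
    show "K \<subseteq> \<Union> (range Zk)" using all K_carrier unfolding gen by blast
    show "small \<kappa> (range Zk)" by (rule small_countable[OF suff_sat]) simp
  qed (use dsub_K dZk in \<open>auto simp: dsub_def\<close>)
  obtain ks where ks: "finite ks" "\<F> = Zk ` ks" using finite_subset_image[OF \<F>(2,1)] by blast
  have KZ: "K \<subseteq> Zk (Max (insert 0 ks))"
  proof
    fix x assume "x \<in> K"
    then obtain k where k: "k \<in> ks" "x \<in> Zk k" using \<F>(3) ks(2) by blast
    then have "k \<le> Max (insert 0 ks)" using ks(1) by simp
    then show "x \<in> Zk (Max (insert 0 ks))" using mono k(2) by blast
  qed
  show ?thesis
    unfolding definably_compact_def
  proof (intro conjI allI impI)
    show "definable M n K" using dsub_K by (simp add: dsub_def)
    show "K \<subseteq> topspace TK" by (simp add: topspace_TK)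
    fix I F \<gamma> assume h: "interval_end I F \<and> \<gamma> ` I \<subseteq> K \<and> definable M (1 + n) {t # \<gamma> t |t. t \<in> I} \<and> continuous_map (top_of_set I) TK \<gamma>"
    then have "curve I \<gamma> (Zk (Max (insert 0 ks)))" using KZ unfolding curve_def by blast
    with lZk[of F "Max (insert 0 ks)"] h have "\<exists>l\<in>Zk (Max (insert 0 ks)). limitin T \<gamma> l F"
      unfolding has_limits_def by (elim allE[of _ I] allE[of _ \<gamma>] impE) simp_all
    then obtain l where l: "l \<in> Zk (Max (insert 0 ks))" "limitin T \<gamma> l F" by (rule bexE)
    \<comment> \<open>The limit \<open>l\<close> taken in \<open>U\<close> need not lie in
      \<open>K\<close>. Since the curve consists of representatives it is fixed by
      \<open>\<mu>\<close>, so it converges to \<open>\<mu> l\<close> in the quotient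
      topology.\<close>
    have "limitin TK (\<mu> \<circ> \<gamma>) (\<mu> l) F" by (rule continuous_map_limit[OF cont_\<mu> l(2)])
    moreover have "eventually (\<lambda>t. (\<mu> \<circ> \<gamma>) t = \<gamma> t) F"
      by (rule eventually_mono[OF interval_end_facts(1)[of I F]]) (use h \<mu>_K in auto)
    ultimately have "limitin TK \<gamma> (\<mu> l) F" by (rule limitin_transform_eventually[rotated])
    moreover have "\<mu> l \<in> K" using \<mu>(1) Zkc[OF l(1)] by blast
    ultimately show "\<exists>l\<in>K. limitin TK \<gamma> l F" by blast
  qed
qed

end

text \<open>In a trivial structure some interval is empty while \<open>at_top\<close> is proper, so no set is
  definably compact in the sense of the definition.\<close>

lemma not_definably_compact_trivial:
  fixes M :: "('a::linordered_group_add, 'f, 'r) interp"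
  assumes triv: "\<And>a::'a. a = 0" and top: "\<And>x. x \<in> topspace T \<Longrightarrow> length x = n"
  shows "\<not> definably_compact M n T Z"
proof
  assume Z: "definably_compact M n T Z"
  let ?\<gamma> = "\<lambda>t::'a. replicate (Suc n) (0::'a)"
  have emp: "{(0::'a)<..} = {}" using triv by (metis empty_iff equals0I greaterThan_iff less_irrefl)
  have "definable M (1 + n) {t # ?\<gamma> t |t. t \<in> {(0::'a)<..}}" unfolding emp by (simp add: definable_empty)
  moreover have "continuous_map (top_of_set {(0::'a)<..}) T ?\<gamma>" unfolding emp by (simp add: continuous_map_def)
  moreover have "?\<gamma> ` {(0::'a)<..} \<subseteq> Z" unfolding emp by simp
  ultimately obtain l where l: "l \<in> Z" "limitin T ?\<gamma> l at_top"
    using Z interval_end.intros(4)[of "0::'a"] unfolding definably_compact_def by blast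
  then have "eventually (\<lambda>t::'a. ?\<gamma> t \<in> topspace T) at_top" unfolding limitin_def by blast
  then have "replicate (Suc n) (0::'a) \<in> topspace T" by (auto simp: eventually_at_top_linorder)
  then show False using top by fastforce
qed

theorem theorem3p10:
  fixes \<kappa> :: "'k rel"
    and M :: "('a::linordered_group_add, 'f, 'r) interp"
    and n :: nat
    and U :: "'a list monoid"
    and T :: "'a list topology"
    and X \<Lambda> :: "'a list set"
  assumes "sufficiently_saturated \<kappa> M"
    and "o_minimal M"
    and "vdef_group \<kappa> M n U"
    and "comm_group U"
    and "canonical_group_topology \<kappa> M n U T"
    and "vconnected \<kappa> M n (carrier U) T"
    and "definably_generated M n U"
    and "definable M n X"
    and "X \<subseteq> carrier U"
    and "subgroup \<Lambda> U"
    and "finitely_generated_subgroup U \<Lambda>"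
    and "X <#>\<^bsub>U\<^esub> \<Lambda> = carrier U"
  shows "\<exists>\<Lambda>'. subgroup \<Lambda>' U \<and> \<Lambda>' \<subseteq> \<Lambda> \<and>
           (\<exists>m K. definable_quotient M n U \<Lambda>' m K \<and>
              ((\<exists>Z. definably_compact M n T Z \<and> generate U Z = carrier U) \<longrightarrow>
                 definably_compact_group \<kappa> M m K))"
proof -
  interpret comm_group U by (rule assms(4))
  interpret vgroup U \<kappa> M n by unfold_locales (rule assms)+
  obtain S where S: "finite S" "S \<subseteq> carrier U" "\<Lambda> = generate U S"
    using assms(11) unfolding finitely_generated_subgroup_def by blast
  have X: "dsub X" using assms(8,9) by (simp add: dsub_def)
  have XL: "carrier U \<subseteq> X <#>\<^bsub>U\<^esub> generate U S" using assms(12) S(3) by simp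
  have "\<exists>N Y. subgroup N U \<and> N \<subseteq> generate U S \<and> (\<forall>Z. dsub Z \<longrightarrow> finite (N \<inter> Z)) \<and> dsub Y \<and> carrier U \<subseteq> Y <#>\<^bsub>U\<^esub> N"
    by (rule exists_lattice[OF X S(1,2) XL]) blast
  then obtain N Y where N: "subgroup N U" "N \<subseteq> generate U S" "\<forall>Z. dsub Z \<longrightarrow> finite (N \<inter> Z)"
    and Y: "dsub Y" "carrier U \<subseteq> Y <#>\<^bsub>U\<^esub> N"
    by blast
  interpret vlattice U \<kappa> M n N Y
    by (rule vlattice.intro[OF vgroup_axioms vlattice_axioms.intro]) (use N Y in auto)
  have "definably_compact_group \<kappa> M n KG" if ex: "\<exists>Z. definably_compact M n T Z \<and> generate U Z = carrier U"
  proof -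
    obtain Z where Z: "definably_compact M n T Z" "generate U Z = carrier U" using ex by blast
    have top: "topspace T = carrier U" using assms(5) unfolding canonical_group_topology_def by blast
    \<comment> \<open>The topological part needs a nontrivial structure. In a trivial one no set is
      definably compact, so the generating set \<open>Z\<close> could not exist.\<close>
    have "\<exists>a::'a. a \<noteq> 0"
    proof (rule ccontr)
      assume "\<not> (\<exists>a::'a. a \<noteq> 0)"
      then have "\<And>a::'a. a = 0" by blast
      moreover have "length x = n" if "x \<in> topspace T" for x using that length_carrier top by simp
      ultimately show False using not_definably_compact_trivial Z(1) by blast
    qed
    then interpret vtop U \<kappa> M n N Y T by unfold_locales (use assms in auto)
    show ?thesis unfolding definably_compact_group_def KG_simps(1)
      using canonical_KG definably_compact_KG[OF Z] by blast
  qed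
  then show ?thesis using N(1,2) S(3) definable_quotient_KG by blast
qed

end
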